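(* Let $\mathsf H$ be a separable real Hilbert space, let $\mathsf W\colon\mathsf H\to 2^{\mathsf H}$ be maximally monotone, let $\alpha\in\,]0,+\infty[$, let $\mathsf C\colon\mathsf H\to\mathsf H$ be $\alpha$-cocoercive, and suppose that $\mathsf Z=\operatorname{zer}(\mathsf W+\mathsf C)\neq\varnothing$. Let $(x_n)_{n\in\mathbb N}$ be the sequence generated by the stochastic algorithm described in the context (with the associated variables $w_n,w_n^*,e_n,e_n^*,q_n,c_n^*,f_n^*,t_n^*,\Delta_n,\theta_n,d_n,\lambda_n$ and $\sigma$-algebras $\mathcal X_n$). For every $n\in\mathbb N$ and every $\mathsf z\in\mathsf Z$, set $$\varepsilon_n(\cdot,\mathsf z)=\max\Big\{0,\ \mathsf E\Big(\theta_n\big(\langle w_n-\mathsf z\mid e_n^*+f_n^*\rangle+\langle e_n\mid w_n^*+\mathsf C\mathsf z\rangle+\langle e_n\mid e_n^*\rangle\big)\,\Big|\,\mathcal X_n\Big)\Big\},$$ and suppose that, for every $n\in\mathbb N$, $\lambda_n$ is independent of $\sigma(\{x_0,\ldots,x_n,d_n\})$ and $\mathsf E(\lambda_n(2-\lambda_n))\ge 0$. Then the following hold: (i) Let $n\in\mathbb N$ and $\mathsf z\in\mathsf Z$. Then $$\big\langle \mathsf z\mid \mathsf E(\theta_nt_n^*\mid\mathcal X_n)\big\rangle\le \mathsf E\big(\theta_n\langle w_n\mid t_n^*\rangle\mid\mathcal X_n\big)+\frac1{4\alpha}\mathsf E\big(\theta_n\|w_n-q_n\|^2\mid\mathcal X_n\big)+\varepsilon_n(\cdot,\mathsf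 z)\quad\mathsf P\text{-a.s.}$$ (ii) $(x_n)_{n\in\mathbb N}$ lies in $L^2(\Omega,\mathcal F,\mathsf P;\mathsf H)$. (iii) Suppose that, for every $\mathsf z\in\mathsf Z$, $\sum_{n\in\mathbb N}\mathsf E\varepsilon_n(\cdot,\mathsf z)\,\mathsf E\lambda_n<+\infty$. Then the following are satisfied: (a) $(\|x_n\|)_{n\in\mathbb N}$ is bounded $\mathsf P$-a.s. and $(\mathsf E\|x_n\|^2)_{n\in\mathbb N}$ is bounded. (b) $\sum_{n\in\mathbb N}\mathsf E(\lambda_n(2-\lambda_n))\,\mathsf E\|d_n\|^2<+\infty$. (c) Suppose that $\inf_{n\in\mathbb N}\mathsf E(\lambda_n(2-\lambda_n))>0$. Then $\sum_{n\in\mathbb N}\mathsf E\|x_{n+1}-x_n\|^2<+\infty$. (d) Suppose that $\inf_{n\in\mathbb N}\lambda_n>0$ $\mathsf P$-a.s. and that $(t_n^* )_{n\in\mathbb N}$ is bounded $\mathsf P$-a.s. Then $\varlimsup\Delta_n\le 0$ $\mathsf P$-a.s. (e) Suppose that $x_n-w_n-e_n\rightharpoonup 0$ $\mathsf P$-a.s., $w_n+e_n-q_n\to 0$ $\mathsf P$-a.s., and $w_n^*+e_n^*+\mathsf Cq_n\to 0$ $\mathsf P$-a.s. Then $(x_n)_{n\in\mathbb N}$ converges weakly $\mathsf P$-a.s. and weakly in $L^2(\Omega,\mathcal F,\mathsf P;\mathsf H)$ to a $\mathsf Z$-valued random variable. (f) Suppose that $\dim\mathsf H<+\infty$, and that $x_n-w_n-e_n$,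 $w_n+e_n-q_n$, and $w_n^*+e_n^*+\mathsf Cq_n$ all converge to $0$ in probability. Then $(x_n)_{n\in\mathbb N}$ converges $\mathsf P$-a.s. and in $L^1(\Omega,\mathcal F,\mathsf P;\mathsf H)$ to a $\mathsf Z$-valued random variable.
   Context: $(\Omega,\mathcal F,\mathsf P)$ is a complete probability space. For $p\in[1,+\infty[$, $L^p(\Omega,\mathcal F,\mathsf P;\mathsf H)$ is the space of (classes of a.s. equal) $\mathsf H$-valued Borel random variables $x$ with $\mathsf E\|x\|^p<+\infty$. $\mathsf E(\cdot\mid\mathcal X)$ is conditional expectation, and $\sigma(\Phi)$ is the $\sigma$-algebra generated by a family $\Phi$ of random variables. $\rightharpoonup$ denotes weak convergence and $\to$ strong convergence in $\mathsf H$; $x_n$ converges to $x$ in probability if $\mathsf P([\|x_n-x\|>\epsilon])\to0$ for every $\epsilon>0$. A random variable is $\mathsf Z$-valued if it belongs to $\mathsf Z$ $\mathsf P$-a.s. $\operatorname{zer}\mathsf M=\{\mathsf x\mid 0\in\mathsf M\mathsf x\}$, $\operatorname{gra}\mathsf M=\{(\mathsf x,\mathsf x^* )\mid\mathsf x^*\in\mathsf M\mathsf x\}$. $\mathsf C\colon\mathsf H\to\mathsf H$ is $\alpha$-cocoercive if $\langle\mathsf x-\mathsf y\mid\mathsf C\mathsf x-\mathsf C\mathsf y\rangle\ge\alpha\|\mathsf C\mathsf x-\mathsf C\mathsf y\|^2$ for all $\mathsf x,\mathsf y\in\mathsf H$. Stochastic algorithm. Let $\rho\in[2,+\infty[$ and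 $x_0\in L^2(\Omega,\mathcal F,\mathsf P;\mathsf H)$. For $n=0,1,\ldots$: 1. $\mathcal X_n=\sigma(x_0,\ldots,x_n)$. 2. Take $w_n,w_n^*,e_n,e_n^*\in L^2(\Omega,\mathcal F,\mathsf P;\mathsf H)$ such that $(w_n+e_n,\,w_n^*+e_n^* )\in\operatorname{gra}\mathsf W$ $\mathsf P$-a.s. 3. Take $q_n,c_n^*,f_n^*\in L^2(\Omega,\mathcal F,\mathsf P;\mathsf H)$ such that $c_n^*+f_n^*=\mathsf Cq_n$ $\mathsf P$-a.s. 4. $t_n^*=w_n^*+c_n^*$. 5. $\Delta_n=\langle x_n-w_n\mid t_n^*\rangle-(4\alpha)^{-1}\|w_n-q_n\|^2$. 6. $\theta_n=\dfrac{\mathsf 1_{[t_n^*\ne0]}\mathsf 1_{[\Delta_n>0]}\Delta_n}{\|t_n^*\|^2+\mathsf 1_{[t_n^*=0]}}$. 7. $d_n=\theta_nt_n^*$. 8. Take $\lambda_n\in L^\infty(\Omega,\mathcal F,\mathsf P;\,]0,\rho])$, i.e., an essentially bounded real random variable with values in $]0,\rho]$ a.s. 9. $x_{n+1}=x_n-\lambda_nd_n$.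
   Formalization: Item (iii)(d) is false as printed (H=R, W the normal cone of {0}, C=0, λ_n=2, x_0=1, w_n=q_n=0, w_n*=t_n*=(-1)^n gives Δ_n=1); the formal (d) also assumes inf_n E(λ_n(2-λ_n))>0, the hypothesis of (c). *)

theory Defs
  imports "HOL-Probability.Probability"
begin

section \<open>Set-valued operators\<close>

definition gra :: "('a \<Rightarrow> 'b set) \<Rightarrow> ('a \<times> 'b) set" where
  "gra A = {(x, u). u \<in> A x}"

definition zer :: "('a \<Rightarrow> 'b::zero set) \<Rightarrow> 'a set" where
  "zer A = {x. 0 \<in> A x}"

definition monotone_operator :: "('a::real_inner \<Rightarrow> 'a set) \<Rightarrow> bool" where
  "monotone_operator A \<longleftrightarrow>
     (\<forall>(x, u) \<in> gra A. \<forall>(y, v) \<in> gra A. 0 \<le> inner (x - y) (u - v))"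

definition maximally_monotone :: "('a::real_inner \<Rightarrow> 'a set) \<Rightarrow> bool" where
  "maximally_monotone A \<longleftrightarrow>
     monotone_operator A \<and> (\<nexists>B. monotone_operator B \<and> gra A \<subset> gra B)"

definition cocoercive :: "real \<Rightarrow> ('a::real_inner \<Rightarrow> 'a) \<Rightarrow> bool" where
  "cocoercive \<alpha> C \<longleftrightarrow> (\<forall>x y. \<alpha> * (norm (C x - C y))\<^sup>2 \<le> inner (x - y) (C x - C y))"

definition operator_plus :: "('a \<Rightarrow> 'b::plus set) \<Rightarrow> ('a \<Rightarrow> 'b) \<Rightarrow> 'a \<Rightarrow> 'b set" where
  "operator_plus A C x = {u + C x | u. u \<in> A x}"


section \<open>Random variables, \<open>L\<^sup>p\<close> and modes of convergence\<close>

text \<open>Elements of \<open>L\<^sup>p\<close> are handled through representatives; identities between them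
  are stated almost everywhere.\<close>

definition Lp :: "real \<Rightarrow> 'w measure \<Rightarrow> ('w \<Rightarrow> 'a::real_normed_vector) set" where
  "Lp p M = {x \<in> borel_measurable M. integrable M (\<lambda>\<omega>. norm (x \<omega>) powr p)}"

definition Lp_converges ::
    "real \<Rightarrow> 'w measure \<Rightarrow> (nat \<Rightarrow> 'w \<Rightarrow> 'a::real_normed_vector) \<Rightarrow> ('w \<Rightarrow> 'a) \<Rightarrow> bool" where
  "Lp_converges p M x y \<longleftrightarrow>
     (\<forall>n. x n \<in> Lp p M) \<and> y \<in> Lp p M \<and>
     (\<lambda>n. LINT \<omega>|M. norm (x n \<omega> - y \<omega>) powr p) \<longlonglongrightarrow> 0"

definition weakly_converges :: "(nat \<Rightarrow> 'a::real_inner) \<Rightarrow> 'a \<Rightarrow> bool" where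
  "weakly_converges x y \<longleftrightarrow> (\<forall>u. (\<lambda>n. inner (x n) u) \<longlonglongrightarrow> inner y u)"

definition L2_weakly_converges ::
    "'w measure \<Rightarrow> (nat \<Rightarrow> 'w \<Rightarrow> 'a::real_inner) \<Rightarrow> ('w \<Rightarrow> 'a) \<Rightarrow> bool" where
  "L2_weakly_converges M x y \<longleftrightarrow>
     (\<forall>n. x n \<in> Lp 2 M) \<and> y \<in> Lp 2 M \<and>
     (\<forall>u \<in> Lp 2 M. (\<lambda>n. LINT \<omega>|M. inner (x n \<omega>) (u \<omega>)) \<longlonglongrightarrow> (LINT \<omega>|M. inner (y \<omega>) (u \<omega>)))"

definition converges_in_probability ::
    "'w measure \<Rightarrow> (nat \<Rightarrow> 'w \<Rightarrow> 'a::real_normed_vector) \<Rightarrow> ('w \<Rightarrow> 'a) \<Rightarrow> bool" where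
  "converges_in_probability M x y \<longleftrightarrow>
     (\<forall>\<epsilon>>0. (\<lambda>n. measure M {\<omega> \<in> space M. \<epsilon> < norm (x n \<omega> - y \<omega>)}) \<longlonglongrightarrow> 0)"

definition sigma_rv :: "'w measure \<Rightarrow> ('w \<Rightarrow> 'a::topological_space) set \<Rightarrow> 'w measure" where
  "sigma_rv M \<Phi> = sigma (space M) {\<phi> -` A \<inter> space M | \<phi> A. \<phi> \<in> \<Phi> \<and> A \<in> sets borel}"


section \<open>Conditional expectation\<close>

text \<open>A version of the conditional expectation of a vector-valued integrable \<open>f\<close>
  (the library only has the scalar case).\<close>

definition cond_exp ::
    "'w measure \<Rightarrow> 'w measure \<Rightarrow> ('w \<Rightarrow> 'a) \<Rightarrow> 'w \<Rightarrow> 'a::{banach, second_countable_topology}" where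
  "cond_exp M F f =
     (SOME g. g \<in> borel_measurable F \<and> integrable M g \<and>
        (\<forall>A \<in> sets F. (LINT \<omega>:A|M. g \<omega>) = (LINT \<omega>:A|M. f \<omega>)))"

text \<open>Conditional expectation, as an extended real, of a measurable real-valued \<open>f\<close> whose
  negative part is integrable. For integrable \<open>f\<close> it agrees almost everywhere with
  \<^const>\<open>real_cond_exp\<close>. The latter replaces the value \<open>\<infinity>\<close> by \<open>0\<close>, so it
  cannot be used when the positive part of \<open>f\<close> is not integrable.\<close>

definition ereal_cond_exp :: "'w measure \<Rightarrow> 'w measure \<Rightarrow> ('w \<Rightarrow> real) \<Rightarrow> 'w \<Rightarrow> ereal" where
  "ereal_cond_exp M F f \<omega> =
     enn2ereal (nn_cond_exp M F (\<lambda>\<omega>. ennreal (f \<omega>)) \<omega>) -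
     enn2ereal (nn_cond_exp M F (\<lambda>\<omega>. ennreal (- f \<omega>)) \<omega>)"

end

theory Submission
  imports Defs "HOL-Library.Diagonal_Subsequence"
begin

text \<open>Monotonicity of \<open>W\<close> and cocoercivity of \<open>C\<close> show that, up to the error terms, the half-space
  \<open>{v. inner (v - w\<^sub>n) t\<^sub>n \<le> (4 \<alpha>)\<^sup>-\<^sup>1 \<parallel>w\<^sub>n - q\<^sub>n\<parallel>\<^sup>2}\<close> contains \<open>Z\<close>, and \<open>x\<^sub>n - d\<^sub>n\<close> is
  the projection of \<open>x\<^sub>n\<close> onto it. As \<open>\<lambda>\<^sub>n\<close> is independent of \<open>(x\<^sub>0, \<dots>, x\<^sub>n, d\<^sub>n)\<close>, this makes
  \<open>\<parallel>x\<^sub>n - z\<parallel>\<^sup>2\<close>, for every \<open>z \<in> Z\<close>, a nonnegative supermartingale up to summable errors: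
  for \<open>A \<in> \<X>\<^sub>n\<close> its integral over \<open>A\<close> increases by at most the \<open>n\<close>-th error. Doob's upcrossing
  argument needs no more than this and yields almost sure convergence, while the expected decrease
  gives the summability claims. Weak convergence is then Opial's argument, since weak
  cluster points lie in \<open>Z\<close>.\<close>

section \<open>Weak convergence in a separable Hilbert space\<close>

text \<open>The weight \<open>\<theta> n\<close> is not bounded, so the error expression need not be
  integrable and its conditional expectation may be infinite. The integrable quantity is
  \<open>gap\<close>, which the error expression dominates; it alone is integrated, and the error
  enters only as an upper bound in the extended reals. The relaxation \<open>lam n\<close> may
  exceed 2, so the distances to \<open>Z\<close> need not decrease along a path. The decrease
  appears after integration, where independence separates \<open>lam n\<close> and its square from
  the step. The constant \<open>1 / (4 * \<alpha>)\<close> is the one for which the square left over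
  by Young's inequality is absorbed exactly by cocoercivity. Each \<open>z\<close> in
  \<open>Z\<close> has its own exceptional null set; a countable dense subset of \<open>Z\<close>
  reduces them to one. Convergence in probability makes the residuals vanish almost surely only
  along a subsequence. One strong cluster point in \<open>Z\<close> is then enough, because the
  distance to it converges along the whole sequence. In (i) the vector-valued
  \<open>cond_exp\<close> is a choice, so its existence has to be proved.\<close>

lemma riesz_representation:
  fixes l :: "'a::{real_inner, complete_space} \<Rightarrow> real"
  assumes "bounded_linear l"
  shows "\<exists>y. \<forall>u. l u = inner y u"
proof -
  interpret l: bounded_linear l by fact
  \<comment> \<open>The representing vector will be the minimiser of this functional: the
    parallelogram law makes a minimising sequence Cauchy, and stationarity at the minimum is the
    desired identity.\<close>
  define J where "J u = (norm u)\<^sup>2 - 2 * l u" for u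
  obtain K where K: "\<And>u. norm (l u) \<le> norm u * K"
    using l.bounded by blast
  have J_ge: "- K\<^sup>2 \<le> J u" for u
  proof -
    have "l u \<le> norm u * K"
      using K[of u] by simp
    moreover have "0 \<le> (norm u - K)\<^sup>2"
      by simp
    ultimately show ?thesis
      unfolding J_def by (simp add: power2_diff mult.commute)
  qed
  have bdd: "bdd_below (range J)"
    using J_ge by (intro bdd_belowI[of _ "- K\<^sup>2"]) auto
  define m where "m = Inf (range J)"
  have m_le: "m \<le> J u" for u
    unfolding m_def using bdd by (intro cInf_lower) auto
  have "\<exists>u. J u < m + inverse (real (Suc n))" for n
  proof -
    have "m < m + inverse (real (Suc n))"
      by simp
    then show ?thesis
      unfolding m_def by (subst (asm) (1) cInf_less_iff) (use bdd in auto)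
  qed
  then obtain u where u: "\<And>n. J (u n) < m + inverse (real (Suc n))"
    by metis
  have parallelogram: "(norm (a - b))\<^sup>2 = 2 * J a + 2 * J b - 4 * J ((1/2) *\<^sub>R (a + b))" for a b
    unfolding J_def
    by (simp add: l.scaleR l.add power2_norm_eq_inner inner_diff_left inner_diff_right
        inner_add_left inner_add_right inner_commute algebra_simps)
  have "Cauchy u"
  proof (rule metric_CauchyI)
    fix \<epsilon> :: real assume "\<epsilon> > 0"
    \<comment> \<open>Both values of \<open>J\<close> exceed \<open>m\<close> by less than
      \<open>inverse N\<close>, and the value at the midpoint is at least \<open>m\<close>. So the
      squared distance is below \<open>4 * inverse N\<close>, whence the bound
      \<open>\<epsilon>\<^sup>2 / 4\<close>.\<close>
    then obtain N where N: "N > 0" "inverse (real N) < \<epsilon>\<^sup>2 / 4"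
      using ex_inverse_of_nat_less[of "\<epsilon>\<^sup>2 / 4"] by auto
    show "\<exists>M. \<forall>i\<ge>M. \<forall>j\<ge>M. dist (u i) (u j) < \<epsilon>"
    proof (intro exI allI impI)
      fix i j assume ij: "i \<ge> N" "j \<ge> N"
      have "inverse (real (Suc k)) \<le> inverse (real N)" if "k \<ge> N" for k
        using that N by (intro le_imp_inverse_le) auto
      note this[OF ij(1)] this[OF ij(2)]
      then have "(norm (u i - u j))\<^sup>2 < \<epsilon>\<^sup>2"
        unfolding parallelogram using u[of i] u[of j] N m_le[of "(1/2) *\<^sub>R (u i + u j)"] by linarith
      then show "dist (u i) (u j) < \<epsilon>"
        unfolding dist_norm using \<open>\<epsilon> > 0\<close> by (simp add: power_less_imp_less_base)
    qed
  qed
  then obtain y where y: "u \<longlonglongrightarrow> y"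
    using Cauchy_convergent convergent_def by blast
  have "(\<lambda>n. J (u n)) \<longlonglongrightarrow> J y"
    unfolding J_def by (intro tendsto_intros l.tendsto y)
  moreover have "(\<lambda>n. m + inverse (real (Suc n))) \<longlonglongrightarrow> m + 0"
    by (intro tendsto_intros LIMSEQ_inverse_real_of_nat)
  ultimately have "J y \<le> m + 0"
    by (rule LIMSEQ_le) (use u in \<open>auto intro: less_imp_le\<close>)
  then have min: "J y \<le> J v" for v
    using m_le[of v] by simp
  have "l v = inner y v" for v
  proof (cases "v = 0")
    case False
    define c where "c = inner y v - l v"
    \<comment> \<open>The minimiser of the quadratic
      \<open>t\<^sup>2 * (norm v)\<^sup>2 + 2 * t * c\<close>; its negative minimum would contradict
      minimality of \<open>y\<close> unless \<open>c = 0\<close>.\<close>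
    define t where "t = - c / (norm v)\<^sup>2"
    have "J (y + t *\<^sub>R v) = J y + t\<^sup>2 * (norm v)\<^sup>2 + 2 * t * c"
      unfolding J_def c_def power2_norm_eq_inner
      by (simp add: l.scaleR l.add inner_add_left inner_add_right inner_commute
          power2_eq_square algebra_simps)
    moreover have "t\<^sup>2 * (norm v)\<^sup>2 + 2 * t * c = - (c\<^sup>2 / (norm v)\<^sup>2)"
      using False unfolding t_def by (simp add: power2_eq_square field_simps)
    ultimately have "c\<^sup>2 / (norm v)\<^sup>2 \<le> 0"
      using min[of "y + t *\<^sub>R v"] by linarith
    then show ?thesis
      using False unfolding c_def by (simp add: divide_le_0_iff)
  qed (simp add: l.zero)
  then show ?thesis
    by blast
qed

text \<open>A diagonal subsequence makes the inner products with a countable dense set of directions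
  converge. The norm bound extends this to all directions, and the limit functional is bounded,
  hence represented by a vector.\<close>

lemma weakly_convergent_subsequence:
  fixes x :: "nat \<Rightarrow> 'a::{real_inner, banach, second_countable_topology}"
  assumes "bounded (range x)"
  shows "\<exists>r y. strict_mono (r::nat \<Rightarrow> nat) \<and> weakly_converges (x \<circ> r) y"
proof -
  obtain D :: "'a set" where D: "countable D" "\<And>X. open X \<Longrightarrow> X \<noteq> {} \<Longrightarrow> \<exists>d\<in>D. d \<in> X"
    using countable_dense_setE by blast
  have "D \<noteq> {}"
    using D(2)[of UNIV] by auto
  define h where "h = from_nat_into D"
  have range_h: "range h = D"
    unfolding h_def using D \<open>D \<noteq> {}\<close> by simp
  obtain K where K: "\<And>n. norm (x n) \<le> K"
    using assms unfolding bounded_iff by auto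
  have K0: "0 \<le> K"
    using K[of 0] norm_ge_zero order_trans by blast
  have inner_le: "\<bar>inner (x n) u\<bar> \<le> K * norm u" for n u
    using Cauchy_Schwarz_ineq2[of "x n" u] K[of n] mult_right_mono[of "norm (x n)" K "norm u"]
    by simp
  interpret subseqs "\<lambda>n s. convergent (\<lambda>i. inner (x (s i)) (h n))"
  proof
    fix n and s :: "nat \<Rightarrow> nat" assume "strict_mono s"
    have "bounded (range (\<lambda>i. inner (x (s i)) (h n)))"
      using inner_le unfolding bounded_iff by auto
    then obtain l r where "strict_mono r" "((\<lambda>i. inner (x (s i)) (h n)) \<circ> r) \<longlonglongrightarrow> l"
      using bounded_imp_convergent_subsequence by blast
    then show "\<exists>r. strict_mono r \<and> convergent (\<lambda>i. inner (x ((s \<circ> r) i)) (h n))"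
      unfolding convergent_def o_def by blast
  qed
  have conv_h: "convergent (\<lambda>i. inner (x (diagseq i)) (h n))" for n
  proof -
    \<comment> \<open>Only a tail of the diagonal sequence is a subsequence of the
      \<open>n\<close>-th refinement; dropping finitely many terms does not affect
      convergence.\<close>
    have "convergent (\<lambda>i. inner (x ((diagseq \<circ> (+) (Suc n)) i)) (h n))"
    proof (rule diagseq_holds)
      fix r s :: "nat \<Rightarrow> nat" and n
      assume "strict_mono r" "convergent (\<lambda>i. inner (x (s i)) (h n))"
      then show "convergent (\<lambda>i. inner (x ((s \<circ> r) i)) (h n))"
        using convergent_subseq_convergent[of "\<lambda>i. inner (x (s i)) (h n)" r]
        by (simp add: o_def)
    qed
    then have "convergent (\<lambda>i. inner (x (diagseq (i + Suc n))) (h n))"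
      by (simp add: o_def add.commute)
    then show ?thesis
      using convergent_ignore_initial_segment[of "\<lambda>i. inner (x (diagseq i)) (h n)" "Suc n"]
      by simp
  qed
  have conv: "convergent (\<lambda>i. inner (x (diagseq i)) u)" for u
  proof (rule real_Cauchy_convergent, rule metric_CauchyI)
    fix \<epsilon> :: real assume "\<epsilon> > 0"
    \<comment> \<open>The denominator \<open>K + 1\<close> is positive even for \<open>K = 0\<close>
      and makes the bound \<open>K * \<delta> < \<epsilon> / 3\<close> strict.\<close>
    define \<delta> where "\<delta> = \<epsilon> / 3 / (K + 1)"
    have "\<delta> > 0"
      using \<open>\<epsilon> > 0\<close> K0 unfolding \<delta>_def by simp
    then obtain n where n: "h n \<in> ball u \<delta>"
      using D(2)[of "ball u \<delta>"] range_h by auto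
    obtain N where N: "\<And>i j. i \<ge> N \<Longrightarrow> j \<ge> N \<Longrightarrow>
        dist (inner (x (diagseq i)) (h n)) (inner (x (diagseq j)) (h n)) < \<epsilon> / 3"
      using metric_CauchyD[OF convergent_Cauchy[OF conv_h[of n]], of "\<epsilon> / 3"] \<open>\<epsilon> > 0\<close> by auto
    have close: "\<bar>inner (x k) u - inner (x k) (h n)\<bar> < \<epsilon> / 3" for k
    proof -
      have "\<bar>inner (x k) u - inner (x k) (h n)\<bar> \<le> K * norm (u - h n)"
        using inner_le[of k "u - h n"] by (simp add: inner_diff_right)
      also have "\<dots> \<le> K * \<delta>"
        using n K0 by (intro mult_left_mono) (auto simp: dist_norm)
      also have "\<dots> < (K + 1) * \<delta>"
        using \<open>\<delta> > 0\<close> by (intro mult_strict_right_mono) auto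
      also have "\<dots> = \<epsilon> / 3"
        using nonzero_mult_div_cancel_left[of "K + 1" "\<epsilon> / 3"] K0
        unfolding \<delta>_def times_divide_eq_right[of "K + 1" "\<epsilon> / 3" "K + 1"] by linarith
      finally show ?thesis .
    qed
    show "\<exists>M. \<forall>i\<ge>M. \<forall>j\<ge>M. dist (inner (x (diagseq i)) u) (inner (x (diagseq j)) u) < \<epsilon>"
    proof (intro exI[of _ N] allI impI)
      fix i j assume "N \<le> i" "N \<le> j"
      then show "dist (inner (x (diagseq i)) u) (inner (x (diagseq j)) u) < \<epsilon>"
        using N[of i j] close[of "diagseq i"] close[of "diagseq j"]
        unfolding dist_real_def by linarith
    qed
  qed
  define l where "l u = lim (\<lambda>i. inner (x (diagseq i)) u)" for u
  have l: "(\<lambda>i. inner (x (diagseq i)) u) \<longlonglongrightarrow> l u" for u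
    using conv[of u] unfolding l_def by (simp add: convergent_LIMSEQ_iff)
  have "bounded_linear l"
  proof (rule bounded_linear_intro[where K = K])
    show "l (u + v) = l u + l v" for u v
      using tendsto_add[OF l[of u] l[of v]] l[of "u + v"]
      by (simp add: inner_add_right LIMSEQ_unique)
    show "l (c *\<^sub>R u) = c *\<^sub>R l u" for c u
      using tendsto_mult_left[OF l[of u], of c] l[of "c *\<^sub>R u"]
      by (simp add: LIMSEQ_unique)
    show "norm (l u) \<le> norm u * K" for u
      using tendsto_rabs[OF l[of u]] inner_le[of _ u]
      by (intro LIMSEQ_le_const2) (auto simp: mult.commute intro!: tendsto_norm)
  qed
  then obtain y where "\<And>u. l u = inner y u"
    using riesz_representation by blast
  then have "weakly_converges (x \<circ> diagseq) y"
    using l unfolding weakly_converges_def by simp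
  then show ?thesis
    using subseq_diagseq by blast
qed

text \<open>The uniform boundedness principle. The closed sets \<open>F k\<close> of directions on
  which the sequence is bounded by \<open>k\<close> cover the space, so by Baire one of them
  contains a ball.\<close>

lemma weakly_converges_bounded:
  fixes a :: "nat \<Rightarrow> 'a::{real_inner, complete_space}"
  assumes "weakly_converges a y"
  shows "bounded (range a)"
proof -
  define F where "F k = {u. \<forall>n. \<bar>inner (a n) u\<bar> \<le> real k}" for k
  have closed_F: "closed (F k)" for k
  proof -
    have "F k = (\<Inter>n. {u. \<bar>inner (a n) u\<bar> \<le> real k})"
      unfolding F_def by auto
    then show ?thesis
      by (auto intro!: closed_INT closed_Collect_le continuous_intros)
  qed
  have cover: "(\<Union>k. F k) = UNIV"
  proof -
    have "\<exists>k. u \<in> F k" for u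
    proof -
      have "Bseq (\<lambda>n. inner (a n) u)"
        using assms unfolding weakly_converges_def
        by (meson convergentI convergent_imp_Bseq)
      then obtain B where B: "\<And>n. norm (inner (a n) u) \<le> B"
        unfolding Bseq_def by blast
      obtain k where "B \<le> real k"
        using real_arch_simple by blast
      then show ?thesis
        using B order_trans unfolding F_def real_norm_def by blast
    qed
    then show ?thesis
      by auto
  qed
  have "\<exists>k. interior (F k) \<noteq> {}"
  proof (rule ccontr)
    assume "\<not> ?thesis"
    then have "euclidean interior_of \<Union>(range F) = {}"
      using closed_F
      by (intro Baire_category_alt) (auto simp: completely_metrizable_space_euclidean)
    then show False
      using cover by simp
  qed
  then obtain k u where "u \<in> interior (F k)"
    by blast
  then obtain r where r: "r > 0" "cball u r \<subseteq> F k"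
    unfolding mem_interior_cball by blast
  \<comment> \<open>The points \<open>u\<close> and \<open>u + v\<close> both lie in
    \<open>F k\<close>, so their difference \<open>v\<close>, of length \<open>r\<close> in the
    direction of \<open>a n\<close>, pairs with \<open>a n\<close> to at most
    \<open>2 * k\<close>.\<close>
  have "norm (a n) \<le> 2 * real k / r" for n
  proof (cases "a n = 0")
    case False
    define v where "v = (r / norm (a n)) *\<^sub>R a n"
    have "norm v = r"
      using False r unfolding v_def by simp
    then have "u \<in> F k" "u + v \<in> F k"
      using r by (auto simp: dist_norm intro!: subsetD[OF r(2)])
    then have "\<bar>inner (a n) u\<bar> \<le> real k" "\<bar>inner (a n) (u + v)\<bar> \<le> real k"
      unfolding F_def by auto
    then have "inner (a n) v \<le> 2 * real k"
      by (simp add: inner_add_right)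
    moreover have "inner (a n) v = r * norm (a n)"
      using False unfolding v_def by (simp add: dot_square_norm power2_eq_square)
    ultimately show ?thesis
      using r by (simp add: field_simps)
  qed (use r in simp)
  then show ?thesis
    unfolding bounded_iff by blast
qed

lemma weakly_converges_subseq:
  "weakly_converges a y \<Longrightarrow> strict_mono r \<Longrightarrow> weakly_converges (a \<circ> r) y"
  unfolding weakly_converges_def
proof (intro allI)
  fix u assume "\<forall>u. (\<lambda>n. inner (a n) u) \<longlonglongrightarrow> inner y u" and r: "strict_mono r"
  from LIMSEQ_subseq_LIMSEQ[OF this(1)[rule_format] r]
  show "(\<lambda>n. inner ((a \<circ> r) n) u) \<longlonglongrightarrow> inner y u"
    by (simp add: o_def)
qed

lemma weakly_converges_diff:
  "weakly_converges a y \<Longrightarrow> weakly_converges b z \<Longrightarrow> weakly_converges (\<lambda>n. a n - b n) (y - z)"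
  unfolding weakly_converges_def inner_diff_left by (intro allI tendsto_diff) simp_all

lemma tendsto_imp_weakly_converges:
  "a \<longlonglongrightarrow> y \<Longrightarrow> weakly_converges a y"
  unfolding weakly_converges_def by (intro allI tendsto_inner tendsto_const)

text \<open>The weakly convergent factor is bounded, so replacing \<open>b n\<close> by its limit
  costs at most a constant times \<open>norm (b n - y)\<close>.\<close>

lemma tendsto_inner_weak_strong:
  fixes a b :: "nat \<Rightarrow> 'a::{real_inner, complete_space}"
  assumes "weakly_converges a x" "b \<longlonglongrightarrow> y"
  shows "(\<lambda>n. inner (a n) (b n)) \<longlonglongrightarrow> inner x y"
proof -
  obtain K where K: "\<And>n. norm (a n) \<le> K"
    using weakly_converges_bounded[OF assms(1)] unfolding bounded_iff by auto
  have "(\<lambda>n. K * norm (b n - y)) \<longlonglongrightarrow> K * 0"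
    using assms(2) by (intro tendsto_mult_left) (simp add: LIM_zero tendsto_norm_zero)
  moreover have "\<forall>\<^sub>F n in sequentially. norm (inner (a n) (b n - y)) \<le> K * norm (b n - y)"
    unfolding real_norm_def
    using K by (intro always_eventually allI order_trans[OF Cauchy_Schwarz_ineq2] mult_right_mono) auto
  ultimately have "(\<lambda>n. inner (a n) (b n - y)) \<longlonglongrightarrow> 0"
    using Lim_null_comparison[of "\<lambda>n. inner (a n) (b n - y)" "\<lambda>n. K * norm (b n - y)"] by simp
  moreover have "(\<lambda>n. inner (a n) y) \<longlonglongrightarrow> inner x y"
    using assms(1) unfolding weakly_converges_def by blast
  ultimately show ?thesis
    using tendsto_add[of "\<lambda>n. inner (a n) (b n - y)" 0 _ "\<lambda>n. inner (a n) y"]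
    by (simp add: inner_diff_right)
qed

text \<open>For two weak cluster points \<open>y\<close> and \<open>y'\<close> in \<open>Z\<close>,
  the product \<open>inner (x n) (y - y')\<close> is an affine combination of the two squared
  distances and hence converges. Comparing its limits along the two subsequences gives
  \<open>y = y'\<close>.\<close>

lemma opial:
  fixes x :: "nat \<Rightarrow> 'a::{real_inner, banach, second_countable_topology}"
  assumes "Z \<noteq> {}"
    and conv: "\<And>z. z \<in> Z \<Longrightarrow> convergent (\<lambda>n. norm (x n - z))"
    and cluster: "\<And>r y. strict_mono (r :: nat \<Rightarrow> nat) \<Longrightarrow> weakly_converges (x \<circ> r) y \<Longrightarrow> y \<in> Z"
  shows "\<exists>y\<in>Z. weakly_converges x y"
proof -
  obtain z0 where "z0 \<in> Z"
    using assms(1) by blast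
  then have "Bseq (\<lambda>n. norm (x n - z0))"
    using conv convergent_imp_Bseq by blast
  then obtain B where B: "\<And>n. norm (x n - z0) \<le> B"
    unfolding Bseq_def by auto
  have "norm (x n) \<le> norm z0 + B" for n
    using B[of n] norm_triangle_sub[of "x n" z0] by linarith
  then have bdd: "bounded (range (x \<circ> s))" for s :: "nat \<Rightarrow> nat"
    unfolding bounded_iff by auto
  obtain r y where r: "strict_mono r" and y: "weakly_converges (x \<circ> r) y"
    using weakly_convergent_subsequence[OF bdd[of id]] by auto
  have "y \<in> Z"
    using cluster r y by blast
  have unique: "y' = y" if s: "strict_mono s" and y': "weakly_converges (x \<circ> s) y'" for s y'
  proof -
    have "y' \<in> Z"
      using cluster that by blast
    have "2 * inner (x n) (y - y') =
        (norm (x n - y'))\<^sup>2 - (norm (x n - y))\<^sup>2 + (norm y)\<^sup>2 - (norm y')\<^sup>2" for n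
      unfolding power2_norm_eq_inner by (simp add: inner_diff_left inner_diff_right inner_commute)
    moreover have "convergent (\<lambda>n. (norm (x n - y'))\<^sup>2 - (norm (x n - y))\<^sup>2 + (norm y)\<^sup>2 - (norm y')\<^sup>2)"
      unfolding power2_eq_square
      by (intro convergent_add convergent_diff convergent_mult conv convergent_const \<open>y \<in> Z\<close> \<open>y' \<in> Z\<close>)
    ultimately have "convergent (\<lambda>n. 2 * inner (x n) (y - y'))"
      by simp
    then obtain l where l: "(\<lambda>n. inner (x n) (y - y')) \<longlonglongrightarrow> l"
      using convergent_mult_const_iff[of 2 "\<lambda>n. inner (x n) (y - y')"] unfolding convergent_def by auto
    have "inner y (y - y') = l" "inner y' (y - y') = l"
      using y y' LIMSEQ_subseq_LIMSEQ[OF l r] LIMSEQ_subseq_LIMSEQ[OF l s]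
      unfolding weakly_converges_def o_def by (meson LIMSEQ_unique)+
    then have "inner (y - y') (y - y') = 0"
      by (simp add: inner_diff_left)
    then show ?thesis
      by simp
  qed
  \<comment> \<open>Otherwise some subsequence stays away from the limit in the direction
    \<open>u\<close>; by boundedness it has a weakly convergent subsequence, whose limit must be
    \<open>y\<close>.\<close>
  have "(\<lambda>n. inner (x n) u) \<longlonglongrightarrow> inner y u" for u
  proof (rule ccontr)
    assume "\<not> ?thesis"
    then obtain \<epsilon> where \<epsilon>: "\<epsilon> > 0" "\<And>N. \<exists>n\<ge>N. \<epsilon> \<le> dist (inner (x n) u) (inner y u)"
      unfolding lim_sequentially by (auto simp: not_less)
    then have "infinite {n. \<epsilon> \<le> dist (inner (x n) u) (inner y u)}"
      unfolding infinite_nat_iff_unbounded_le by auto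
    then obtain s :: "nat \<Rightarrow> nat" where s: "strict_mono s"
      "\<And>n. \<epsilon> \<le> dist (inner (x (s n)) u) (inner y u)"
      using infinite_enumerate by blast
    obtain s' y' where s': "strict_mono s'" and y': "weakly_converges (x \<circ> s \<circ> s') y'"
      using weakly_convergent_subsequence[OF bdd[of s]] by auto
    have "y' = y"
      using unique[of "s \<circ> s'" y'] s s' y' by (simp add: o_assoc strict_mono_o)
    then have "(\<lambda>n. inner (x (s (s' n))) u) \<longlonglongrightarrow> inner y u"
      using y' unfolding weakly_converges_def by simp
    then have "\<exists>n. dist (inner (x (s (s' n))) u) (inner y u) < \<epsilon>"
      using \<epsilon>(1) unfolding lim_sequentially by blast
    then show False
      using s(2) by (meson not_le)
  qed
  then show ?thesis
    using \<open>y \<in> Z\<close> unfolding weakly_converges_def by blast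
qed

text \<open>The distance is 1-Lipschitz in \<open>z\<close>, uniformly in \<open>n\<close>. This
  carries an almost sure statement about countably many points over to all of
  \<open>Z\<close>.\<close>

lemma convergent_dist_dense:
  fixes x :: "nat \<Rightarrow> 'a::real_normed_vector"
  assumes "\<And>z. z \<in> D \<Longrightarrow> convergent (\<lambda>n. norm (x n - z))" "z \<in> closure D"
  shows "convergent (\<lambda>n. norm (x n - z))"
proof (rule real_Cauchy_convergent, rule metric_CauchyI)
  fix \<epsilon> :: real assume "\<epsilon> > 0"
  then obtain y where y: "y \<in> D" "dist y z < \<epsilon> / 3"
    using assms(2) unfolding closure_approachable by (meson divide_pos_pos zero_less_numeral)
  obtain N where N: "\<And>i j. i \<ge> N \<Longrightarrow> j \<ge> N \<Longrightarrow> dist (norm (x i - y)) (norm (x j - y)) < \<epsilon> / 3"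
    using metric_CauchyD[OF convergent_Cauchy[OF assms(1)[OF y(1)]], of "\<epsilon> / 3"] \<open>\<epsilon> > 0\<close> by auto
  have close: "\<bar>norm (x n - z) - norm (x n - y)\<bar> < \<epsilon> / 3" for n
    using norm_triangle_ineq3[of "x n - z" "x n - y"] y(2) by (simp add: dist_norm)
  show "\<exists>M. \<forall>i\<ge>M. \<forall>j\<ge>M. dist (norm (x i - z)) (norm (x j - z)) < \<epsilon>"
  proof (intro exI[of _ N] allI impI)
    fix i j assume "N \<le> i" "N \<le> j"
    then show "dist (norm (x i - z)) (norm (x j - z)) < \<epsilon>"
      using N[of i j] close[of i] close[of j] unfolding dist_real_def by linarith
  qed
qed

text \<open>Finite dimension is expressed by a finite spanning set; after orthogonalisation the
  coordinates of a vector are inner products, so weak convergence is convergence of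
  coordinates.\<close>

lemma finite_dim_weakly_converges_imp_tendsto:
  fixes a :: "nat \<Rightarrow> 'a::real_inner"
  assumes "finite (B :: 'a set)" "span B = UNIV" "weakly_converges a y"
  shows "a \<longlonglongrightarrow> y"
proof -
  obtain C :: "'a set" where C: "finite C" "span C = UNIV" "pairwise orthogonal C"
    using basis_orthogonal[OF assms(1)] assms(2) by auto
  have expand: "v = (\<Sum>b\<in>C. (inner v b / inner b b) *\<^sub>R b)" for v
  proof -
    define s where "s = v - (\<Sum>b\<in>C. (inner v b / inner b b) *\<^sub>R b)"
    have "orthogonal s b" if "b \<in> C" for b
    proof -
      \<comment> \<open>A zero vector in \<open>C\<close> does no harm: its quotient is 0 by
        convention, and \<open>inner v 0 = 0\<close>.\<close>
      have "(\<Sum>b'\<in>C. (inner v b' / inner b' b') * inner b' b)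
          = (\<Sum>b'\<in>C. if b' = b then inner v b else 0)"
        using C(3) that
        by (intro sum.cong) (auto simp: pairwise_def orthogonal_def)
      then show ?thesis
        using C(1) that unfolding s_def orthogonal_def
        by (simp add: inner_diff_left inner_sum_left)
    qed
    then have "orthogonal s s"
      using orthogonal_to_span[of s C s] C(2) by (simp add: orthogonal_commute)
    then show ?thesis
      unfolding s_def by (simp add: orthogonal_self)
  qed
  have "(\<lambda>n. \<Sum>b\<in>C. (inner (a n) b / inner b b) *\<^sub>R b) \<longlonglongrightarrow> (\<Sum>b\<in>C. (inner y b / inner b b) *\<^sub>R b)"
    using assms(3) unfolding weakly_converges_def divide_inverse
    by (intro tendsto_sum tendsto_scaleR tendsto_mult tendsto_const) blast
  then show ?thesis
    using expand by simp
qed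

section \<open>Monotone operators\<close>

text \<open>Otherwise adding the pair \<open>(x, u)\<close> to the graph would yield a proper
  monotone extension.\<close>

lemma maximally_monotone_memI:
  assumes "maximally_monotone A"
    and "\<And>y v. v \<in> A y \<Longrightarrow> 0 \<le> inner (x - y) (u - v)"
  shows "u \<in> A x"
proof (rule ccontr)
  assume "u \<notin> A x"
  define B where "B = A(x := insert u (A x))"
  have in_B: "v \<in> B y \<longleftrightarrow> v \<in> A y \<or> (y = x \<and> v = u)" for y v
    unfolding B_def by auto
  have swap: "inner (y - x) (v - u) = inner (x - y) (u - v)" for y v
    by (simp add: inner_diff_left inner_diff_right)
  have "monotone_operator A"
    using assms(1) unfolding maximally_monotone_def by blast
  then have "0 \<le> inner (y - y') (v - v')" if "v \<in> B y" "v' \<in> B y'" for y v y' v'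
    using that assms(2) unfolding in_B monotone_operator_def gra_def
    by (elim disjE) (auto simp: swap)
  then have "monotone_operator B"
    unfolding monotone_operator_def gra_def by blast
  moreover have "gra A \<subset> gra B"
    using \<open>u \<notin> A x\<close> unfolding gra_def by (auto simp: in_B)
  ultimately show False
    using assms(1) unfolding maximally_monotone_def by blast
qed

lemma maximally_monotone_ineq:
  "maximally_monotone A \<Longrightarrow> u \<in> A x \<Longrightarrow> v \<in> A y \<Longrightarrow> 0 \<le> inner (x - y) (u - v)"
  unfolding maximally_monotone_def monotone_operator_def gra_def by blast

text \<open>The monotonicity inequality against a fixed pair of the graph survives the limit,
  because a weakly convergent factor is paired with a strongly convergent one; maximality then
  places the limit in the graph.\<close>

lemma maximally_monotone_weak_strong_closed:
  fixes A :: "'a::{real_inner, complete_space} \<Rightarrow> 'a set"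
  assumes A: "maximally_monotone A"
    and "weakly_converges a x" "b \<longlonglongrightarrow> u" "\<And>n. b n \<in> A (a n)"
  shows "u \<in> A x"
proof (rule maximally_monotone_memI[OF A])
  fix y v assume "v \<in> A y"
  then have "0 \<le> inner (a n - y) (b n - v)" for n
    using maximally_monotone_ineq[OF A assms(4)] by simp
  moreover have "(\<lambda>n. inner (a n - y) (b n - v)) \<longlonglongrightarrow> inner (x - y) (u - v)"
    by (intro tendsto_inner_weak_strong weakly_converges_diff tendsto_diff tendsto_const
        tendsto_imp_weakly_converges assms)
  ultimately show "0 \<le> inner (x - y) (u - v)"
    by (intro LIMSEQ_le_const) auto
qed

lemma cocoercive_lipschitz:
  assumes "cocoercive \<alpha> C" "0 < \<alpha>"
  shows "norm (C x - C y) \<le> norm (x - y) / \<alpha>"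
proof -
  have "\<alpha> * (norm (C x - C y))\<^sup>2 \<le> norm (x - y) * norm (C x - C y)"
    using assms(1) norm_cauchy_schwarz unfolding cocoercive_def by (metis order_trans)
  then have "\<alpha> * norm (C x - C y) \<le> norm (x - y)"
    by (cases "norm (C x - C y) = 0") (auto simp: power2_eq_square)
  then show ?thesis
    using assms(2) by (simp add: field_simps)
qed

lemma zer_operator_plus_iff:
  fixes W :: "'a \<Rightarrow> 'b::ab_group_add set"
  shows "x \<in> zer (operator_plus W C) \<longleftrightarrow> - C x \<in> W x"
proof -
  have "0 = u + C x \<longleftrightarrow> u = - C x" for u
    by (metis add.right_inverse add_eq_0_iff2 add.commute)
  then show ?thesis
    unfolding zer_def operator_plus_def by auto
qed

text \<open>Testing against a zero \<open>z\<close> turns cocoercivity into strong convergence of \<open>C (a n)\<close> to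
  \<open>C z\<close>, so closedness of the graph of \<open>W\<close> alone suffices.\<close>

lemma zer_operator_plus_demiclosed:
  fixes W :: "'a::{real_inner, complete_space} \<Rightarrow> 'a set"
  assumes W: "maximally_monotone W" and C: "cocoercive \<alpha> C" and \<alpha>: "0 < \<alpha>"
    and z: "z \<in> zer (operator_plus W C)"
    and a: "weakly_converges a x" and u: "\<And>n. u n \<in> W (a n)"
    and aq: "(\<lambda>n. a n - q n) \<longlonglongrightarrow> 0" and uq: "(\<lambda>n. u n + C (q n)) \<longlonglongrightarrow> 0"
  shows "x \<in> zer (operator_plus W C)"
proof -
  have "(\<lambda>n. norm (a n - q n) / \<alpha>) \<longlonglongrightarrow> 0 / \<alpha>"
    using aq \<alpha> by (intro tendsto_divide tendsto_norm_zero) auto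
  then have "(\<lambda>n. C (a n) - C (q n)) \<longlonglongrightarrow> 0"
    by (intro Lim_null_comparison[of "\<lambda>n. C (a n) - C (q n)" "\<lambda>n. norm (a n - q n) / \<alpha>"])
      (auto intro!: always_eventually cocoercive_lipschitz[OF C \<alpha>])
  from tendsto_add[OF uq this] have uC: "(\<lambda>n. u n + C (a n)) \<longlonglongrightarrow> 0"
    by (simp add: algebra_simps)
  have coco: "\<alpha> * (norm (C p - C r))\<^sup>2 \<le> inner (p - r) (C p - C r)" for p r
    using C unfolding cocoercive_def by blast
  have sqrt_lim: "b \<longlonglongrightarrow> 0" if "\<And>n. \<alpha> * (norm (b n))\<^sup>2 \<le> g n" "g \<longlonglongrightarrow> 0"
    for b :: "nat \<Rightarrow> 'a" and g
  proof -
    have "(\<lambda>n. g n / \<alpha>) \<longlonglongrightarrow> 0 / \<alpha>"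
      using that(2) \<alpha> by (intro tendsto_divide) auto
    then have "(\<lambda>n. (norm (b n))\<^sup>2) \<longlonglongrightarrow> 0"
      using that(1) \<alpha>
      by (intro Lim_null_comparison[of "\<lambda>n. (norm (b n))\<^sup>2" "\<lambda>n. g n / \<alpha>"])
        (auto intro!: always_eventually simp: field_simps)
    then show ?thesis
      by (simp add: tendsto_norm_zero_iff)
  qed
  have "- C z \<in> W z"
    using z by (simp add: zer_operator_plus_iff)
  then have mono: "0 \<le> inner (a n - z) (u n + C z)" for n
    using maximally_monotone_ineq[OF W u[of n]] by force
  \<comment> \<open>Adding \<open>coco\<close> at \<open>z\<close> and \<open>mono\<close> bounds
    the squared norm by the pairing of the weakly convergent \<open>a n - z\<close> with
    \<open>u n + C (a n)\<close>, which tends strongly to 0.\<close>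
  have "(\<lambda>n. C (a n) - C z) \<longlonglongrightarrow> 0"
  proof (rule sqrt_lim)
    show "\<alpha> * (norm (C (a n) - C z))\<^sup>2 \<le> inner (a n - z) (u n + C (a n))" for n
      using coco[of "a n" z] mono[of n] by (simp add: inner_diff_right inner_add_right)
    show "(\<lambda>n. inner (a n - z) (u n + C (a n))) \<longlonglongrightarrow> 0"
      using tendsto_inner_weak_strong[OF weakly_converges_diff[OF a
            tendsto_imp_weakly_converges[OF tendsto_const]] uC, of z] by simp
  qed
  then have Ca: "(\<lambda>n. C (a n)) \<longlonglongrightarrow> C z"
    by (rule LIM_zero_cancel)
  \<comment> \<open>Now \<open>C (a n)\<close> converges strongly, so its pairing with
    \<open>a n - x\<close>, which tends weakly to 0, vanishes in the limit. This identifies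
    \<open>C x\<close> with \<open>C z\<close>.\<close>
  have "(\<lambda>n. C (a n) - C x) \<longlonglongrightarrow> 0"
  proof (rule sqrt_lim[OF coco])
    show "(\<lambda>n. inner (a n - x) (C (a n) - C x)) \<longlonglongrightarrow> 0"
      using tendsto_inner_weak_strong[OF weakly_converges_diff[OF a
            tendsto_imp_weakly_converges[OF tendsto_const]] tendsto_diff[OF Ca tendsto_const],
          of x "C x"] by simp
  qed
  then have "(\<lambda>n. C (a n)) \<longlonglongrightarrow> C x"
    by (rule LIM_zero_cancel)
  with Ca have "C z = C x"
    by (rule LIMSEQ_unique)
  have "(\<lambda>n. (u n + C (a n)) - C (a n)) \<longlonglongrightarrow> 0 - C z"
    by (intro tendsto_diff uC Ca)
  then have "u \<longlonglongrightarrow> - C x"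
    using \<open>C z = C x\<close> by simp
  then show ?thesis
    unfolding zer_operator_plus_iff
    by (rule maximally_monotone_weak_strong_closed[OF W a _ u])
qed

section \<open>Almost sure convergence of nonnegative quasi-supermartingales\<close>

text \<open>\<open>holding a b v n\<close> is the strategy that buys below \<open>a\<close> and sells above \<open>b\<close>;
  \<open>upcrossings a b v n\<close> counts its completed sales up to time \<open>n\<close>.\<close>

fun holding :: "real \<Rightarrow> real \<Rightarrow> (nat \<Rightarrow> real) \<Rightarrow> nat \<Rightarrow> bool" where
  "holding a b v 0 \<longleftrightarrow> v 0 < a"
| "holding a b v (Suc n) \<longleftrightarrow> (if holding a b v n then v (Suc n) \<le> b else v (Suc n) < a)"

fun upcrossings :: "real \<Rightarrow> real \<Rightarrow> (nat \<Rightarrow> real) \<Rightarrow> nat \<Rightarrow> nat" where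
  "upcrossings a b v 0 = 0"
| "upcrossings a b v (Suc n) = upcrossings a b v n + of_bool (holding a b v n \<and> b < v (Suc n))"

text \<open>Each completed trade earns more than \<open>b - a\<close>. A position still open was
  bought below \<open>a\<close>, so it has gained more than \<open>v n - a\<close> so far; carrying
  this term along makes the induction work.\<close>

lemma holding_gain:
  assumes "a < b"
  shows "(b - a) * upcrossings a b v n + (if holding a b v n then v n - a else 0)
    \<le> (\<Sum>k<n. of_bool (holding a b v k) * (v (Suc k) - v k))"
proof (induction n)
  case (Suc n)
  then show ?case
    using assms by (auto simp: algebra_simps split: if_splits)
qed simp

lemma holding_if_less: "v n < a \<Longrightarrow> a < b \<Longrightarrow> holding a b v n"
  by (cases n) auto

lemma not_holding_if_greater: "b < v n \<Longrightarrow> a < b \<Longrightarrow> \<not> holding a b v n"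
  by (cases n) auto

lemma upcrossings_mono: "m \<le> n \<Longrightarrow> upcrossings a b v m \<le> upcrossings a b v n"
  by (rule lift_Suc_mono_le) auto

lemma upcrossings_unbounded:
  assumes "a < b" "\<exists>\<^sub>F n in sequentially. v n < a" "\<exists>\<^sub>F n in sequentially. b < v n"
  shows "\<exists>n. k \<le> upcrossings a b v n"
proof (induction k)
  case (Suc k)
  then obtain n where n: "k \<le> upcrossings a b v n"
    by blast
  obtain i where i: "n \<le> i" "v i < a"
    using assms(2) unfolding frequently_sequentially by blast
  obtain j where j: "i \<le> j" "b < v j"
    using assms(3) unfolding frequently_sequentially by blast
  \<comment> \<open>The position is held at time \<open>i\<close>, so it can be closed later only
    through a sale, which raises the count.\<close>
  have "upcrossings a b v i + of_bool (\<not> holding a b v j') \<le> upcrossings a b v j'" if "i \<le> j'" for j'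
    using that
  proof (induction j' rule: dec_induct)
    case base
    then show ?case
      using holding_if_less[of v i a b] i assms(1) by simp
  qed auto
  from this[OF j(1)] have "Suc (upcrossings a b v i) \<le> upcrossings a b v j"
    using not_holding_if_greater[of b v j a] j assms(1) by simp
  moreover have "upcrossings a b v n \<le> upcrossings a b v i"
    using i by (intro upcrossings_mono)
  ultimately show ?case
    using n by (intro exI[of _ j]) linarith
qed simp

text \<open>If the lower and upper limits differed, two rationals between them would be crossed
  infinitely often; \<open>K\<close> then excludes an infinite limit. Rational levels keep the
  number of null sets countable when this is used almost surely.\<close>

lemma convergent_if_upcrossings_bounded:
  fixes v :: "nat \<Rightarrow> real"
  assumes nonneg: "\<And>n. 0 \<le> v n"
    and K: "\<exists>\<^sub>F n in sequentially. v n \<le> K"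
    and bounded: "\<And>a b :: rat. 0 \<le> a \<Longrightarrow> a < b \<Longrightarrow> \<exists>B. \<forall>n. upcrossings (of_rat a) (of_rat b) v n \<le> B"
  shows "convergent v"
proof -
  let ?f = "\<lambda>n. ereal (v n)"
  have "liminf ?f = limsup ?f"
  proof (rule ccontr)
    assume "\<not> ?thesis"
    then have "liminf ?f < limsup ?f"
      using Liminf_le_Limsup[of sequentially ?f] by simp
    then obtain a where a: "liminf ?f < ereal (of_rat a)" "ereal (of_rat a) < limsup ?f"
      using ereal_dense3 by blast
    then obtain b where b: "ereal (of_rat a) < ereal (of_rat b)" "ereal (of_rat b) < limsup ?f"
      using ereal_dense3 by blast
    have "\<exists>\<^sub>F n in sequentially. v n < of_rat a"
    proof (rule ccontr)
      assume "\<not> ?thesis"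
      then have "\<forall>\<^sub>F n in sequentially. ereal (of_rat a) \<le> ?f n"
        by (simp add: not_frequently not_less)
      then have "ereal (of_rat a) \<le> liminf ?f"
        by (rule Liminf_bounded)
      with a(1) show False
        by simp
    qed
    then have freq_a: "\<exists>\<^sub>F n in sequentially. v n < real_of_rat a" .
    have "\<exists>\<^sub>F n in sequentially. of_rat b < v n"
    proof (rule ccontr)
      assume "\<not> ?thesis"
      then have "\<forall>\<^sub>F n in sequentially. ?f n \<le> ereal (of_rat b)"
        by (simp add: not_frequently not_less)
      then have "limsup ?f \<le> ereal (of_rat b)"
        by (rule Limsup_bounded)
      with b(2) show False
        by simp
    qed
    then have freq_b: "\<exists>\<^sub>F n in sequentially. real_of_rat b < v n" .
    obtain n where "v n < of_rat a"
      using frequently_ex[OF freq_a] by blast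
    then have "0 \<le> a"
      using nonneg[of n] by (smt (verit) zero_le_of_rat_iff)
    moreover have "a < b"
      using b(1) by (simp add: of_rat_less)
    ultimately obtain B where B: "\<And>n. upcrossings (of_rat a) (of_rat b) v n \<le> B"
      using bounded by blast
    have "real_of_rat a < of_rat b"
      using b(1) by simp
    from upcrossings_unbounded[OF this freq_a freq_b, of "Suc B"] B show False
      by (metis Suc_n_not_le_n order_trans)
  qed
  then have lim: "?f \<longlonglongrightarrow> limsup ?f"
    by (intro Liminf_eq_Limsup) auto
  have "0 \<le> liminf ?f"
    using nonneg by (intro Liminf_bounded always_eventually) auto
  moreover have "liminf ?f \<le> ereal K"
  proof (rule ccontr)
    assume "\<not> ?thesis"
    then have "\<forall>\<^sub>F n in sequentially. ereal K < ?f n"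
      by (intro less_LiminfD) auto
    then show False
      using K by (simp add: frequently_def not_le)
  qed
  ultimately obtain r where "limsup ?f = ereal r"
    using \<open>liminf ?f = limsup ?f\<close> by (cases "limsup ?f") auto
  then show ?thesis
    using lim unfolding convergent_def by auto
qed

text \<open>In \<open>adapted\<close> the values \<open>V m\<close> are known at every later time;
  this is all that is used of a filtration being increasing. The errors \<open>\<delta> n\<close>
  are numbers because they bound integrals over arbitrary events of \<open>F n\<close>.\<close>

locale nonneg_quasi_supermartingale = prob_space M for M :: "'w measure" +
  fixes F :: "nat \<Rightarrow> 'w measure" and V :: "nat \<Rightarrow> 'w \<Rightarrow> real" and \<delta> :: "nat \<Rightarrow> real"
  assumes subalg: "\<And>n. subalgebra M (F n)"
    and adapted: "\<And>m n. m \<le> n \<Longrightarrow> V m \<in> borel_measurable (F n)"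
    and nonneg: "\<And>n \<omega>. 0 \<le> V n \<omega>"
    and integrable: "\<And>n. integrable M (V n)"
    and decrease: "\<And>n A. A \<in> sets (F n) \<Longrightarrow>
      (LINT \<omega>:A|M. V (Suc n) \<omega>) \<le> (LINT \<omega>:A|M. V n \<omega>) + \<delta> n"
    and \<delta>_nonneg: "\<And>n. 0 \<le> \<delta> n" and \<delta>_summable: "summable \<delta>"
begin

lemma expectation_le: "expectation (V n) \<le> expectation (V 0) + suminf \<delta>"
proof -
  have "expectation (V n) \<le> expectation (V 0) + (\<Sum>k<n. \<delta> k)"
  proof (induction n)
    case (Suc n)
    have "space M \<in> sets (F n)"
      using subalg[of n] sets.top[of "F n"] unfolding subalgebra_def by simp
    from decrease[OF this] Suc show ?case
      by (simp add: set_integral_space integrable)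
  qed simp
  then show ?thesis
    using sum_le_suminf[OF \<delta>_summable, of "{..<n}"] \<delta>_nonneg by (simp add: order_trans add_left_mono)
qed

lemma adapted_holding:
  "m \<le> n \<Longrightarrow> Measurable.pred (F n) (\<lambda>\<omega>. holding a b (\<lambda>k. V k \<omega>) m)"
proof (induction m)
  case 0
  have [measurable]: "V 0 \<in> borel_measurable (F n)"
    using adapted by simp
  show ?case
    by simp
next
  case (Suc m)
  have [measurable]: "V (Suc m) \<in> borel_measurable (F n)"
      "Measurable.pred (F n) (\<lambda>\<omega>. holding a b (\<lambda>k. V k \<omega>) m)"
    using adapted Suc by simp_all
  show ?case
    by simp
qed

text \<open>The event of holding at time \<open>k\<close> lies in \<open>F k\<close>, so the
  \<open>k\<close>-th trading step gains at most \<open>\<delta> k\<close> on average. As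
  \<open>V\<close> is nonnegative, a position still open has lost at most \<open>a\<close>.\<close>

lemma expectation_upcrossings_le:
  assumes "0 \<le> a" "a < b"
  shows "(\<integral>\<^sup>+ \<omega>. of_nat (upcrossings a b (\<lambda>k. V k \<omega>) n) \<partial>M) \<le> ennreal ((a + suminf \<delta>) / (b - a))"
proof -
  let ?H = "\<lambda>k. {\<omega> \<in> space M. holding a b (\<lambda>k. V k \<omega>) k}"
  have space_F: "space (F k) = space M" and sets_F: "sets (F k) \<subseteq> sets M" for k
    using subalg[of k] unfolding subalgebra_def by auto
  have H: "?H k \<in> sets (F k)" for k
    using adapted_holding[of k k a b] by (simp add: pred_def space_F)
  then have H_M: "?H k \<in> sets M" for k
    using sets_F by blast
  have [measurable]: "V k \<in> borel_measurable M" for k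
    using integrable by simp
  have [measurable]: "Measurable.pred M (\<lambda>\<omega>. holding a b (\<lambda>k. V k \<omega>) k)" for k
    using H_M by (simp add: pred_def)
  have U_meas[measurable]: "(\<lambda>\<omega>. upcrossings a b (\<lambda>k. V k \<omega>) n) \<in> measurable M (count_space UNIV)" for n
    by (induction n) simp_all
  have U_bound: "upcrossings a b v n \<le> n" for v n
    by (induction n) (auto simp: of_bool_def)
  have U_int: "integrable M (\<lambda>\<omega>. real (upcrossings a b (\<lambda>k. V k \<omega>) n))"
    using U_bound by (intro integrable_const_bound[of _ n]) auto
  have H_int: "integrable M (\<lambda>\<omega>. indicator (?H k) \<omega> * V j \<omega>)" for k j
    using integrable_mult_indicator[OF H_M integrable] by simp
  have pointwise: "(b - a) * real (upcrossings a b (\<lambda>k. V k \<omega>) n) \<le>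
      a + (\<Sum>k<n. indicator (?H k) \<omega> * V (Suc k) \<omega> - indicator (?H k) \<omega> * V k \<omega>)"
    if "\<omega> \<in> space M" for \<omega>
  proof -
    have "(\<Sum>k<n. of_bool (holding a b (\<lambda>k. V k \<omega>) k) * (V (Suc k) \<omega> - V k \<omega>)) =
        (\<Sum>k<n. indicator (?H k) \<omega> * V (Suc k) \<omega> - indicator (?H k) \<omega> * V k \<omega>)"
      using that by (intro sum.cong) (auto simp: indicator_def)
    then show ?thesis
      using holding_gain[OF assms(2), of "\<lambda>k. V k \<omega>" n] nonneg[of n \<omega>] assms
      by (auto split: if_splits)
  qed
  have "expectation (\<lambda>\<omega>. (b - a) * real (upcrossings a b (\<lambda>k. V k \<omega>) n)) \<le> expectation (\<lambda>\<omega>.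
      a + (\<Sum>k<n. indicator (?H k) \<omega> * V (Suc k) \<omega> - indicator (?H k) \<omega> * V k \<omega>))"
    using pointwise U_int H_int by (intro integral_mono) auto
  also have "\<dots> = a + (\<Sum>k<n. (LINT \<omega>:?H k|M. V (Suc k) \<omega>) - (LINT \<omega>:?H k|M. V k \<omega>))"
    using H_int by (simp add: prob_space set_lebesgue_integral_def)
  also have "\<dots> \<le> a + (\<Sum>k<n. \<delta> k)"
    using decrease[OF H] by (intro add_left_mono sum_mono) (simp add: algebra_simps)
  also have "\<dots> \<le> a + suminf \<delta>"
    using sum_le_suminf[OF \<delta>_summable, of "{..<n}"] \<delta>_nonneg by simp
  finally have "expectation (\<lambda>\<omega>. real (upcrossings a b (\<lambda>k. V k \<omega>) n)) \<le> (a + suminf \<delta>) / (b - a)"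
    using assms by (subst (asm) integral_mult_right_zero) (simp add: pos_le_divide_eq mult.commute)
  moreover have "(\<integral>\<^sup>+ \<omega>. of_nat (upcrossings a b (\<lambda>k. V k \<omega>) n) \<partial>M)
      = ennreal (expectation (\<lambda>\<omega>. real (upcrossings a b (\<lambda>k. V k \<omega>) n)))"
    using nn_integral_eq_integral[OF U_int] by (simp add: ennreal_of_nat_eq_real_of_nat)
  ultimately show ?thesis
    by (simp add: ennreal_leI)
qed

lemma AE_upcrossings_bounded:
  assumes "0 \<le> a" "a < b"
  shows "AE \<omega> in M. \<exists>B. \<forall>n. upcrossings a b (\<lambda>k. V k \<omega>) n \<le> B"
proof -
  let ?U = "\<lambda>n \<omega>. of_nat (upcrossings a b (\<lambda>k. V k \<omega>) n) :: ennreal"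
  have "V m \<in> borel_measurable M" for m
    using integrable by simp
  note [measurable] = this
  have "Measurable.pred M (\<lambda>\<omega>. holding a b (\<lambda>k. V k \<omega>) k)" for k
    using measurable_from_subalg[OF subalg adapted_holding[OF order_refl]] .
  note [measurable] = this
  have "(\<lambda>\<omega>. upcrossings a b (\<lambda>k. V k \<omega>) n) \<in> measurable M (count_space UNIV)" for n
    by (induction n) simp_all
  note [measurable] = this
  have "(\<integral>\<^sup>+ \<omega>. (SUP n. ?U n \<omega>) \<partial>M) = (SUP n. \<integral>\<^sup>+ \<omega>. ?U n \<omega> \<partial>M)"
    by (intro nn_integral_monotone_convergence_SUP)
      (auto simp: incseq_def le_fun_def upcrossings_mono)
  also have "\<dots> \<le> ennreal ((a + suminf \<delta>) / (b - a))"
    using expectation_upcrossings_le[OF assms] by (intro SUP_least)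
  finally have "(\<integral>\<^sup>+ \<omega>. (SUP n. ?U n \<omega>) \<partial>M) \<noteq> \<infinity>"
    by (auto simp: top_unique)
  then have "AE \<omega> in M. (SUP n. ?U n \<omega>) \<noteq> \<infinity>"
    by (intro nn_integral_PInf_AE) auto
  then show ?thesis
  proof eventually_elim
    case (elim \<omega>)
    then obtain B where B: "(SUP n. ?U n \<omega>) < of_nat B"
      using ennreal_Ex_less_of_nat[of "SUP n. ?U n \<omega>"]
      unfolding infinity_ennreal_def top.not_eq_extremum by blast
    have "upcrossings a b (\<lambda>k. V k \<omega>) n \<le> B" for n
      using le_less_trans[OF SUP_upper[of n UNIV "\<lambda>n. ?U n \<omega>"] B] by simp
    then show ?case
      by blast
  qed
qed

lemma AE_convergent: "AE \<omega> in M. convergent (\<lambda>n. V n \<omega>)"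
proof -
  have [measurable]: "V k \<in> borel_measurable M" for k
    using integrable by simp
  have "AE \<omega> in M. 0 \<le> a \<longrightarrow> a < b \<longrightarrow>
      (\<exists>B. \<forall>n. upcrossings (of_rat a) (of_rat b) (\<lambda>k. V k \<omega>) n \<le> B)" for a b
    using AE_upcrossings_bounded[of "of_rat a" "of_rat b"] by (cases "0 \<le> a \<and> a < b") (auto simp: of_rat_less)
  then have up: "AE \<omega> in M. \<forall>a b. 0 \<le> a \<longrightarrow> a < b \<longrightarrow>
      (\<exists>B. \<forall>n. upcrossings (of_rat a) (of_rat b) (\<lambda>k. V k \<omega>) n \<le> B)"
    by (simp add: AE_all_countable)
  \<comment> \<open>By Fatou's lemma the lower limit is finite almost surely, which excludes
    divergence to infinity, the one failure that finitely many upcrossings permit.\<close>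
  have "(\<integral>\<^sup>+ \<omega>. liminf (\<lambda>n. ennreal (V n \<omega>)) \<partial>M) \<le> liminf (\<lambda>n. \<integral>\<^sup>+ \<omega>. ennreal (V n \<omega>) \<partial>M)"
    by (intro nn_integral_liminf) auto
  also have "\<dots> \<le> ennreal (expectation (V 0) + suminf \<delta>)"
    using expectation_le nonneg integrable
    by (intro Liminf_le always_eventually) (auto simp: nn_integral_eq_integral intro!: ennreal_leI)
  finally have "AE \<omega> in M. liminf (\<lambda>n. ennreal (V n \<omega>)) \<noteq> \<infinity>"
    by (intro nn_integral_PInf_AE) (auto simp: top_unique)
  then show ?thesis
    using up
  proof eventually_elim
    case (elim \<omega>)
    obtain K where K: "liminf (\<lambda>n. ennreal (V n \<omega>)) < of_nat K"
      using elim(1) ennreal_Ex_less_of_nat by (auto simp: top.not_eq_extremum)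
    have "\<exists>\<^sub>F n in sequentially. V n \<omega> \<le> K"
    proof (rule ccontr)
      assume "\<not> ?thesis"
      then have "\<forall>\<^sub>F n in sequentially. of_nat K \<le> ennreal (V n \<omega>)"
        by (auto simp: not_frequently not_le ennreal_of_nat_eq_real_of_nat
            elim!: eventually_mono intro!: ennreal_leI)
      then have "of_nat K \<le> liminf (\<lambda>n. ennreal (V n \<omega>))"
        by (rule Liminf_bounded)
      with K show False
        by simp
    qed
    then show ?case
      using elim(2) nonneg by (intro convergent_if_upcrossings_bounded) auto
  qed
qed

end

section \<open>Measurability\<close>

text \<open>The variables of the algorithm are specified only almost everywhere. Changing a function
  on a null set alters preimages by subsets of a null set, which completeness makes
  measurable.\<close>

lemma (in complete_measure) measurable_AE_cong:
  assumes "AE \<omega> in M. f \<omega> = g \<omega>" and f: "f \<in> measurable M N"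
    and "\<And>\<omega>. \<omega> \<in> space M \<Longrightarrow> g \<omega> \<in> space N"
  shows "g \<in> measurable M N"
proof (rule measurableI)
  fix A assume "A \<in> sets N"
  define E where "E = {\<omega> \<in> space M. f \<omega> \<noteq> g \<omega>}"
  have E: "E \<in> null_sets M"
    using assms(1) unfolding E_def by (simp add: AE_iff_null_sets)
  have "g -` A \<inter> space M = (f -` A \<inter> space M - E) \<union> (g -` A \<inter> E)"
    unfolding E_def by auto
  moreover have "g -` A \<inter> E \<in> null_sets M"
    by (rule complete2[OF _ E]) blast
  ultimately show "g -` A \<inter> space M \<in> sets M"
    using measurable_sets[OF f \<open>A \<in> sets N\<close>] null_setsD2[OF E] null_setsD2
    by (metis sets.Diff sets.Un)
qed (use assms in auto)

text \<open>Weak and strong measurability agree in the separable case (Pettis). The norm can be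
  tested on a countable dense set of directions, which makes preimages of closed balls measurable,
  and an open set is a countable union of balls with centres in \<open>D\<close> and rational
  radii.\<close>

lemma borel_measurable_if_inner:
  fixes y :: "'w \<Rightarrow> 'a::{real_inner, second_countable_topology}"
  assumes [measurable]: "\<And>u. (\<lambda>\<omega>. inner (y \<omega>) u) \<in> borel_measurable M"
  shows "y \<in> borel_measurable M"
proof -
  obtain D :: "'a set" where D: "countable D" "\<And>X. open X \<Longrightarrow> X \<noteq> {} \<Longrightarrow> \<exists>d\<in>D. d \<in> X"
    using countable_dense_setE by blast
  have norm_le_iff: "norm v \<le> r \<longleftrightarrow> (\<forall>u\<in>D. inner v u \<le> r * norm u)" if "0 \<le> r" for v :: 'a and r
  proof
    assume "norm v \<le> r"
    then show "\<forall>u\<in>D. inner v u \<le> r * norm u"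
      by (meson mult_right_mono norm_cauchy_schwarz norm_ge_zero order_trans)
  next
    assume *: "\<forall>u\<in>D. inner v u \<le> r * norm u"
    have "open {u. r * norm u < inner v u}"
      by (intro open_Collect_less continuous_intros)
    with D(2) * have "{u. r * norm u < inner v u} = {}"
      by fastforce
    then have "\<not> r * norm v < inner v v"
      by blast
    then show "norm v \<le> r"
      using that by (cases "v = 0") (auto simp: dot_square_norm power2_eq_square)
  qed
  have ball: "{\<omega> \<in> space M. norm (y \<omega> - d) \<le> r} \<in> sets M" if "0 \<le> r" for d r
  proof -
    have "{\<omega> \<in> space M. norm (y \<omega> - d) \<le> r}
        = {\<omega> \<in> space M. \<forall>u\<in>D. inner (y \<omega>) u - inner d u \<le> r * norm u}"
      unfolding norm_le_iff[OF that] by (simp add: inner_diff_left)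
    also have "\<dots> \<in> sets M"
      using D(1) by measurable
    finally show ?thesis .
  qed
  show ?thesis
  proof (rule borel_measurableI)
    fix S :: "'a set" assume "open S"
    define I where "I = {(d, q). d \<in> D \<and> 0 \<le> q \<and> cball d (real_of_rat q) \<subseteq> S}"
    have "countable I"
      by (rule countable_subset[of _ "D \<times> UNIV"]) (use D(1) in \<open>auto simp: I_def\<close>)
    have "\<exists>(d, q) \<in> I. norm (v - d) \<le> of_rat q" if "v \<in> S" for v
    proof -
      obtain \<epsilon> where \<epsilon>: "\<epsilon> > 0" "ball v \<epsilon> \<subseteq> S"
        using \<open>open S\<close> \<open>v \<in> S\<close> openE by blast
      obtain q where q: "0 < real_of_rat q" "real_of_rat q < \<epsilon> / 2"
        using of_rat_dense[of 0 "\<epsilon> / 2"] \<epsilon> by auto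
      obtain d where d: "d \<in> D" "d \<in> ball v (of_rat q)"
        using D(2)[of "ball v (of_rat q)"] q by auto
      have "cball d (of_rat q) \<subseteq> ball v \<epsilon>"
      proof
        fix p assume "p \<in> cball d (of_rat q)"
        then show "p \<in> ball v \<epsilon>"
          using d q dist_triangle[of v p d] by simp
      qed
      then have "(d, q) \<in> I"
        using d q \<epsilon> unfolding I_def by auto
      then show ?thesis
        using d by (intro bexI[of _ "(d, q)"]) (auto simp: dist_norm)
    qed
    moreover have "v \<in> S" if "(d, q) \<in> I" "norm (v - d) \<le> of_rat q" for v d q
      using that unfolding I_def by (auto simp: dist_norm norm_minus_commute)
    ultimately have "y -` S \<inter> space M = (\<Union>(d, q)\<in>I. {\<omega> \<in> space M. norm (y \<omega> - d) \<le> of_rat q})"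
      by fastforce
    also have "\<dots> \<in> sets M"
      using \<open>countable I\<close> ball by (intro sets.countable_UN') (auto simp: I_def)
    finally show "y -` S \<inter> space M \<in> sets M" .
  qed
qed

lemma space_sigma_rv [simp]: "space (sigma_rv M \<Phi>) = space M"
  unfolding sigma_rv_def by (rule space_measure_of) auto

lemma sets_sigma_rv:
  "sets (sigma_rv M \<Phi>) = sigma_sets (space M) {\<phi> -` A \<inter> space M | \<phi> A. \<phi> \<in> \<Phi> \<and> A \<in> sets borel}"
  unfolding sigma_rv_def by (rule sets_measure_of) auto

lemma measurable_sigma_rv: "\<phi> \<in> \<Phi> \<Longrightarrow> \<phi> \<in> borel_measurable (sigma_rv M \<Phi>)"
  by (rule measurableI) (auto simp: sets_sigma_rv)

lemma sets_sigma_rv_mono: "\<Phi> \<subseteq> \<Psi> \<Longrightarrow> sets (sigma_rv M \<Phi>) \<subseteq> sets (sigma_rv M \<Psi>)"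
  unfolding sets_sigma_rv by (rule sigma_sets_mono') auto

lemma subalgebra_sigma_rv:
  assumes "\<And>\<phi>. \<phi> \<in> \<Phi> \<Longrightarrow> \<phi> \<in> borel_measurable M"
  shows "subalgebra M (sigma_rv M \<Phi>)"
  unfolding subalgebra_def sets_sigma_rv
  using assms by (auto intro!: sets.sigma_sets_subset measurable_sets)

section \<open>Conditional expectation\<close>

text \<open>The positive part of \<open>h\<close> may have infinite conditional expectation. Moving
  the negative parts across turns \<open>g \<le> h\<close> into an inequality between sums of
  nonnegative functions, so that nothing infinite is subtracted before conditioning; the three terms
  other than the positive part of \<open>h\<close> are finite almost surely.\<close>

lemma (in sigma_finite_subalgebra) real_cond_exp_le_ereal_cond_exp:
  assumes g: "integrable M g" and [measurable]: "h \<in> borel_measurable M"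
    and le: "AE \<omega> in M. g \<omega> \<le> h \<omega>"
  shows "AE \<omega> in M. ereal (real_cond_exp M F g \<omega>) \<le> ereal_cond_exp M F h \<omega>"
proof -
  let ?N = "\<lambda>f. nn_cond_exp M F (\<lambda>\<omega>. ennreal (f \<omega>))"
  have [measurable]: "g \<in> borel_measurable M"
    using g by simp
  have finite: "AE \<omega> in M. ?N f \<omega> \<noteq> \<infinity>" if [measurable]: "f \<in> borel_measurable M"
    and "(\<integral>\<^sup>+ \<omega>. ennreal (f \<omega>) \<partial>M) < \<infinity>" for f
  proof (rule nn_integral_PInf_AE)
    have "(\<integral>\<^sup>+ \<omega>. ?N f \<omega> \<partial>M) = (\<integral>\<^sup>+ \<omega>. ennreal (f \<omega>) \<partial>M)"
      using nn_cond_exp_intg[of "\<lambda>_. 1" "\<lambda>\<omega>. ennreal (f \<omega>)"] by simp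
    then show "(\<integral>\<^sup>+ \<omega>. ?N f \<omega> \<partial>M) \<noteq> \<infinity>"
      using that(2) by simp
  qed simp
  have "(\<integral>\<^sup>+ \<omega>. ennreal (g \<omega>) \<partial>M) < \<infinity>" "(\<integral>\<^sup>+ \<omega>. ennreal (- g \<omega>) \<partial>M) < \<infinity>"
    using g by (auto simp: real_integrable_def top.not_eq_extremum)
  moreover from this(2) have "(\<integral>\<^sup>+ \<omega>. ennreal (- h \<omega>) \<partial>M) < \<infinity>"
    by (rule le_less_trans[rotated])
      (use le in \<open>auto intro!: nn_integral_mono_AE ennreal_leI elim: eventually_mono\<close>)
  ultimately have "AE \<omega> in M. ?N g \<omega> \<noteq> \<infinity>" "AE \<omega> in M. ?N (\<lambda>\<omega>. - g \<omega>) \<omega> \<noteq> \<infinity>"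
      "AE \<omega> in M. ?N (\<lambda>\<omega>. - h \<omega>) \<omega> \<noteq> \<infinity>"
    using \<open>g \<in> borel_measurable M\<close> by (simp_all only: finite assms(2) borel_measurable_uminus)
  moreover have "AE \<omega> in M. nn_cond_exp M F (\<lambda>\<omega>. ennreal (g \<omega>) + ennreal (- h \<omega>)) \<omega>
      \<le> nn_cond_exp M F (\<lambda>\<omega>. ennreal (h \<omega>) + ennreal (- g \<omega>)) \<omega>"
  proof (rule nn_cond_exp_mono)
    show "AE \<omega> in M. ennreal (g \<omega>) + ennreal (- h \<omega>) \<le> ennreal (h \<omega>) + ennreal (- g \<omega>)"
      using le
    proof eventually_elim
      case (elim \<omega>)
      then show ?case
        by (cases "0 \<le> g \<omega>"; cases "0 \<le> h \<omega>") (auto simp: ennreal_neg intro!: ennreal_leI)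
    qed
  qed simp_all
  moreover have "AE \<omega> in M. ?N g \<omega> + ?N (\<lambda>\<omega>. - h \<omega>) \<omega> =
      nn_cond_exp M F (\<lambda>\<omega>. ennreal (g \<omega>) + ennreal (- h \<omega>)) \<omega>"
    by (intro nn_cond_exp_sum) simp_all
  moreover have "AE \<omega> in M. ?N h \<omega> + ?N (\<lambda>\<omega>. - g \<omega>) \<omega> =
      nn_cond_exp M F (\<lambda>\<omega>. ennreal (h \<omega>) + ennreal (- g \<omega>)) \<omega>"
    by (intro nn_cond_exp_sum) simp_all
  ultimately show ?thesis
  proof eventually_elim
    case (elim \<omega>)
    obtain a b c where abc: "?N g \<omega> = ennreal a" "?N (\<lambda>\<omega>. - g \<omega>) \<omega> = ennreal b"
      "?N (\<lambda>\<omega>. - h \<omega>) \<omega> = ennreal c" "0 \<le> a" "0 \<le> b" "0 \<le> c"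
      using elim(1-3) unfolding infinity_ennreal_def by (metis ennreal_cases)
    have le: "ennreal a + ennreal c \<le> ?N h \<omega> + ennreal b"
      using elim(4-6) abc by simp
    show ?case
    proof (cases "?N h \<omega>")
      case (real r)
      then have "a + c \<le> r + b"
        using le abc by (simp flip: ennreal_plus)
      then show ?thesis
        using abc real unfolding ereal_cond_exp_def real_cond_exp_def by (simp add: enn2ereal_ennreal)
    next
      case top
      then show ?thesis
        using abc unfolding ereal_cond_exp_def by (simp add: enn2ereal_ennreal)
    qed
  qed
qed

section \<open>Vector-valued conditional expectation by approximation in
  \<open>L\<^sup>1\<close>\<close>

context sigma_finite_subalgebra
begin

text \<open>The property from which \<open>cond_exp\<close> makes its choice, separated from the
  choice so that existence can be proved.\<close>

definition is_cond_exp :: "('a \<Rightarrow> 'b) \<Rightarrow> ('a \<Rightarrow> 'b::{banach, second_countable_topology}) \<Rightarrow> bool" where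
  "is_cond_exp f g \<longleftrightarrow> g \<in> borel_measurable F \<and> integrable M g \<and>
     (\<forall>A \<in> sets F. (LINT \<omega>:A|M. g \<omega>) = (LINT \<omega>:A|M. f \<omega>))"

lemma sets_F_subset: "A \<in> sets F \<Longrightarrow> A \<in> sets M"
  using subalg unfolding subalgebra_def by auto

text \<open>A fixed inner product commutes with integration over each event of \<open>F\<close>, so
  uniqueness of the scalar conditional expectation applies.\<close>

lemma is_cond_exp_inner:
  fixes f g :: "'a \<Rightarrow> 'b::{banach, second_countable_topology, real_inner}"
  assumes f: "integrable M f" and g: "is_cond_exp f g"
  shows "AE \<omega> in M. real_cond_exp M F (\<lambda>\<omega>. inner z (f \<omega>)) \<omega> = inner z (g \<omega>)"
proof (rule real_cond_exp_charact)
  fix A assume A: "A \<in> sets F"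
  have g': "integrable M g" "g \<in> borel_measurable F"
    using g unfolding is_cond_exp_def by auto
  have "(LINT \<omega>:A|M. inner z (k \<omega>)) = inner z (LINT \<omega>:A|M. k \<omega>)" if "integrable M k" for k
  proof -
    have "(LINT \<omega>:A|M. inner z (k \<omega>)) = (LINT \<omega>|M. inner z (indicator A \<omega> *\<^sub>R k \<omega>))"
      unfolding set_lebesgue_integral_def by simp
    also have "\<dots> = inner z (LINT \<omega>:A|M. k \<omega>)"
      unfolding set_lebesgue_integral_def
      using integrable_mult_indicator[OF sets_F_subset[OF A] that] by (intro integral_inner_right) auto
    finally show ?thesis .
  qed
  then show "(LINT \<omega>:A|M. inner z (f \<omega>)) = (LINT \<omega>:A|M. inner z (g \<omega>))"
    using f g' g A unfolding is_cond_exp_def by simp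
next
  show "(\<lambda>\<omega>. inner z (g \<omega>)) \<in> borel_measurable F"
    using g unfolding is_cond_exp_def by (intro borel_measurable_inner) auto
qed (use f g in \<open>auto simp: is_cond_exp_def\<close>)

lemma is_cond_exp_diff:
  assumes "integrable M f" "integrable M f'" "is_cond_exp f g" "is_cond_exp f' g'"
  shows "is_cond_exp (\<lambda>\<omega>. f \<omega> - f' \<omega>) (\<lambda>\<omega>. g \<omega> - g' \<omega>)"
  using assms sets_F_subset unfolding is_cond_exp_def
  by (auto simp: set_integral_diff(2) set_integrable_def integrable_mult_indicator)

lemma is_cond_exp_add:
  assumes "integrable M f" "integrable M f'" "is_cond_exp f g" "is_cond_exp f' g'"
  shows "is_cond_exp (\<lambda>\<omega>. f \<omega> + f' \<omega>) (\<lambda>\<omega>. g \<omega> + g' \<omega>)"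
  using assms sets_F_subset unfolding is_cond_exp_def
  by (auto simp: set_integral_add(2) set_integrable_def integrable_mult_indicator)

text \<open>The norm bound comes from testing against a countable dense set of directions, which reduces
  it to the monotonicity of the scalar conditional expectation.\<close>

lemma is_cond_exp_norm_le:
  fixes f g :: "'a \<Rightarrow> 'b::{banach, second_countable_topology, real_inner}"
  assumes f: "integrable M f" and g: "is_cond_exp f g"
  shows "(LINT \<omega>|M. norm (g \<omega>)) \<le> (LINT \<omega>|M. norm (f \<omega>))"
proof -
  obtain D :: "'b set" where D: "countable D" "\<And>X. open X \<Longrightarrow> X \<noteq> {} \<Longrightarrow> \<exists>d\<in>D. d \<in> X"
    using countable_dense_setE by blast
  let ?E = "real_cond_exp M F (\<lambda>\<omega>. norm (f \<omega>))"
  have nf: "integrable M (\<lambda>\<omega>. norm (f \<omega>))"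
    using f by simp
  have "AE \<omega> in M. inner u (g \<omega>) \<le> norm u * ?E \<omega>" for u
  proof -
    have "AE \<omega> in M. real_cond_exp M F (\<lambda>\<omega>. inner u (f \<omega>)) \<omega>
        \<le> real_cond_exp M F (\<lambda>\<omega>. norm u * norm (f \<omega>)) \<omega>"
      using f by (intro real_cond_exp_mono) (auto intro: norm_cauchy_schwarz)
    then show ?thesis
      using is_cond_exp_inner[OF f g, of u] real_cond_exp_cmult[OF nf, of "norm u"]
      by eventually_elim simp
  qed
  then have "AE \<omega> in M. \<forall>u\<in>D. inner u (g \<omega>) \<le> norm u * ?E \<omega>"
    using D(1) by (simp add: AE_ball_countable)
  moreover have "AE \<omega> in M. 0 \<le> ?E \<omega>"
    using f by (intro real_cond_exp_pos) auto
  ultimately have "AE \<omega> in M. norm (g \<omega>) \<le> ?E \<omega>"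
  proof eventually_elim
    case (elim \<omega>)
    have "open {u. norm u * ?E \<omega> < inner u (g \<omega>)}"
      by (intro open_Collect_less continuous_intros)
    with D(2) elim(1) have "{u. norm u * ?E \<omega> < inner u (g \<omega>)} = {}"
      by fastforce
    then have "\<not> norm (g \<omega>) * ?E \<omega> < inner (g \<omega>) (g \<omega>)"
      by blast
    then show ?case
      using elim(2) by (cases "g \<omega> = 0") (auto simp: dot_square_norm power2_eq_square)
  qed
  then have "(LINT \<omega>|M. norm (g \<omega>)) \<le> (LINT \<omega>|M. ?E \<omega>)"
    using g real_cond_exp_int(1)[OF nf] by (intro integral_mono_AE) (auto simp: is_cond_exp_def)
  then show ?thesis
    using real_cond_exp_int(2)[OF nf] by simp
qed

text \<open>Conditional expectation contracts the \<open>L\<^sup>1\<close> norm, so a rapidly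
  convergent subsequence of the approximations has conditional expectations whose increments are
  summable, both in the mean and almost surely.\<close>

lemma is_cond_exp_limit:
  fixes f :: "'a \<Rightarrow> 'b::{banach, second_countable_topology, real_inner}"
  assumes s: "\<And>i. integrable M (s i)" and f: "integrable M f"
    and g: "\<And>i. is_cond_exp (s i) (g i)"
    and lim: "(\<lambda>i. LINT \<omega>|M. norm (s i \<omega> - f \<omega>)) \<longlonglongrightarrow> 0"
  shows "\<exists>g. is_cond_exp f g"
proof -
  \<comment> \<open>The geometric rate makes the norms of successive differences summable.\<close>
  have "\<exists>i. (LINT \<omega>|M. norm (s i \<omega> - f \<omega>)) < (1/2) ^ k" for k
    using order_tendstoD(2)[OF lim, of "(1/2) ^ k"]
    by (auto simp: eventually_sequentially intro!: zero_less_power)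
  then obtain r where r: "\<And>k. (LINT \<omega>|M. norm (s (r k) \<omega> - f \<omega>)) < (1/2) ^ k"
    by metis
  define u where "u k \<omega> = s (r (Suc k)) \<omega> - s (r k) \<omega>" for k \<omega>
  define h where "h k \<omega> = g (r (Suc k)) \<omega> - g (r k) \<omega>" for k \<omega>
  have u_int: "integrable M (u k)" for k
    unfolding u_def using s by simp
  have uh: "is_cond_exp (u k) (h k)" for k
    using is_cond_exp_diff[OF s s g g] unfolding u_def h_def .
  then have h_int: "integrable M (h k)" and h_F [measurable]: "h k \<in> borel_measurable F" for k
    unfolding is_cond_exp_def by auto
  have [measurable]: "h k \<in> borel_measurable M" for k
    using h_int by simp
  have u_le: "(LINT \<omega>|M. norm (u k \<omega>)) \<le> 2 * (1/2) ^ k" for k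
  proof -
    have "(LINT \<omega>|M. norm (u k \<omega>))
        \<le> (LINT \<omega>|M. norm (s (r (Suc k)) \<omega> - f \<omega>) + norm (s (r k) \<omega> - f \<omega>))"
      using s f norm_triangle_ineq4[of "s (r (Suc k)) \<omega> - f \<omega>" "s (r k) \<omega> - f \<omega>" for \<omega>]
      unfolding u_def by (intro integral_mono) auto
    also have "\<dots> = (LINT \<omega>|M. norm (s (r (Suc k)) \<omega> - f \<omega>)) + (LINT \<omega>|M. norm (s (r k) \<omega> - f \<omega>))"
      using s f by (intro Bochner_Integration.integral_add) auto
    also have "\<dots> \<le> (1/2) ^ Suc k + (1/2) ^ k"
      using r[of k] r[of "Suc k"] by linarith
    also have "\<dots> \<le> 2 * (1/2) ^ k"
      by simp
    finally show ?thesis .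
  qed
  have h_le: "(LINT \<omega>|M. norm (h k \<omega>)) \<le> 2 * (1/2) ^ k" for k
    using is_cond_exp_norm_le[OF u_int uh] u_le order_trans by blast
  have summable_int: "summable (\<lambda>k. LINT \<omega>|M. norm (h k \<omega>))"
    by (rule summable_comparison_test[of _ "\<lambda>k. 2 * (1/2) ^ k"])
      (use h_le in \<open>auto intro!: summable_mult summable_geometric\<close>)
  have "(\<integral>\<^sup>+ \<omega>. (\<Sum>k. ennreal (norm (h k \<omega>))) \<partial>M) = (\<Sum>k. ennreal (LINT \<omega>|M. norm (h k \<omega>)))"
    using nn_integral_eq_integral[OF integrable_norm[OF h_int]] by (subst nn_integral_suminf) auto
  also have "\<dots> \<noteq> \<infinity>"
    using summable_int by (simp add: suminf_ennreal2)
  finally have "AE \<omega> in M. (\<Sum>k. ennreal (norm (h k \<omega>))) \<noteq> \<infinity>"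
    by (intro nn_integral_PInf_AE) auto
  then have summable_h: "AE \<omega> in M. summable (\<lambda>k. norm (h k \<omega>))"
    by eventually_elim (auto intro!: summable_suminf_not_top)
  \<comment> \<open>The limit written as a telescoping series. Taking \<open>suminf\<close> at every
    point keeps \<open>G\<close> measurable for \<open>F\<close> itself.\<close>
  define G where "G \<omega> = g (r 0) \<omega> + (\<Sum>k. h k \<omega>)" for \<omega>
  have g0: "integrable M (g (r 0))" and g0_F [measurable]: "g (r 0) \<in> borel_measurable F"
    using g unfolding is_cond_exp_def by auto
  have sum_int: "integrable M (\<lambda>\<omega>. \<Sum>k. h k \<omega>)"
    by (rule integrable_suminf[OF h_int summable_h summable_int])
  have "(LINT \<omega>:A|M. G \<omega>) = (LINT \<omega>:A|M. f \<omega>)" if A: "A \<in> sets F" for A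
  proof -
    have A_M [measurable]: "A \<in> sets M"
      using sets_F_subset A .
    have set_int: "set_integrable M A k" if "integrable M k" for k :: "'a \<Rightarrow> 'b"
      unfolding set_integrable_def by (rule integrable_mult_indicator[OF A_M that])
    have "(\<lambda>k. LINT \<omega>:A|M. h k \<omega>) sums (LINT \<omega>|M. (\<Sum>k. indicator A \<omega> *\<^sub>R h k \<omega>))"
      unfolding set_lebesgue_integral_def
    proof (rule sums_integral)
      show "integrable M (\<lambda>\<omega>. indicator A \<omega> *\<^sub>R h k \<omega>)" for k
        by (rule integrable_mult_indicator[OF A_M h_int])
      show "AE \<omega> in M. summable (\<lambda>k. norm (indicator A \<omega> *\<^sub>R h k \<omega>))"
        using summable_h by eventually_elim (simp add: indicator_def)
      have "(LINT \<omega>|M. norm (indicator A \<omega> *\<^sub>R h k \<omega>)) \<le> (LINT \<omega>|M. norm (h k \<omega>))" for k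
        using h_int integrable_mult_indicator[OF A_M h_int]
        by (intro integral_mono integrable_norm) (auto simp: indicator_def)
      then show "summable (\<lambda>k. LINT \<omega>|M. norm (indicator A \<omega> *\<^sub>R h k \<omega>))"
        by (intro summable_comparison_test[OF _ summable_int]) auto
    qed
    moreover have "(LINT \<omega>|M. (\<Sum>k. indicator A \<omega> *\<^sub>R h k \<omega>)) = (LINT \<omega>:A|M. (\<Sum>k. h k \<omega>))"
      unfolding set_lebesgue_integral_def by (intro Bochner_Integration.integral_cong) (auto simp: indicator_def)
    moreover have "(LINT \<omega>:A|M. h k \<omega>) = (LINT \<omega>:A|M. s (r (Suc k)) \<omega>) - (LINT \<omega>:A|M. s (r k) \<omega>)" for k
      using uh[of k] A set_integral_diff(2)[OF set_int[OF s] set_int[OF s]]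
      unfolding is_cond_exp_def u_def by auto
    ultimately have "(\<lambda>k. (LINT \<omega>:A|M. s (r (Suc k)) \<omega>) - (LINT \<omega>:A|M. s (r k) \<omega>)) sums
        (LINT \<omega>:A|M. (\<Sum>k. h k \<omega>))"
      by simp
    then have "(\<lambda>n. (LINT \<omega>:A|M. s (r n) \<omega>) - (LINT \<omega>:A|M. s (r 0) \<omega>)) \<longlonglongrightarrow> (LINT \<omega>:A|M. (\<Sum>k. h k \<omega>))"
      unfolding sums_def sum_lessThan_telescope[of "\<lambda>k. LINT \<omega>:A|M. s (r k) \<omega>"] .
    moreover have "(\<lambda>n. LINT \<omega>:A|M. s (r n) \<omega>) \<longlonglongrightarrow> (LINT \<omega>:A|M. f \<omega>)"
    proof (rule LIM_zero_cancel, rule Lim_null_comparison)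
      have "norm ((LINT \<omega>:A|M. s (r n) \<omega>) - (LINT \<omega>:A|M. f \<omega>)) \<le> (1/2) ^ n" for n
      proof -
        have "norm ((LINT \<omega>:A|M. s (r n) \<omega>) - (LINT \<omega>:A|M. f \<omega>)) = norm (LINT \<omega>:A|M. s (r n) \<omega> - f \<omega>)"
          using set_integral_diff(2)[OF set_int[OF s] set_int[OF f]] by simp
        also have "\<dots> \<le> (LINT \<omega>|M. norm (s (r n) \<omega> - f \<omega>))"
          unfolding set_lebesgue_integral_def
          using s f integrable_mult_indicator[OF A_M, of "\<lambda>\<omega>. s (r n) \<omega> - f \<omega>"]
          by (intro order_trans[OF integral_norm_bound] integral_mono integrable_norm)
            (auto simp: indicator_def)
        finally show ?thesis
          using r[of n] by linarith
      qed
      then show "\<forall>\<^sub>F n in sequentially. norm ((LINT \<omega>:A|M. s (r n) \<omega>) - (LINT \<omega>:A|M. f \<omega>)) \<le> (1/2) ^ n"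
        by simp
      show "(\<lambda>n. (1/2) ^ n :: real) \<longlonglongrightarrow> 0"
        by (intro LIMSEQ_power_zero) simp
    qed
    then have "(\<lambda>n. (LINT \<omega>:A|M. s (r n) \<omega>) - (LINT \<omega>:A|M. s (r 0) \<omega>)) \<longlonglongrightarrow>
        (LINT \<omega>:A|M. f \<omega>) - (LINT \<omega>:A|M. s (r 0) \<omega>)"
      by (intro tendsto_diff tendsto_const)
    ultimately have "(LINT \<omega>:A|M. (\<Sum>k. h k \<omega>)) = (LINT \<omega>:A|M. f \<omega>) - (LINT \<omega>:A|M. s (r 0) \<omega>)"
      by (rule LIMSEQ_unique)
    moreover have "(LINT \<omega>:A|M. g (r 0) \<omega>) = (LINT \<omega>:A|M. s (r 0) \<omega>)"
      using g[of "r 0"] A unfolding is_cond_exp_def by blast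
    ultimately show ?thesis
      unfolding G_def using set_integral_add(2)[OF set_int[OF g0] set_int[OF sum_int]] by simp
  qed
  moreover have "integrable M G"
    unfolding G_def using g0 sum_int by simp
  moreover have "G \<in> borel_measurable F"
    unfolding G_def by measurable
  ultimately show ?thesis
    unfolding is_cond_exp_def by blast
qed

text \<open>For an indicator times a vector, the scalar conditional expectation times that vector
  works; sums and dominated limits reach all integrable functions.\<close>

lemma is_cond_exp_exists:
  fixes f :: "'a \<Rightarrow> 'b::{banach, second_countable_topology, real_inner}"
  assumes "integrable M f"
  shows "\<exists>g. is_cond_exp f g"
  using assms
proof (induction rule: integrable_induct)
  case (base A c)
  have ind: "integrable M (indicator A :: _ \<Rightarrow> real)"
    using base by (simp add: integrable_indicator_iff)
  let ?E = "real_cond_exp M F (indicator A)"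
  have "(LINT \<omega>:B|M. ?E \<omega> *\<^sub>R c) = (LINT \<omega>:B|M. indicator A \<omega> *\<^sub>R c)" if B: "B \<in> sets F" for B
  proof -
    have "(LINT \<omega>:B|M. k \<omega> *\<^sub>R c) = (LINT \<omega>:B|M. k \<omega>) *\<^sub>R c" if "integrable M k" for k :: "'a \<Rightarrow> real"
    proof -
      have "(LINT \<omega>:B|M. k \<omega> *\<^sub>R c) = (LINT \<omega>|M. (indicator B \<omega> *\<^sub>R k \<omega>) *\<^sub>R c)"
        unfolding set_lebesgue_integral_def by simp
      also have "\<dots> = (LINT \<omega>:B|M. k \<omega>) *\<^sub>R c"
        unfolding set_lebesgue_integral_def
        using integrable_mult_indicator[OF sets_F_subset[OF B] that] by (intro integral_scaleR_left) auto
      finally show ?thesis .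
    qed
    then show ?thesis
      using ind real_cond_exp_int(1)[OF ind] real_cond_exp_intA[OF ind B] by simp
  qed
  then have "is_cond_exp (\<lambda>\<omega>. indicator A \<omega> *\<^sub>R c) (\<lambda>\<omega>. ?E \<omega> *\<^sub>R c)"
    using real_cond_exp_int(1)[OF ind] unfolding is_cond_exp_def by simp
  then show ?case
    by blast
next
  case (add f f')
  then show ?case
    using is_cond_exp_add by blast
next
  case (lim f s)
  then obtain g where g: "\<And>i. is_cond_exp (s i) (g i)"
    by metis
  have "(\<lambda>i. LINT \<omega>|M. norm (s i \<omega> - f \<omega>)) \<longlonglongrightarrow> (LINT \<omega>|M. 0)"
  proof (rule integral_dominated_convergence)
    \<comment> \<open>The approximations in this induction satisfy
      \<open>norm (s i \<omega>) \<le> 2 * norm (f \<omega>)\<close>, which gives the factor 3 for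
      the difference.\<close>
    show "integrable M (\<lambda>\<omega>. 3 * norm (f \<omega>))"
      using lim.hyps(4) by simp
    show "AE \<omega> in M. (\<lambda>i. norm (s i \<omega> - f \<omega>)) \<longlonglongrightarrow> 0"
      using lim.hyps(2) by (intro AE_I2 tendsto_norm_zero LIM_zero)
    show "AE \<omega> in M. norm (norm (s i \<omega> - f \<omega>)) \<le> 3 * norm (f \<omega>)" for i
    proof (rule AE_I2)
      fix \<omega> assume "\<omega> \<in> space M"
      then show "norm (norm (s i \<omega> - f \<omega>)) \<le> 3 * norm (f \<omega>)"
        using lim.hyps(3)[of \<omega> i] norm_triangle_ineq4[of "s i \<omega>" "f \<omega>"] by simp
    qed
  qed (use borel_measurable_integrable[OF lim.hyps(1)] borel_measurable_integrable[OF lim.hyps(4)] in auto)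
  then show ?case
    using is_cond_exp_limit[of s f g] lim.hyps(1,4) g by simp
qed

lemma inner_cond_exp:
  fixes f :: "'a \<Rightarrow> 'b::{banach, second_countable_topology, real_inner}"
  assumes "integrable M f"
  shows "AE \<omega> in M. inner z (cond_exp M F f \<omega>) = real_cond_exp M F (\<lambda>\<omega>. inner z (f \<omega>)) \<omega>"
proof -
  have "is_cond_exp f (cond_exp M F f)"
    using someI_ex[OF is_cond_exp_exists[OF assms, unfolded is_cond_exp_def]]
    unfolding is_cond_exp_def cond_exp_def .
  from is_cond_exp_inner[OF assms this, of z] show ?thesis
    by eventually_elim simp
qed

end

section \<open>Expectations of products under independence\<close>

lemma sigma_sets_vimage_subset_sigma_rv:
  assumes "h \<in> borel_measurable (sigma_rv M \<Gamma>)"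
  shows "sigma_sets (space M) {h -` A \<inter> space M | A. A \<in> sets borel} \<subseteq> sets (sigma_rv M \<Gamma>)"
proof -
  have "{h -` A \<inter> space M | A. A \<in> sets borel} \<subseteq> sets (sigma_rv M \<Gamma>)"
    using measurable_sets[OF assms] by auto
  from sets.sigma_sets_subset[OF this] show ?thesis
    by simp
qed

text \<open>Formulated for functions measurable with respect to the generated algebras, so that it
  covers the square of \<open>lam n\<close> and step terms restricted to a past event.\<close>

lemma (in prob_space) indep_sigma_rv_product:
  fixes f g :: "'a \<Rightarrow> real"
  assumes indep: "indep_set (sets (sigma_rv M \<Phi>)) (sets (sigma_rv M \<Psi>))"
    and f: "f \<in> borel_measurable (sigma_rv M \<Phi>)" "integrable M f"
    and g: "g \<in> borel_measurable (sigma_rv M \<Psi>)" "integrable M g"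
  shows "integrable M (\<lambda>\<omega>. f \<omega> * g \<omega>)"
    and "expectation (\<lambda>\<omega>. f \<omega> * g \<omega>) = expectation f * expectation g"
proof -
  have "indep_var borel f borel g"
    unfolding indep_var_eq
  proof (intro conjI)
    show "random_variable borel f" "random_variable borel g"
      using f g by auto
    show "indep_set (sigma_sets (space M) {f -` A \<inter> space M | A. A \<in> sets borel})
        (sigma_sets (space M) {g -` A \<inter> space M | A. A \<in> sets borel})"
      using indep sigma_sets_vimage_subset_sigma_rv[OF f(1)] sigma_sets_vimage_subset_sigma_rv[OF g(1)]
      unfolding indep_sets2_eq by blast
  qed
  then show "integrable M (\<lambda>\<omega>. f \<omega> * g \<omega>)"
    and "expectation (\<lambda>\<omega>. f \<omega> * g \<omega>) = expectation f * expectation g"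
    using indep_var_integrable indep_var_lebesgue_integral f(2) g(2) by blast+
qed

section \<open>Modes of convergence\<close>

lemma Lp2_iff: "x \<in> Lp 2 M \<longleftrightarrow> x \<in> borel_measurable M \<and> integrable M (\<lambda>\<omega>. (norm (x \<omega>))\<^sup>2)"
  unfolding Lp_def by (simp add: powr_numeral)

lemma Lp1_iff: "x \<in> Lp 1 M \<longleftrightarrow> x \<in> borel_measurable M \<and> integrable M (\<lambda>\<omega>. norm (x \<omega>))"
  unfolding Lp_def by simp

lemma norm_add_squared_le: "(norm (a + b))\<^sup>2 \<le> 2 * (norm a)\<^sup>2 + 2 * (norm b)\<^sup>2"
  for a b :: "'a::real_normed_vector"
proof -
  have "(norm (a + b))\<^sup>2 \<le> (norm a + norm b)\<^sup>2"
    by (intro power_mono norm_triangle_ineq) simp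
  also have "\<dots> \<le> 2 * (norm a)\<^sup>2 + 2 * (norm b)\<^sup>2"
    using sum_squares_bound[of "norm a" "norm b"] by (simp add: power2_sum)
  finally show ?thesis .
qed

lemma Lp2_add:
  fixes x y :: "'w \<Rightarrow> 'a::{real_normed_vector, second_countable_topology}"
  assumes "x \<in> Lp 2 M" "y \<in> Lp 2 M"
  shows "(\<lambda>\<omega>. x \<omega> + y \<omega>) \<in> Lp 2 M"
proof -
  have [measurable]: "x \<in> borel_measurable M" "y \<in> borel_measurable M"
    using assms by (auto simp: Lp2_iff)
  have "integrable M (\<lambda>\<omega>. (norm (x \<omega> + y \<omega>))\<^sup>2)"
    by (rule Bochner_Integration.integrable_bound[of _ "\<lambda>\<omega>. 2 * (norm (x \<omega>))\<^sup>2 + 2 * (norm (y \<omega>))\<^sup>2"])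
      (use assms norm_add_squared_le in \<open>auto simp: Lp2_iff\<close>)
  then show ?thesis
    by (simp add: Lp2_iff)
qed

lemma Lp2_minus:
  fixes x :: "'w \<Rightarrow> 'a::{real_normed_vector, second_countable_topology}"
  shows "x \<in> Lp 2 M \<Longrightarrow> (\<lambda>\<omega>. - x \<omega>) \<in> Lp 2 M"
  by (auto simp: Lp2_iff)

lemma Lp2_diff:
  fixes x y :: "'w \<Rightarrow> 'a::{real_normed_vector, second_countable_topology}"
  assumes "x \<in> Lp 2 M" "y \<in> Lp 2 M"
  shows "(\<lambda>\<omega>. x \<omega> - y \<omega>) \<in> Lp 2 M"
  using Lp2_add[OF assms(1) Lp2_minus[OF assms(2)]] by simp

lemma Lp2_const: "finite_measure M \<Longrightarrow> (\<lambda>_. z) \<in> Lp 2 M"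
  by (simp add: Lp2_iff finite_measure.integrable_const)

lemma integrable_inner_Lp2:
  fixes x y :: "'w \<Rightarrow> 'a::{real_inner, second_countable_topology}"
  assumes "x \<in> Lp 2 M" "y \<in> Lp 2 M"
  shows "integrable M (\<lambda>\<omega>. inner (x \<omega>) (y \<omega>))"
proof -
  have [measurable]: "x \<in> borel_measurable M" "y \<in> borel_measurable M"
    using assms by (auto simp: Lp2_iff)
  have "\<bar>inner a b\<bar> \<le> (norm a)\<^sup>2 + (norm b)\<^sup>2" for a b :: 'a
    using Cauchy_Schwarz_ineq2[of a b] sum_squares_bound[of "norm a" "norm b"]
      mult_nonneg_nonneg[OF norm_ge_zero[of a] norm_ge_zero[of b]] by linarith
  then have "AE \<omega> in M. norm (inner (x \<omega>) (y \<omega>)) \<le> norm ((norm (x \<omega>))\<^sup>2 + (norm (y \<omega>))\<^sup>2)"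
    by (intro AE_I2) (simp only: real_norm_def abs_of_nonneg add_nonneg_nonneg zero_le_power2)
  moreover have "integrable M (\<lambda>\<omega>. (norm (x \<omega>))\<^sup>2 + (norm (y \<omega>))\<^sup>2)"
    using assms by (simp add: Lp2_iff)
  ultimately show ?thesis
    by (rule Bochner_Integration.integrable_bound[rotated 2]) simp
qed

lemma (in finite_measure) integrable_norm_Lp2:
  assumes "x \<in> Lp 2 M"
  shows "integrable M (\<lambda>\<omega>. norm (x \<omega>))"
proof -
  have [measurable]: "x \<in> borel_measurable M"
    using assms by (simp add: Lp2_iff)
  have "norm a \<le> 1 + (norm a)\<^sup>2" for a :: 'b
    using sum_squares_bound[of 1 "norm a"] norm_ge_zero[of a] unfolding power_one mult_1_right by linarith
  then have "AE \<omega> in M. norm (norm (x \<omega>)) \<le> norm (1 + (norm (x \<omega>))\<^sup>2)"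
    by (intro AE_I2) (simp only: real_norm_def abs_of_nonneg add_nonneg_nonneg zero_le_power2 norm_ge_zero zero_le_one)
  moreover have "integrable M (\<lambda>\<omega>. 1 + (norm (x \<omega>))\<^sup>2)"
    using assms by (simp add: Lp2_iff)
  ultimately show ?thesis
    by (rule Bochner_Integration.integrable_bound[rotated 2]) simp
qed

lemma expectation_norm_diff_squared_le:
  fixes x y :: "'w \<Rightarrow> 'a::{real_normed_vector, second_countable_topology}"
  assumes "x \<in> Lp 2 M" "y \<in> Lp 2 M"
  shows "(LINT \<omega>|M. (norm (x \<omega> - y \<omega>))\<^sup>2) \<le> 2 * (LINT \<omega>|M. (norm (x \<omega>))\<^sup>2) + 2 * (LINT \<omega>|M. (norm (y \<omega>))\<^sup>2)"
proof -
  have int: "integrable M (\<lambda>\<omega>. 2 * (norm (x \<omega>))\<^sup>2)" "integrable M (\<lambda>\<omega>. 2 * (norm (y \<omega>))\<^sup>2)"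
    using assms by (auto simp: Lp2_iff)
  have "(LINT \<omega>|M. (norm (x \<omega> - y \<omega>))\<^sup>2) \<le> (LINT \<omega>|M. 2 * (norm (x \<omega>))\<^sup>2 + 2 * (norm (y \<omega>))\<^sup>2)"
    using Lp2_diff[OF assms] int norm_add_squared_le[of "x \<omega>" "- y \<omega>" for \<omega>]
    by (intro integral_mono Bochner_Integration.integrable_add) (auto simp: Lp2_iff)
  then show ?thesis
    using int by simp
qed

text \<open>The tangent inequality
  \<open>2 * inner x y - (norm y)\<^sup>2 \<le> (norm x)\<^sup>2\<close> gives weak lower
  semicontinuity of the squared norm, and Fatou's lemma integrates it.\<close>

lemma AE_weakly_converges_Lp2:
  fixes x :: "nat \<Rightarrow> 'w \<Rightarrow> 'a::{real_inner, second_countable_topology}"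
  assumes x: "\<And>n. x n \<in> Lp 2 M" and K: "\<And>n. (LINT \<omega>|M. (norm (x n \<omega>))\<^sup>2) \<le> K"
    and y [measurable]: "y \<in> borel_measurable M"
    and conv: "AE \<omega> in M. weakly_converges (\<lambda>n. x n \<omega>) (y \<omega>)"
  shows "y \<in> Lp 2 M"
proof -
  have [measurable]: "x n \<in> borel_measurable M" for n
    using x by (simp add: Lp2_iff)
  have "AE \<omega> in M. ennreal ((norm (y \<omega>))\<^sup>2) \<le> liminf (\<lambda>n. ennreal ((norm (x n \<omega>))\<^sup>2))"
    using conv
  proof eventually_elim
    case (elim \<omega>)
    have "(\<lambda>n. 2 * inner (x n \<omega>) (y \<omega>) - (norm (y \<omega>))\<^sup>2) \<longlonglongrightarrow> 2 * inner (y \<omega>) (y \<omega>) - (norm (y \<omega>))\<^sup>2"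
      using elim unfolding weakly_converges_def
      by (intro tendsto_diff tendsto_mult tendsto_const) blast
    then have "(\<lambda>n. ennreal (2 * inner (x n \<omega>) (y \<omega>) - (norm (y \<omega>))\<^sup>2)) \<longlonglongrightarrow> ennreal ((norm (y \<omega>))\<^sup>2)"
      by (intro tendsto_ennrealI) (simp add: power2_norm_eq_inner)
    then have "ennreal ((norm (y \<omega>))\<^sup>2) = liminf (\<lambda>n. ennreal (2 * inner (x n \<omega>) (y \<omega>) - (norm (y \<omega>))\<^sup>2))"
      by (intro lim_imp_Liminf[symmetric]) auto
    also have "\<dots> \<le> liminf (\<lambda>n. ennreal ((norm (x n \<omega>))\<^sup>2))"
    proof (intro Liminf_mono always_eventually allI ennreal_leI)
      fix n
      have "0 \<le> (norm (x n \<omega> - y \<omega>))\<^sup>2"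
        by simp
      then show "2 * inner (x n \<omega>) (y \<omega>) - (norm (y \<omega>))\<^sup>2 \<le> (norm (x n \<omega>))\<^sup>2"
        unfolding power2_norm_eq_inner by (simp add: inner_diff_left inner_diff_right inner_commute)
    qed
    finally show ?case .
  qed
  then have "(\<integral>\<^sup>+ \<omega>. ennreal ((norm (y \<omega>))\<^sup>2) \<partial>M) \<le> (\<integral>\<^sup>+ \<omega>. liminf (\<lambda>n. ennreal ((norm (x n \<omega>))\<^sup>2)) \<partial>M)"
    by (rule nn_integral_mono_AE)
  also have "\<dots> \<le> liminf (\<lambda>n. \<integral>\<^sup>+ \<omega>. ennreal ((norm (x n \<omega>))\<^sup>2) \<partial>M)"
    by (intro nn_integral_liminf) auto
  also have "\<dots> \<le> ennreal K"
    using x K by (intro Liminf_le always_eventually) (auto simp: Lp2_iff nn_integral_eq_integral intro!: ennreal_leI)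
  finally show ?thesis
    unfolding Lp2_iff by (auto intro!: integrableI_bounded simp: top_unique less_top[symmetric] power_abs)
qed

text \<open>Off the events \<open>B k\<close>, on which all \<open>x n - y\<close> are bounded by \<open>k\<close>, Young's inequality with a
  small weight \<open>\<eta>\<close> trades the \<open>L\<^sup>2\<close> bound against the tail of \<open>u\<close>.\<close>

lemma (in prob_space) AE_weakly_converges_imp_L2_weakly_converges:
  fixes x :: "nat \<Rightarrow> 'a \<Rightarrow> 'b::{real_inner, complete_space, second_countable_topology}"
  assumes x: "\<And>n. x n \<in> Lp 2 M" and K: "\<And>n. expectation (\<lambda>\<omega>. (norm (x n \<omega>))\<^sup>2) \<le> K"
    and y: "y \<in> borel_measurable M"
    and conv: "AE \<omega> in M. weakly_converges (\<lambda>n. x n \<omega>) (y \<omega>)"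
  shows "L2_weakly_converges M x y"
proof -
  have y2: "y \<in> Lp 2 M"
    using AE_weakly_converges_Lp2[OF x K y conv] .
  define v where "v n \<omega> = x n \<omega> - y \<omega>" for n \<omega>
  have v: "v n \<in> Lp 2 M" for n
    using Lp2_diff[OF x y2] unfolding v_def .
  define K' where "K' = 2 * K + 2 * expectation (\<lambda>\<omega>. (norm (y \<omega>))\<^sup>2)"
  have v_le: "expectation (\<lambda>\<omega>. (norm (v n \<omega>))\<^sup>2) \<le> K'" for n
    using expectation_norm_diff_squared_le[OF x[of n] y2] K[of n] unfolding v_def K'_def by linarith
  have "0 \<le> expectation (\<lambda>\<omega>. (norm (v 0 \<omega>))\<^sup>2)"
    by simp
  with v_le[of 0] have K'0: "0 \<le> K'"
    by linarith
  have v_conv: "AE \<omega> in M. weakly_converges (\<lambda>n. v n \<omega>) 0"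
    using conv
  proof eventually_elim
    case (elim \<omega>)
    then show ?case
      using weakly_converges_diff[OF elim tendsto_imp_weakly_converges[OF tendsto_const], of "y \<omega>"]
      unfolding v_def by simp
  qed
  have [measurable]: "v n \<in> borel_measurable M" for n
    using v by (simp add: Lp2_iff)
  define B where "B k = {\<omega> \<in> space M. \<forall>n. norm (v n \<omega>) \<le> real k}" for k
  have B [measurable]: "B k \<in> sets M" for k
    unfolding B_def by measurable
  have lim: "(\<lambda>n. expectation (\<lambda>\<omega>. inner (v n \<omega>) (u \<omega>))) \<longlonglongrightarrow> 0" if u: "u \<in> Lp 2 M" for u
  proof (rule LIMSEQ_I)
    fix \<epsilon> :: real assume "\<epsilon> > 0"
    have [measurable]: "u \<in> borel_measurable M" and u2: "integrable M (\<lambda>\<omega>. (norm (u \<omega>))\<^sup>2)"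
      using u by (auto simp: Lp2_iff)
    \<comment> \<open>The budget: less than \<open>\<epsilon> / 4\<close> on \<open>B k\<close>, and
      off it less than \<open>\<epsilon> / 4\<close> from \<open>\<eta> / 2 * K'\<close> plus
      \<open>\<epsilon> / 8\<close> from the tail of \<open>u\<close>.\<close>
    define \<eta> where "\<eta> = \<epsilon> / (2 * (K' + 1))"
    have \<eta>: "\<eta> > 0"
      using \<open>\<epsilon> > 0\<close> K'0 unfolding \<eta>_def by simp
    have \<eta>K: "\<eta> * K' < \<epsilon> / 2"
      using \<open>\<epsilon> > 0\<close> K'0 unfolding \<eta>_def by (simp add: field_simps)
    have "(\<lambda>k. expectation (\<lambda>\<omega>. indicator (- B k) \<omega> * (norm (u \<omega>))\<^sup>2)) \<longlonglongrightarrow> expectation (\<lambda>_. 0)"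
    proof (rule integral_dominated_convergence[OF _ _ u2])
      show "AE \<omega> in M. (\<lambda>k. indicator (- B k) \<omega> * (norm (u \<omega>))\<^sup>2) \<longlonglongrightarrow> 0"
        using v_conv AE_space
      proof eventually_elim
        case (elim \<omega>)
        \<comment> \<open>A weakly convergent path is bounded, so almost every point lies in
          \<open>B k\<close> for all large \<open>k\<close>.\<close>
        obtain N where N: "\<And>n. norm (v n \<omega>) \<le> N"
          using weakly_converges_bounded[OF elim(1)] unfolding bounded_iff by auto
        obtain k0 :: nat where k0: "N \<le> real k0"
          using real_arch_simple by blast
        have "\<forall>\<^sub>F k in sequentially. indicator (- B k) \<omega> * (norm (u \<omega>))\<^sup>2 = 0"
          using eventually_ge_at_top[of k0]
        proof eventually_elim
          case (elim k)
          then have "norm (v n \<omega>) \<le> real k" for n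
            using N[of n] k0 by linarith
          then show ?case
            using \<open>\<omega> \<in> space M\<close> unfolding B_def by (auto simp: indicator_def)
        qed
        then show ?case
          by (rule tendsto_eventually)
      qed
    qed (auto simp: indicator_def)
    then have "\<forall>\<^sub>F k in sequentially. expectation (\<lambda>\<omega>. indicator (- B k) \<omega> * (norm (u \<omega>))\<^sup>2) < \<eta> * (\<epsilon> / 4)"
      using \<eta> \<open>\<epsilon> > 0\<close> by (intro order_tendstoD(2)) auto
    then obtain k where k: "expectation (\<lambda>\<omega>. indicator (- B k) \<omega> * (norm (u \<omega>))\<^sup>2) < \<eta> * (\<epsilon> / 4)"
      using eventually_happens'[OF sequentially_bot] by blast
    have int_tail: "integrable M (\<lambda>\<omega>. indicator (- B k) \<omega> * (norm (u \<omega>))\<^sup>2)"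
      by (rule Bochner_Integration.integrable_bound[OF u2]) (auto simp: indicator_def)
    have v2: "integrable M (\<lambda>\<omega>. (norm (v n \<omega>))\<^sup>2)" for n
      using v by (simp add: Lp2_iff)
    have "(\<lambda>n. expectation (\<lambda>\<omega>. indicator (B k) \<omega> * inner (v n \<omega>) (u \<omega>))) \<longlonglongrightarrow> expectation (\<lambda>_. 0)"
    proof (rule integral_dominated_convergence[where w = "\<lambda>\<omega>. real k * norm (u \<omega>)"])
      show "integrable M (\<lambda>\<omega>. real k * norm (u \<omega>))"
        using integrable_norm_Lp2[OF u] by simp
      show "AE \<omega> in M. (\<lambda>n. indicator (B k) \<omega> * inner (v n \<omega>) (u \<omega>)) \<longlonglongrightarrow> 0"
        using v_conv by eventually_elim (auto simp: weakly_converges_def intro!: tendsto_mult_right_zero)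
      show "AE \<omega> in M. norm (indicator (B k) \<omega> * inner (v n \<omega>) (u \<omega>)) \<le> real k * norm (u \<omega>)" for n
      proof (rule AE_I2)
        fix \<omega>
        show "norm (indicator (B k) \<omega> * inner (v n \<omega>) (u \<omega>)) \<le> real k * norm (u \<omega>)"
          using Cauchy_Schwarz_ineq2[of "v n \<omega>" "u \<omega>"] mult_right_mono[of "norm (v n \<omega>)" "real k" "norm (u \<omega>)"]
          unfolding B_def by (auto simp: indicator_def)
      qed
    qed auto
    then have "\<forall>\<^sub>F n in sequentially. \<bar>expectation (\<lambda>\<omega>. indicator (B k) \<omega> * inner (v n \<omega>) (u \<omega>))\<bar> < \<epsilon> / 4"
      using \<open>\<epsilon> > 0\<close> by (intro order_tendstoD(2)[OF tendsto_rabs_zero]) auto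
    then obtain N where N: "\<And>n. N \<le> n \<Longrightarrow> \<bar>expectation (\<lambda>\<omega>. indicator (B k) \<omega> * inner (v n \<omega>) (u \<omega>))\<bar> < \<epsilon> / 4"
      unfolding eventually_sequentially by blast
    show "\<exists>N. \<forall>n\<ge>N. norm (expectation (\<lambda>\<omega>. inner (v n \<omega>) (u \<omega>)) - 0) < \<epsilon>"
    proof (intro exI[of _ N] allI impI)
      fix n assume "N \<le> n"
      have int: "integrable M (\<lambda>\<omega>. inner (v n \<omega>) (u \<omega>))"
        by (rule integrable_inner_Lp2[OF v u])
      have int_B: "integrable M (\<lambda>\<omega>. indicator (B k) \<omega> * inner (v n \<omega>) (u \<omega>))"
          "integrable M (\<lambda>\<omega>. indicator (- B k) \<omega> * inner (v n \<omega>) (u \<omega>))"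
        by (rule Bochner_Integration.integrable_bound[OF int]; auto simp: indicator_def)+
      have young: "\<bar>indicator (- B k) \<omega> * inner (v n \<omega>) (u \<omega>)\<bar> \<le>
          \<eta> / 2 * (norm (v n \<omega>))\<^sup>2 + 1 / (2 * \<eta>) * (indicator (- B k) \<omega> * (norm (u \<omega>))\<^sup>2)" for \<omega>
      proof -
        have "0 \<le> (\<eta> * norm (v n \<omega>) - norm (u \<omega>))\<^sup>2 / (2 * \<eta>)"
          using \<eta> by simp
        also have "\<dots> = \<eta> / 2 * (norm (v n \<omega>))\<^sup>2 + 1 / (2 * \<eta>) * (norm (u \<omega>))\<^sup>2 - norm (v n \<omega>) * norm (u \<omega>)"
          using \<eta> by (simp add: power2_diff power2_eq_square field_simps)
        finally show ?thesis
          using Cauchy_Schwarz_ineq2[of "v n \<omega>" "u \<omega>"] \<eta> by (auto simp: indicator_def)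
      qed
      have "\<bar>expectation (\<lambda>\<omega>. indicator (- B k) \<omega> * inner (v n \<omega>) (u \<omega>))\<bar>
          \<le> expectation (\<lambda>\<omega>. \<bar>indicator (- B k) \<omega> * inner (v n \<omega>) (u \<omega>)\<bar>)"
        using integral_norm_bound[of M "\<lambda>\<omega>. indicator (- B k) \<omega> * inner (v n \<omega>) (u \<omega>)"] by simp
      also have "\<dots> \<le> expectation (\<lambda>\<omega>. \<eta> / 2 * (norm (v n \<omega>))\<^sup>2 +
          1 / (2 * \<eta>) * (indicator (- B k) \<omega> * (norm (u \<omega>))\<^sup>2))"
        using int_B(2) v2[of n] int_tail young by (intro integral_mono) auto
      also have "\<dots> = \<eta> / 2 * expectation (\<lambda>\<omega>. (norm (v n \<omega>))\<^sup>2) +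
          1 / (2 * \<eta>) * expectation (\<lambda>\<omega>. indicator (- B k) \<omega> * (norm (u \<omega>))\<^sup>2)"
        using v2[of n] int_tail by simp
      also have "\<dots> \<le> \<eta> / 2 * K' + 1 / (2 * \<eta>) * (\<eta> * (\<epsilon> / 4))"
        using v_le[of n] k \<eta> by (intro add_mono mult_left_mono) auto
      also have "\<dots> < \<epsilon> / 4 + \<epsilon> / 8"
        using \<eta> \<eta>K by (intro add_less_le_mono) (auto simp: mult.commute)
      finally have tail: "\<bar>expectation (\<lambda>\<omega>. indicator (- B k) \<omega> * inner (v n \<omega>) (u \<omega>))\<bar> < \<epsilon> / 4 + \<epsilon> / 8" .
      have "expectation (\<lambda>\<omega>. inner (v n \<omega>) (u \<omega>)) = expectation (\<lambda>\<omega>.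
          indicator (B k) \<omega> * inner (v n \<omega>) (u \<omega>) + indicator (- B k) \<omega> * inner (v n \<omega>) (u \<omega>))"
        by (intro Bochner_Integration.integral_cong) (auto simp: indicator_def)
      also have "\<dots> = expectation (\<lambda>\<omega>. indicator (B k) \<omega> * inner (v n \<omega>) (u \<omega>)) +
          expectation (\<lambda>\<omega>. indicator (- B k) \<omega> * inner (v n \<omega>) (u \<omega>))"
        using int_B by (rule Bochner_Integration.integral_add)
      finally show "norm (expectation (\<lambda>\<omega>. inner (v n \<omega>) (u \<omega>)) - 0) < \<epsilon>"
        using tail N[OF \<open>N \<le> n\<close>] by simp
    qed
  qed
  have "(\<lambda>n. expectation (\<lambda>\<omega>. inner (x n \<omega>) (u \<omega>))) \<longlonglongrightarrow> expectation (\<lambda>\<omega>. inner (y \<omega>) (u \<omega>))"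
    if u: "u \<in> Lp 2 M" for u
  proof (rule LIM_zero_cancel)
    have "expectation (\<lambda>\<omega>. inner (x n \<omega>) (u \<omega>)) - expectation (\<lambda>\<omega>. inner (y \<omega>) (u \<omega>))
        = expectation (\<lambda>\<omega>. inner (v n \<omega>) (u \<omega>))" for n
      unfolding v_def inner_diff_left
      by (rule Bochner_Integration.integral_diff[symmetric]) (intro integrable_inner_Lp2 x y2 u)+
    then show "(\<lambda>n. expectation (\<lambda>\<omega>. inner (x n \<omega>) (u \<omega>)) - expectation (\<lambda>\<omega>. inner (y \<omega>) (u \<omega>))) \<longlonglongrightarrow> 0"
      using lim[OF u] by simp
  qed
  then show ?thesis
    using x y2 unfolding L2_weakly_converges_def by blast
qed

text \<open>The \<open>L\<^sup>2\<close> bound provides uniform integrability: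
  \<open>t \<le> min t R + t\<^sup>2 / R\<close> splits the distance into a truncation, which
  bounded convergence handles, and a remainder that is small uniformly in \<open>n\<close>.\<close>

lemma (in prob_space) AE_tendsto_imp_Lp_converges_1:
  fixes x :: "nat \<Rightarrow> 'a \<Rightarrow> 'b::{real_inner, second_countable_topology}"
  assumes x: "\<And>n. x n \<in> Lp 2 M" and K: "\<And>n. expectation (\<lambda>\<omega>. (norm (x n \<omega>))\<^sup>2) \<le> K"
    and y: "y \<in> borel_measurable M"
    and conv: "AE \<omega> in M. (\<lambda>n. x n \<omega>) \<longlonglongrightarrow> y \<omega>"
  shows "Lp_converges 1 M x y"
proof -
  have "AE \<omega> in M. weakly_converges (\<lambda>n. x n \<omega>) (y \<omega>)"
    using conv by eventually_elim (rule tendsto_imp_weakly_converges)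
  then have y2: "y \<in> Lp 2 M"
    using AE_weakly_converges_Lp2[of x, OF x K y] by blast
  define v where "v n \<omega> = norm (x n \<omega> - y \<omega>)" for n \<omega>
  define K' where "K' = 2 * K + 2 * expectation (\<lambda>\<omega>. (norm (y \<omega>))\<^sup>2)"
  have xy: "(\<lambda>\<omega>. x n \<omega> - y \<omega>) \<in> Lp 2 M" for n
    using Lp2_diff[OF x y2] .
  have v_int: "integrable M (v n)" "integrable M (\<lambda>\<omega>. (v n \<omega>)\<^sup>2)" for n
    using integrable_norm_Lp2[OF xy] xy[of n] unfolding v_def Lp2_iff by auto
  have [measurable]: "v n \<in> borel_measurable M" for n
    using v_int by simp
  have v_nonneg: "0 \<le> v n \<omega>" for n \<omega>
    unfolding v_def by simp
  have v_le: "expectation (\<lambda>\<omega>. (v n \<omega>)\<^sup>2) \<le> K'" for n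
    using expectation_norm_diff_squared_le[OF x[of n] y2] K[of n] unfolding v_def K'_def by linarith
  have "(\<lambda>n. expectation (v n)) \<longlonglongrightarrow> 0"
  proof (rule LIMSEQ_I)
    fix \<epsilon> :: real assume "\<epsilon> > 0"
    \<comment> \<open>Chosen so that \<open>K' / R \<le> \<epsilon> / 2\<close>; the added 1 keeps
      \<open>R\<close> positive.\<close>
    define R where "R = 2 * (\<bar>K'\<bar> + 1) / \<epsilon>"
    have R: "R > 0" "R * (\<epsilon> / 2) = \<bar>K'\<bar> + 1"
      using \<open>\<epsilon> > 0\<close> unfolding R_def by (auto simp: field_simps)
    have KR: "K' / R \<le> \<epsilon> / 2"
      using R by (simp add: pos_divide_le_eq mult.commute)
    have "(\<lambda>n. expectation (\<lambda>\<omega>. min (v n \<omega>) R)) \<longlonglongrightarrow> expectation (\<lambda>_. 0)"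
    proof (rule integral_dominated_convergence[where w = "\<lambda>_. R"])
      show "AE \<omega> in M. (\<lambda>n. min (v n \<omega>) R) \<longlonglongrightarrow> 0"
        using conv
      proof eventually_elim
        case (elim \<omega>)
        have "(\<lambda>n. min (v n \<omega>) R) \<longlonglongrightarrow> min 0 R"
          unfolding v_def by (intro tendsto_min tendsto_norm_zero LIM_zero elim tendsto_const)
        then show ?case
          using R by simp
      qed
      show "AE \<omega> in M. norm (min (v n \<omega>) R) \<le> R" for n
        using R unfolding v_def by auto
    qed auto
    then have "\<forall>\<^sub>F n in sequentially. expectation (\<lambda>\<omega>. min (v n \<omega>) R) < \<epsilon> / 2"
      using \<open>\<epsilon> > 0\<close> by (intro order_tendstoD(2)) auto
    then obtain N where N: "\<And>n. N \<le> n \<Longrightarrow> expectation (\<lambda>\<omega>. min (v n \<omega>) R) < \<epsilon> / 2"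
      unfolding eventually_sequentially by blast
    show "\<exists>N. \<forall>n\<ge>N. norm (expectation (v n) - 0) < \<epsilon>"
    proof (intro exI[of _ N] allI impI)
      fix n assume "N \<le> n"
      have min_int: "integrable M (\<lambda>\<omega>. min (v n \<omega>) R)"
        using R v_nonneg[of n] by (intro integrable_const_bound[of _ R]) auto
      have le: "t \<le> min t R + t\<^sup>2 / R" if "0 \<le> t" for t
        using that R by (cases "t \<le> R") (auto simp: min_def power2_eq_square field_simps intro: mult_mono add_increasing)
      have "expectation (v n) \<le> expectation (\<lambda>\<omega>. min (v n \<omega>) R + (v n \<omega>)\<^sup>2 / R)"
        using v_int[of n] min_int v_nonneg[of n] by (intro integral_mono le) auto
      also have "\<dots> = expectation (\<lambda>\<omega>. min (v n \<omega>) R) + expectation (\<lambda>\<omega>. (v n \<omega>)\<^sup>2) / R"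
        using v_int[of n] min_int by simp
      also have "\<dots> < \<epsilon> / 2 + K' / R"
        using N[OF \<open>N \<le> n\<close>] v_le[of n] R by (intro add_less_le_mono divide_right_mono) auto
      finally have "expectation (v n) < \<epsilon>"
        using KR by linarith
      moreover have "0 \<le> expectation (v n)"
        unfolding v_def by simp
      ultimately show "norm (expectation (v n) - 0) < \<epsilon>"
        by simp
    qed
  qed
  then show ?thesis
    using integrable_norm_Lp2[OF x] integrable_norm_Lp2[OF y2] x y2
    unfolding Lp_converges_def Lp1_iff v_def by (auto simp: Lp2_iff)
qed

text \<open>Turns convergence in probability into \<open>L\<^sup>1\<close> convergence, from which
  almost surely convergent subsequences can be extracted. The truncated norm is at most
  \<open>\<epsilon> / 2\<close> off the exceptional event and at most 1 on it.\<close>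

lemma (in prob_space) converges_in_probability_truncation:
  fixes a :: "nat \<Rightarrow> 'a \<Rightarrow> 'b::{real_normed_vector, second_countable_topology}"
  assumes [measurable]: "\<And>n. a n \<in> borel_measurable M"
    and conv: "converges_in_probability M a (\<lambda>_. 0)"
  shows "(\<lambda>n. expectation (\<lambda>\<omega>. min 1 (norm (a n \<omega>)))) \<longlonglongrightarrow> 0"
proof (rule LIMSEQ_I)
  fix \<epsilon> :: real assume "\<epsilon> > 0"
  let ?A = "\<lambda>n. {\<omega> \<in> space M. \<epsilon> / 2 < norm (a n \<omega>)}"
  have "(\<lambda>n. prob (?A n)) \<longlonglongrightarrow> 0"
    using conv \<open>\<epsilon> > 0\<close> unfolding converges_in_probability_def by (auto dest: spec[of _ "\<epsilon> / 2"])
  then have "\<forall>\<^sub>F n in sequentially. prob (?A n) < \<epsilon> / 2"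
    using \<open>\<epsilon> > 0\<close> by (intro order_tendstoD(2)) auto
  then obtain N where N: "\<And>n. N \<le> n \<Longrightarrow> prob (?A n) < \<epsilon> / 2"
    unfolding eventually_sequentially by blast
  show "\<exists>N. \<forall>n\<ge>N. norm (expectation (\<lambda>\<omega>. min 1 (norm (a n \<omega>))) - 0) < \<epsilon>"
  proof (intro exI[of _ N] allI impI)
    fix n assume "N \<le> n"
    have "expectation (\<lambda>\<omega>. min 1 (norm (a n \<omega>))) \<le> expectation (\<lambda>\<omega>. \<epsilon> / 2 + indicator (?A n) \<omega>)"
    proof (rule integral_mono)
      show "integrable M (\<lambda>\<omega>. min 1 (norm (a n \<omega>)))"
        by (rule integrable_const_bound[of _ 1]) auto
      show "integrable M (\<lambda>\<omega>. \<epsilon> / 2 + indicator (?A n) \<omega>)"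
        by (intro Bochner_Integration.integrable_add) (auto simp: integrable_indicator_iff emeasure_eq_measure)
      show "min 1 (norm (a n \<omega>)) \<le> \<epsilon> / 2 + indicator (?A n) \<omega>" if "\<omega> \<in> space M" for \<omega>
        using that \<open>\<epsilon> > 0\<close> by (auto simp: indicator_def)
    qed
    also have "\<dots> = \<epsilon> / 2 + prob (?A n)"
      by (subst Bochner_Integration.integral_add)
        (auto simp: integrable_indicator_iff emeasure_eq_measure prob_space)
    also have "\<dots> < \<epsilon>"
      using N[OF \<open>N \<le> n\<close>] by simp
    finally show "norm (expectation (\<lambda>\<omega>. min 1 (norm (a n \<omega>))) - 0) < \<epsilon>"
      by simp
  qed
qed

text \<open>The sum of the three truncated norms tends to 0 in \<open>L\<^sup>1\<close>, so a single
  subsequence serves all three sequences.\<close>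

lemma (in prob_space) converges_in_probability_AE_subseq3:
  fixes a b c :: "nat \<Rightarrow> 'a \<Rightarrow> 'b::{real_normed_vector, second_countable_topology}"
  assumes [measurable]: "\<And>n. a n \<in> borel_measurable M" "\<And>n. b n \<in> borel_measurable M"
      "\<And>n. c n \<in> borel_measurable M"
    and "converges_in_probability M a (\<lambda>_. 0)" "converges_in_probability M b (\<lambda>_. 0)"
      "converges_in_probability M c (\<lambda>_. 0)"
  shows "\<exists>r. strict_mono (r :: nat \<Rightarrow> nat) \<and> (AE \<omega> in M. (\<lambda>n. a (r n) \<omega>) \<longlonglongrightarrow> 0 \<and>
    (\<lambda>n. b (r n) \<omega>) \<longlonglongrightarrow> 0 \<and> (\<lambda>n. c (r n) \<omega>) \<longlonglongrightarrow> 0)"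
proof -
  let ?m = "\<lambda>v :: 'b. min 1 (norm v)"
  let ?u = "\<lambda>n \<omega>. ?m (a n \<omega>) + ?m (b n \<omega>) + ?m (c n \<omega>)"
  have int: "integrable M (\<lambda>\<omega>. ?m (f \<omega>))" if [measurable]: "f \<in> borel_measurable M" for f
    by (rule integrable_const_bound[of _ 1]) auto
  have "expectation (\<lambda>\<omega>. norm (?u n \<omega>)) = expectation (\<lambda>\<omega>. ?m (a n \<omega>)) +
      expectation (\<lambda>\<omega>. ?m (b n \<omega>)) + expectation (\<lambda>\<omega>. ?m (c n \<omega>))" for n
  proof -
    have "norm (?u n \<omega>) = ?u n \<omega>" for \<omega>
      by simp
    then show ?thesis
      using int[of "a n"] int[of "b n"] int[of "c n"] by simp
  qed
  moreover have "(\<lambda>n. expectation (\<lambda>\<omega>. ?m (a n \<omega>)) + expectation (\<lambda>\<omega>. ?m (b n \<omega>)) +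
      expectation (\<lambda>\<omega>. ?m (c n \<omega>))) \<longlonglongrightarrow> 0 + 0 + 0"
    by (intro tendsto_add converges_in_probability_truncation assms)
  ultimately have "(\<lambda>n. expectation (\<lambda>\<omega>. norm (?u n \<omega>))) \<longlonglongrightarrow> 0"
    by simp
  moreover have "integrable M (?u n)" for n
    using int by simp
  ultimately obtain r where r: "strict_mono (r :: nat \<Rightarrow> nat)" and "AE \<omega> in M. (\<lambda>n. ?u (r n) \<omega>) \<longlonglongrightarrow> 0"
    using tendsto_L1_AE_subseq[of M ?u] by auto
  from this(2) have "AE \<omega> in M. (\<lambda>n. a (r n) \<omega>) \<longlonglongrightarrow> 0 \<and>
    (\<lambda>n. b (r n) \<omega>) \<longlonglongrightarrow> 0 \<and> (\<lambda>n. c (r n) \<omega>) \<longlonglongrightarrow> 0"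
  proof eventually_elim
    case (elim \<omega>)
    have null: "f \<longlonglongrightarrow> 0" if "\<And>n. ?m (f n) \<le> ?u (r n) \<omega>" for f :: "nat \<Rightarrow> 'b"
    proof (rule Lim_null_comparison[OF _ elim])
      \<comment> \<open>Once the sum is below 1, the truncation is inactive and the sum dominates
        the norm itself.\<close>
      have "\<forall>\<^sub>F n in sequentially. ?u (r n) \<omega> < 1"
        using elim by (rule order_tendstoD(2)) simp
      then show "\<forall>\<^sub>F n in sequentially. norm (f n) \<le> ?u (r n) \<omega>"
      proof eventually_elim
        case (elim n)
        then show ?case
          using that[of n] by linarith
      qed
    qed
    show ?case
      by (intro conjI null) auto
  qed
  with r show ?thesis
    by blast
qed

section \<open>The stochastic algorithm\<close>

text \<open>Everything rests on
  \<open>\<theta> * \<Delta> = (norm (\<theta> *\<^sub>R t))\<^sup>2\<close>, which is nonnegative.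
  The third claim serves integrability of the quadratic term, the fourth square integrability of the
  step, and the last the bound on the upper limit of \<open>\<Delta> n\<close>.\<close>

lemma relaxed_projection_step:
  fixes x w q t :: "'a::real_inner"
  assumes \<alpha>: "0 < \<alpha>"
    and \<Delta>: "\<Delta> = inner (x - w) t - inverse (4 * \<alpha>) * (norm (w - q))\<^sup>2"
    and \<theta>: "\<theta> = of_bool (t \<noteq> 0) * of_bool (\<Delta> > 0) * \<Delta> / ((norm t)\<^sup>2 + of_bool (t = 0))"
  shows "0 \<le> \<theta>"
    and "\<theta> * \<Delta> = (norm (\<theta> *\<^sub>R t))\<^sup>2"
    and "\<theta> * (norm (w - q))\<^sup>2 \<le> 4 * \<alpha> * (\<theta> * inner (x - w) t)"
    and "norm (\<theta> *\<^sub>R t) \<le> norm (x - w)"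
    and "\<Delta> \<le> norm (\<theta> *\<^sub>R t) * norm t"
proof -
  show \<theta>0: "0 \<le> \<theta>"
    unfolding \<theta> by auto
  \<comment> \<open>If \<open>t = 0\<close>, then \<open>\<Delta>\<close> is minus a nonnegative
    term; so a vanishing \<open>\<theta>\<close> always comes with
    \<open>\<Delta> \<le> 0\<close>.\<close>
  have cases: "(t \<noteq> 0 \<and> \<Delta> > 0 \<and> \<theta> = \<Delta> / (norm t)\<^sup>2) \<or> (\<theta> = 0 \<and> \<Delta> \<le> 0)"
  proof (cases "t \<noteq> 0 \<and> \<Delta> > 0")
    case False
    moreover have "\<Delta> \<le> 0" if "t = 0"
      using that \<alpha> unfolding \<Delta> by simp
    ultimately show ?thesis
      unfolding \<theta> by auto
  qed (simp add: \<theta>)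
  show norm_sq: "\<theta> * \<Delta> = (norm (\<theta> *\<^sub>R t))\<^sup>2"
    using cases by (auto simp: power_mult_distrib power2_eq_square field_simps)
  have \<theta>\<Delta>: "0 \<le> \<theta> * \<Delta>"
    unfolding norm_sq by simp
  have expand: "\<theta> * \<Delta> = \<theta> * inner (x - w) t - inverse (4 * \<alpha>) * (\<theta> * (norm (w - q))\<^sup>2)"
    unfolding \<Delta> by (simp add: algebra_simps)
  then have "inverse (4 * \<alpha>) * (\<theta> * (norm (w - q))\<^sup>2) \<le> \<theta> * inner (x - w) t"
    using \<theta>\<Delta> by linarith
  then show "\<theta> * (norm (w - q))\<^sup>2 \<le> 4 * \<alpha> * (\<theta> * inner (x - w) t)"
    using \<alpha> by (simp add: field_simps)
  have "0 \<le> inverse (4 * \<alpha>) * (\<theta> * (norm (w - q))\<^sup>2)"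
    using \<theta>0 \<alpha> by simp
  then have "(norm (\<theta> *\<^sub>R t))\<^sup>2 \<le> inner (x - w) (\<theta> *\<^sub>R t)"
    using expand norm_sq by simp
  also have "\<dots> \<le> norm (x - w) * norm (\<theta> *\<^sub>R t)"
    by (rule norm_cauchy_schwarz)
  finally have "norm (\<theta> *\<^sub>R t) * norm (\<theta> *\<^sub>R t) \<le> norm (x - w) * norm (\<theta> *\<^sub>R t)"
    by (simp only: power2_eq_square)
  then show "norm (\<theta> *\<^sub>R t) \<le> norm (x - w)"
    using mult_right_le_imp_le[of "norm (\<theta> *\<^sub>R t)"] norm_ge_zero[of "x - w"]
    by (metis zero_less_norm_iff norm_zero)
  show "\<Delta> \<le> norm (\<theta> *\<^sub>R t) * norm t"
    using cases by (auto simp: power2_eq_square)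
qed

text \<open>Monotonicity is applied at the perturbed point of the graph against
  \<open>- C z\<close>. Splitting \<open>w - z\<close> as \<open>(w - q) + (q - z)\<close> leaves a
  cross term; Young's inequality bounds it by \<open>(norm (w - q))\<^sup>2 / (4 * \<alpha>)\<close>
  plus exactly the square that cocoercivity supplies. The remaining bracket is the cost of replacing
  the perturbed vectors by \<open>w\<close> and \<open>t\<close>.\<close>

lemma zer_separation:
  fixes W :: "'a::real_inner \<Rightarrow> 'a set"
  assumes W: "maximally_monotone W" and C: "cocoercive \<alpha> C" and \<alpha>: "0 < \<alpha>"
    and z: "z \<in> zer (operator_plus W C)" and we: "(w + e, w' + e') \<in> gra W"
    and cf: "c' + f' = C q" and t: "t = w' + c'"
  shows "inner (z - w) t \<le> (norm (w - q))\<^sup>2 / (4 * \<alpha>) +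
    (inner (w - z) (e' + f') + inner e (w' + C z) + inner e e')"
proof -
  have "- C z \<in> W z"
    using z by (simp add: zer_operator_plus_iff)
  with we have mono: "0 \<le> inner (w + e - z) (w' + e' + C z)"
    using maximally_monotone_ineq[OF W, of "w' + e'" "w + e" "- C z" z] by (simp add: gra_def)
  have coco: "\<alpha> * (norm (C q - C z))\<^sup>2 \<le> inner (q - z) (C q - C z)"
    using C unfolding cocoercive_def by blast
  have "0 \<le> (norm (w - q) - 2 * \<alpha> * norm (C q - C z))\<^sup>2 / (4 * \<alpha>)"
    using \<alpha> by simp
  also have "\<dots> = (norm (w - q))\<^sup>2 / (4 * \<alpha>) - norm (w - q) * norm (C q - C z) + \<alpha> * (norm (C q - C z))\<^sup>2"
    using \<alpha> by (simp add: power2_diff power2_eq_square field_simps)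
  finally have young: "norm (w - q) * norm (C q - C z) \<le>
      (norm (w - q))\<^sup>2 / (4 * \<alpha>) + \<alpha> * (norm (C q - C z))\<^sup>2"
    by simp
  have "- inner (w - q) (C q - C z) \<le> norm (w - q) * norm (C q - C z)"
    using Cauchy_Schwarz_ineq2[of "w - q" "C q - C z"] by linarith
  with young coco have "- ((norm (w - q))\<^sup>2 / (4 * \<alpha>)) \<le> inner (w - z) (C q - C z)"
    by (simp add: inner_diff_left)
  moreover have "inner (w - z) t = inner (w + e - z) (w' + e' + C z) + inner (w - z) (C q - C z) -
      (inner (w - z) (e' + f') + inner e (w' + C z) + inner e e')"
    unfolding t cf[symmetric] by (simp add: inner_diff_left inner_add_left inner_diff_right inner_add_right)
  ultimately show ?thesis
    using mono by (simp add: inner_diff_left)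
qed

locale stochastic_splitting = prob_space M + complete_measure M
  for M :: "'w measure" +
  fixes W :: "'a::{real_inner, banach, second_countable_topology} \<Rightarrow> 'a set"
    and C :: "'a \<Rightarrow> 'a"
    and \<alpha> \<rho> :: real
    and Z :: "'a set"
    and \<X> :: "nat \<Rightarrow> 'w measure"
    and x w w' e e' q c' f' t' d :: "nat \<Rightarrow> 'w \<Rightarrow> 'a"
    and \<Delta> \<theta> lam :: "nat \<Rightarrow> 'w \<Rightarrow> real"
    and \<epsilon> :: "nat \<Rightarrow> 'a \<Rightarrow> 'w \<Rightarrow> ereal"
  assumes W: "maximally_monotone W"
    and \<alpha>: "0 < \<alpha>"
    and C: "cocoercive \<alpha> C"
    and Z: "Z = zer (operator_plus W C)" "Z \<noteq> {}"
    and \<rho>: "2 \<le> \<rho>"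
    and x0: "x 0 \<in> Lp 2 M"
    and step1: "\<And>n. \<X> n = sigma_rv M (x ` {..n})"
    and step2: "\<And>n. w n \<in> Lp 2 M" "\<And>n. w' n \<in> Lp 2 M" "\<And>n. e n \<in> Lp 2 M" "\<And>n. e' n \<in> Lp 2 M"
      "\<And>n. AE \<omega> in M. (w n \<omega> + e n \<omega>, w' n \<omega> + e' n \<omega>) \<in> gra W"
    and step3: "\<And>n. q n \<in> Lp 2 M" "\<And>n. c' n \<in> Lp 2 M" "\<And>n. f' n \<in> Lp 2 M"
      "\<And>n. AE \<omega> in M. c' n \<omega> + f' n \<omega> = C (q n \<omega>)"
    and step4: "\<And>n. AE \<omega> in M. t' n \<omega> = w' n \<omega> + c' n \<omega>"
    and step5: "\<And>n. AE \<omega> in M.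
      \<Delta> n \<omega> = inner (x n \<omega> - w n \<omega>) (t' n \<omega>) - inverse (4 * \<alpha>) * (norm (w n \<omega> - q n \<omega>))\<^sup>2"
    and step6: "\<And>n. AE \<omega> in M.
      \<theta> n \<omega> = of_bool (t' n \<omega> \<noteq> 0) * of_bool (\<Delta> n \<omega> > 0) * \<Delta> n \<omega> /
              ((norm (t' n \<omega>))\<^sup>2 + of_bool (t' n \<omega> = 0))"
    and step7: "\<And>n. AE \<omega> in M. d n \<omega> = \<theta> n \<omega> *\<^sub>R t' n \<omega>"
    and step8: "\<And>n. lam n \<in> borel_measurable M" "\<And>n. AE \<omega> in M. 0 < lam n \<omega> \<and> lam n \<omega> \<le> \<rho>"
    and step9: "\<And>n. AE \<omega> in M. x (Suc n) \<omega> = x n \<omega> - lam n \<omega> *\<^sub>R d n \<omega>"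
    and \<epsilon>: "\<And>n z. z \<in> Z \<Longrightarrow> AE \<omega> in M.
      \<epsilon> n z \<omega> = max 0 (ereal_cond_exp M (\<X> n)
        (\<lambda>\<omega>. \<theta> n \<omega> * (inner (w n \<omega> - z) (e' n \<omega> + f' n \<omega>) +
                    inner (e n \<omega>) (w' n \<omega> + C z) + inner (e n \<omega>) (e' n \<omega>))) \<omega>)"
    and indep: "\<And>n. indep_set
      (sets (sigma_rv M {lam n})) (sets (sigma_rv M (x ` {..n} \<union> {d n})))"
    and lam: "\<And>n. 0 \<le> (LINT \<omega>|M. lam n \<omega> * (2 - lam n \<omega>))"
begin

section \<open>Measurability and square integrability of the iterates\<close>

lemma Lp2_measurable: "f \<in> Lp 2 M \<Longrightarrow> f \<in> borel_measurable M"
  by (simp add: Lp2_iff)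

lemmas given_measurable [measurable] =
  Lp2_measurable[OF step2(1)] Lp2_measurable[OF step2(2)] Lp2_measurable[OF step2(3)]
  Lp2_measurable[OF step2(4)] Lp2_measurable[OF step3(1)] Lp2_measurable[OF step3(2)]
  Lp2_measurable[OF step3(3)] step8(1)

lemma t'_measurable [measurable]: "t' n \<in> borel_measurable M"
  by (rule measurable_AE_cong[of "\<lambda>\<omega>. w' n \<omega> + c' n \<omega>"]) (use step4[of n] in auto)

lemma AE_step:
  "AE \<omega> in M. d n \<omega> = \<theta> n \<omega> *\<^sub>R t' n \<omega> \<and>
    \<Delta> n \<omega> = inner (x n \<omega> - w n \<omega>) (t' n \<omega>) - inverse (4 * \<alpha>) * (norm (w n \<omega> - q n \<omega>))\<^sup>2 \<and>
    0 \<le> \<theta> n \<omega> \<and> \<theta> n \<omega> * \<Delta> n \<omega> = (norm (d n \<omega>))\<^sup>2 \<and>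
    \<theta> n \<omega> * (norm (w n \<omega> - q n \<omega>))\<^sup>2 \<le> 4 * \<alpha> * (\<theta> n \<omega> * inner (x n \<omega> - w n \<omega>) (t' n \<omega>)) \<and>
    norm (d n \<omega>) \<le> norm (x n \<omega> - w n \<omega>) \<and>
    \<Delta> n \<omega> \<le> norm (d n \<omega>) * norm (t' n \<omega>)"
  using step5[of n] step6[of n] step7[of n]
proof eventually_elim
  case (elim \<omega>)
  from relaxed_projection_step[OF \<alpha> elim(1,2)] elim(1,3) show ?case
    by simp
qed

text \<open>The step is bounded by \<open>norm (x n \<omega> - w n \<omega>)\<close>, so it is
  square integrable without any bound on \<open>\<theta> n\<close>. The hypothesis on
  \<open>x n\<close> is the induction hypothesis of \<open>x_Lp2\<close>.\<close>

lemma step_measurable: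
  assumes "x n \<in> Lp 2 M"
  shows "\<theta> n \<in> borel_measurable M" and "d n \<in> Lp 2 M"
proof -
  have [measurable]: "x n \<in> borel_measurable M"
    using assms by (simp add: Lp2_iff)
  have [measurable]: "\<Delta> n \<in> borel_measurable M"
    by (rule measurable_AE_cong[of "\<lambda>\<omega>. inner (x n \<omega> - w n \<omega>) (t' n \<omega>) -
          inverse (4 * \<alpha>) * (norm (w n \<omega> - q n \<omega>))\<^sup>2"]) (use step5[of n] in auto)
  show [measurable]: "\<theta> n \<in> borel_measurable M"
  proof (rule measurable_AE_cong)
    show "AE \<omega> in M. of_bool (t' n \<omega> \<noteq> 0) * of_bool (\<Delta> n \<omega> > 0) * \<Delta> n \<omega> /
        ((norm (t' n \<omega>))\<^sup>2 + of_bool (t' n \<omega> = 0)) = \<theta> n \<omega>"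
      using step6[of n] by eventually_elim simp
    show "(\<lambda>\<omega>. of_bool (t' n \<omega> \<noteq> 0) * of_bool (\<Delta> n \<omega> > 0) * \<Delta> n \<omega> /
        ((norm (t' n \<omega>))\<^sup>2 + of_bool (t' n \<omega> = 0))) \<in> borel_measurable M"
      unfolding of_bool_def by measurable
  qed simp
  have [measurable]: "d n \<in> borel_measurable M"
    by (rule measurable_AE_cong[of "\<lambda>\<omega>. \<theta> n \<omega> *\<^sub>R t' n \<omega>"]) (use step7[of n] in auto)
  have "integrable M (\<lambda>\<omega>. (norm (d n \<omega>))\<^sup>2)"
  proof (rule Bochner_Integration.integrable_bound)
    show "integrable M (\<lambda>\<omega>. (norm (x n \<omega> - w n \<omega>))\<^sup>2)"
      using Lp2_diff[OF assms step2(1)[of n]] by (simp add: Lp2_iff)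
    show "AE \<omega> in M. norm ((norm (d n \<omega>))\<^sup>2) \<le> norm ((norm (x n \<omega> - w n \<omega>))\<^sup>2)"
      using AE_step[of n] by eventually_elim (auto intro: power_mono)
  qed simp
  then show "d n \<in> Lp 2 M"
    by (simp add: Lp2_iff)
qed

lemma x_Lp2: "x n \<in> Lp 2 M"
proof (induction n)
  case 0
  show ?case
    by (rule x0)
next
  case (Suc n)
  have d: "d n \<in> Lp 2 M"
    using step_measurable(2)[OF Suc] .
  have [measurable]: "d n \<in> borel_measurable M" "x n \<in> borel_measurable M"
    using d Suc by (auto simp: Lp2_iff)
  have "(\<lambda>\<omega>. lam n \<omega> *\<^sub>R d n \<omega>) \<in> Lp 2 M"
    unfolding Lp2_iff
  proof
    show "integrable M (\<lambda>\<omega>. (norm (lam n \<omega> *\<^sub>R d n \<omega>))\<^sup>2)"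
    proof (rule Bochner_Integration.integrable_bound)
      show "integrable M (\<lambda>\<omega>. \<rho>\<^sup>2 * (norm (d n \<omega>))\<^sup>2)"
        using d by (simp add: Lp2_iff)
      show "AE \<omega> in M. norm ((norm (lam n \<omega> *\<^sub>R d n \<omega>))\<^sup>2) \<le> norm (\<rho>\<^sup>2 * (norm (d n \<omega>))\<^sup>2)"
        using step8(2)[of n]
        by eventually_elim (auto simp: power_mult_distrib abs_mult intro!: mult_right_mono power_mono)
    qed simp
  qed simp
  from Lp2_diff[OF Suc this] have "(\<lambda>\<omega>. x n \<omega> - lam n \<omega> *\<^sub>R d n \<omega>) \<in> Lp 2 M" .
  moreover have "AE \<omega> in M. x n \<omega> - lam n \<omega> *\<^sub>R d n \<omega> = x (Suc n) \<omega>"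
    using step9[of n] by eventually_elim simp
  ultimately show ?case
    unfolding Lp2_iff
    using measurable_AE_cong[of "\<lambda>\<omega>. x n \<omega> - lam n \<omega> *\<^sub>R d n \<omega>" "x (Suc n)" borel]
    by (auto elim!: integrable_cong_AE_imp)
qed

lemmas d_Lp2 = step_measurable(2)[OF x_Lp2]

lemmas derived_measurable [measurable] =
  Lp2_measurable[OF x_Lp2] step_measurable(1)[OF x_Lp2] Lp2_measurable[OF d_Lp2]

section \<open>The conditional error estimate\<close>

lemma \<X>_subalgebra: "subalgebra M (\<X> n)"
  unfolding step1 by (rule subalgebra_sigma_rv) auto

sublocale \<X>: finite_measure_subalgebra M "\<X> n" for n
  by unfold_locales (rule \<X>_subalgebra)

lemma x_adapted: "m \<le> n \<Longrightarrow> x m \<in> borel_measurable (\<X> n)"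
  unfolding step1 by (rule measurable_sigma_rv) auto

text \<open>The terms of (i) other than the error, collected on one side before conditioning. It is
  integrable, and almost surely it equals \<open>(norm (d n \<omega>))\<^sup>2 - inner (x n \<omega>
  - z) (d n \<omega>)\<close>, which links (i) to the expansion of the next squared
  distance.\<close>

definition gap :: "nat \<Rightarrow> 'a \<Rightarrow> 'w \<Rightarrow> real" where
  "gap n z \<omega> = inner z (\<theta> n \<omega> *\<^sub>R t' n \<omega>) - \<theta> n \<omega> * inner (w n \<omega>) (t' n \<omega>) -
     1 / (4 * \<alpha>) * (\<theta> n \<omega> * (norm (w n \<omega> - q n \<omega>))\<^sup>2)"

text \<open>The vector \<open>\<theta> n \<omega> *\<^sub>R t' n \<omega>\<close> is the step
  \<open>d n \<omega>\<close>, so its pairings with square integrable variables are integrable. One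
  such pairing dominates the quadratic term, because
  \<open>\<theta> n \<omega> * \<Delta> n \<omega>\<close> is nonnegative.\<close>

lemma step_integrable:
  "integrable M (\<lambda>\<omega>. \<theta> n \<omega> *\<^sub>R t' n \<omega>)"
  "integrable M (\<lambda>\<omega>. \<theta> n \<omega> * inner (w n \<omega>) (t' n \<omega>))"
  "integrable M (\<lambda>\<omega>. \<theta> n \<omega> * (norm (w n \<omega> - q n \<omega>))\<^sup>2)"
proof -
  have d: "(\<lambda>\<omega>. \<theta> n \<omega> *\<^sub>R t' n \<omega>) \<in> Lp 2 M"
    using d_Lp2[of n] unfolding Lp2_iff
    by (auto elim!: integrable_cong_AE_imp intro: AE_mp[OF step7[of n]])
  then have "integrable M (\<lambda>\<omega>. norm (\<theta> n \<omega> *\<^sub>R t' n \<omega>))"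
    by (rule integrable_norm_Lp2)
  then show "integrable M (\<lambda>\<omega>. \<theta> n \<omega> *\<^sub>R t' n \<omega>)"
    by (simp add: integrable_norm_iff del: norm_scaleR)
  show "integrable M (\<lambda>\<omega>. \<theta> n \<omega> * inner (w n \<omega>) (t' n \<omega>))"
    using integrable_inner_Lp2[OF step2(1) d] by simp
  show "integrable M (\<lambda>\<omega>. \<theta> n \<omega> * (norm (w n \<omega> - q n \<omega>))\<^sup>2)"
  proof (rule Bochner_Integration.integrable_bound)
    show "integrable M (\<lambda>\<omega>. 4 * \<alpha> * inner (x n \<omega> - w n \<omega>) (\<theta> n \<omega> *\<^sub>R t' n \<omega>))"
      by (intro integrable_mult_right integrable_inner_Lp2 Lp2_diff x_Lp2 step2(1) d)
    show "AE \<omega> in M. norm (\<theta> n \<omega> * (norm (w n \<omega> - q n \<omega>))\<^sup>2)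
        \<le> norm (4 * \<alpha> * inner (x n \<omega> - w n \<omega>) (\<theta> n \<omega> *\<^sub>R t' n \<omega>))"
      using AE_step[of n]
    proof eventually_elim
      case (elim \<omega>)
      then have *: "0 \<le> \<theta> n \<omega>" "\<theta> n \<omega> * (norm (w n \<omega> - q n \<omega>))\<^sup>2
          \<le> 4 * \<alpha> * (\<theta> n \<omega> * inner (x n \<omega> - w n \<omega>) (t' n \<omega>))"
        by blast+
      have "norm (\<theta> n \<omega> * (norm (w n \<omega> - q n \<omega>))\<^sup>2) = \<theta> n \<omega> * (norm (w n \<omega> - q n \<omega>))\<^sup>2"
        using *(1) by simp
      also have "\<dots> \<le> 4 * \<alpha> * inner (x n \<omega> - w n \<omega>) (\<theta> n \<omega> *\<^sub>R t' n \<omega>)"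
        using *(2) by simp
      also have "\<dots> \<le> norm (4 * \<alpha> * inner (x n \<omega> - w n \<omega>) (\<theta> n \<omega> *\<^sub>R t' n \<omega>))"
        unfolding real_norm_def by (rule abs_ge_self)
      finally show ?case .
    qed
  qed simp
qed

lemma gap_integrable: "integrable M (gap n z)"
  unfolding gap_def using step_integrable[of n]
  by (intro Bochner_Integration.integrable_diff integrable_mult_right integrable_inner_right) auto

lemma gap_eq: "AE \<omega> in M. gap n z \<omega> = (norm (d n \<omega>))\<^sup>2 - inner (x n \<omega> - z) (d n \<omega>)"
  using AE_step[of n]
proof eventually_elim
  case (elim \<omega>)
  then have d: "d n \<omega> = \<theta> n \<omega> *\<^sub>R t' n \<omega>"
    and \<Delta>: "\<Delta> n \<omega> = inner (x n \<omega> - w n \<omega>) (t' n \<omega>) - inverse (4 * \<alpha>) * (norm (w n \<omega> - q n \<omega>))\<^sup>2"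
    and "\<theta> n \<omega> * \<Delta> n \<omega> = (norm (d n \<omega>))\<^sup>2"
    by blast+
  from this(3) show ?case
    unfolding gap_def \<Delta> inverse_eq_divide
    by (simp only: d inner_scaleR_right inner_diff_left) (simp add: algebra_simps)
qed

lemma gap_le:
  assumes "z \<in> Z"
  shows "AE \<omega> in M. gap n z \<omega> \<le> \<theta> n \<omega> * (inner (w n \<omega> - z) (e' n \<omega> + f' n \<omega>) +
    inner (e n \<omega>) (w' n \<omega> + C z) + inner (e n \<omega>) (e' n \<omega>))"
  using AE_step[of n] step2(5)[of n] step3(4)[of n] step4[of n]
proof eventually_elim
  case (elim \<omega>)
  let ?B = "inner (w n \<omega> - z) (e' n \<omega> + f' n \<omega>) + inner (e n \<omega>) (w' n \<omega> + C z) + inner (e n \<omega>) (e' n \<omega>)"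
  have "inner (z - w n \<omega>) (t' n \<omega>) \<le> (norm (w n \<omega> - q n \<omega>))\<^sup>2 / (4 * \<alpha>) + ?B"
    using zer_separation[OF W C \<alpha> assms[unfolded Z(1)] elim(2,3,4)] .
  then have "\<theta> n \<omega> * (inner (z - w n \<omega>) (t' n \<omega>) - (norm (w n \<omega> - q n \<omega>))\<^sup>2 / (4 * \<alpha>)) \<le> \<theta> n \<omega> * ?B"
    using elim(1) by (intro mult_left_mono) auto
  moreover have "gap n z \<omega> =
      \<theta> n \<omega> * (inner (z - w n \<omega>) (t' n \<omega>) - (norm (w n \<omega> - q n \<omega>))\<^sup>2 / (4 * \<alpha>))"
    unfolding gap_def by (simp add: inner_diff_left algebra_simps)
  ultimately show ?case
    by simp
qed

lemma cond_exp_gap_le: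
  assumes "z \<in> Z"
  shows "AE \<omega> in M. 0 \<le> \<epsilon> n z \<omega> \<and> ereal (real_cond_exp M (\<X> n) (gap n z) \<omega>) \<le> \<epsilon> n z \<omega>"
proof -
  have "AE \<omega> in M. ereal (real_cond_exp M (\<X> n) (gap n z) \<omega>) \<le> ereal_cond_exp M (\<X> n)
      (\<lambda>\<omega>. \<theta> n \<omega> * (inner (w n \<omega> - z) (e' n \<omega> + f' n \<omega>) +
         inner (e n \<omega>) (w' n \<omega> + C z) + inner (e n \<omega>) (e' n \<omega>))) \<omega>"
    by (rule \<X>.real_cond_exp_le_ereal_cond_exp[OF gap_integrable _ gap_le[OF assms]]) measurable
  then show ?thesis
    using \<epsilon>[OF assms, of n] by eventually_elim (auto simp: le_max_iff_disj)
qed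

lemma cond_exp_bound:
  assumes "z \<in> Z"
  shows "AE \<omega> in M.
    ereal (inner z (cond_exp M (\<X> n) (\<lambda>\<omega>. \<theta> n \<omega> *\<^sub>R t' n \<omega>) \<omega>)) \<le>
    ereal (real_cond_exp M (\<X> n) (\<lambda>\<omega>. \<theta> n \<omega> * inner (w n \<omega>) (t' n \<omega>)) \<omega> +
           1 / (4 * \<alpha>) * real_cond_exp M (\<X> n) (\<lambda>\<omega>. \<theta> n \<omega> * (norm (w n \<omega> - q n \<omega>))\<^sup>2) \<omega>)
    + \<epsilon> n z \<omega>"
proof -
  note int = step_integrable[of n]
  have int_z: "integrable M (\<lambda>\<omega>. inner z (\<theta> n \<omega> *\<^sub>R t' n \<omega>))"
    using int(1) by (intro integrable_inner_right) auto
  have int_c: "integrable M (\<lambda>\<omega>. 1 / (4 * \<alpha>) * (\<theta> n \<omega> * (norm (w n \<omega> - q n \<omega>))\<^sup>2))"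
    using int(3) by (rule integrable_mult_right)
  show ?thesis
    using cond_exp_gap_le[OF assms, of n] \<X>.inner_cond_exp[OF int(1), of z n]
      \<X>.real_cond_exp_diff[OF int_z int(2), of n]
      \<X>.real_cond_exp_diff[OF Bochner_Integration.integrable_diff[OF int_z int(2)] int_c, of n]
      \<X>.real_cond_exp_cmult[OF int(3), of n "1 / (4 * \<alpha>)"]
  proof eventually_elim
    case (elim \<omega>)
    then have "real_cond_exp M (\<X> n) (gap n z) \<omega> =
        inner z (cond_exp M (\<X> n) (\<lambda>\<omega>. \<theta> n \<omega> *\<^sub>R t' n \<omega>) \<omega>) -
        (real_cond_exp M (\<X> n) (\<lambda>\<omega>. \<theta> n \<omega> * inner (w n \<omega>) (t' n \<omega>)) \<omega> +
         1 / (4 * \<alpha>) * real_cond_exp M (\<X> n) (\<lambda>\<omega>. \<theta> n \<omega> * (norm (w n \<omega> - q n \<omega>))\<^sup>2) \<omega>)"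
      unfolding gap_def[abs_def] by simp
    \<comment> \<open>The error may be infinite, and then the bound is trivial; being nonnegative,
      it is never minus infinity.\<close>
    with elim(1) show ?case
      by (cases "\<epsilon> n z \<omega>") auto
  qed
qed

section \<open>Expected decrease of the squared distance to a zero\<close>

lemma lam_integrable: "integrable M (lam n)" "integrable M (\<lambda>\<omega>. (lam n \<omega>)\<^sup>2)"
proof -
  show "integrable M (lam n)"
    using step8(2)[of n] by (intro integrable_const_bound[of _ \<rho>]) (auto elim: eventually_mono)
  have "AE \<omega> in M. norm ((lam n \<omega>)\<^sup>2) \<le> \<rho>\<^sup>2"
    using step8(2)[of n] by eventually_elim (auto intro: power_mono)
  then show "integrable M (\<lambda>\<omega>. (lam n \<omega>)\<^sup>2)"
    by (intro integrable_const_bound[of _ "\<rho>\<^sup>2"]) auto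
qed

lemma expectation_lam_pos: "0 < expectation (lam n)"
proof -
  have "AE \<omega> in M. 0 < lam n \<omega>"
    using step8(2)[of n] by eventually_elim simp
  then show ?thesis
    by (intro expectation_greater lam_integrable)
qed

lemma set_integral_gap_le:
  assumes "z \<in> Z" and A: "A \<in> sets (\<X> n)" and fin: "(\<integral>\<^sup>+ \<omega>. e2ennreal (\<epsilon> n z \<omega>) \<partial>M) < \<infinity>"
  shows "(LINT \<omega>:A|M. gap n z \<omega>) \<le> enn2real (\<integral>\<^sup>+ \<omega>. e2ennreal (\<epsilon> n z \<omega>) \<partial>M)"
proof -
  let ?g = "\<lambda>\<omega>. indicator A \<omega> * real_cond_exp M (\<X> n) (gap n z) \<omega>"
  have A_M [measurable]: "A \<in> sets M"
    using A \<X>.sets_F_subset by blast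
  have int: "integrable M ?g"
    using integrable_mult_indicator[OF A_M \<X>.real_cond_exp_int(1)[OF gap_integrable]] by simp
  have "(LINT \<omega>:A|M. gap n z \<omega>) = (LINT \<omega>|M. ?g \<omega>)"
    using \<X>.real_cond_exp_intA[OF gap_integrable A] unfolding set_lebesgue_integral_def by simp
  \<comment> \<open>Only the positive part is kept: \<open>ennreal\<close> sends negative values to
    0, and the error dominates what remains.\<close>
  also have "\<dots> \<le> enn2real (\<integral>\<^sup>+ \<omega>. ennreal (?g \<omega>) \<partial>M)"
    unfolding real_lebesgue_integral_def[OF int] by simp
  also have "\<dots> \<le> enn2real (\<integral>\<^sup>+ \<omega>. e2ennreal (\<epsilon> n z \<omega>) \<partial>M)"
  proof (rule enn2real_mono)
    show "(\<integral>\<^sup>+ \<omega>. ennreal (?g \<omega>) \<partial>M) \<le> (\<integral>\<^sup>+ \<omega>. e2ennreal (\<epsilon> n z \<omega>) \<partial>M)"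
    proof (rule nn_integral_mono_AE)
      show "AE \<omega> in M. ennreal (?g \<omega>) \<le> e2ennreal (\<epsilon> n z \<omega>)"
        using cond_exp_gap_le[OF assms(1), of n]
      proof eventually_elim
        case (elim \<omega>)
        then have "e2ennreal (ereal (real_cond_exp M (\<X> n) (gap n z) \<omega>)) \<le> e2ennreal (\<epsilon> n z \<omega>)"
          by (intro e2ennreal_mono) simp
        then show ?case
          by (simp add: indicator_def)
      qed
    qed
  qed (use fin in simp)
  finally show ?thesis .
qed

text \<open>Expanding the square produces \<open>lam n\<close> and its square multiplied by step
  terms restricted to \<open>A\<close>. Independence replaces both weights by their expectations, so
  only the mean of \<open>lam n * (2 - lam n)\<close> has to be nonnegative and \<open>lam n\<close>
  itself may exceed 2.\<close>

lemma set_integral_decrease: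
  assumes "z \<in> Z" and A: "A \<in> sets (\<X> n)" and fin: "(\<integral>\<^sup>+ \<omega>. e2ennreal (\<epsilon> n z \<omega>) \<partial>M) < \<infinity>"
  shows "(LINT \<omega>:A|M. (norm (x (Suc n) \<omega> - z))\<^sup>2) \<le>
    (LINT \<omega>:A|M. (norm (x n \<omega> - z))\<^sup>2) -
    (LINT \<omega>|M. lam n \<omega> * (2 - lam n \<omega>)) * (LINT \<omega>:A|M. (norm (d n \<omega>))\<^sup>2) +
    2 * expectation (lam n) * enn2real (\<integral>\<^sup>+ \<omega>. e2ennreal (\<epsilon> n z \<omega>) \<partial>M)"
proof -
  let ?I = "indicator A :: 'w \<Rightarrow> real"
  let ?\<Sigma> = "sigma_rv M (x ` {..n} \<union> {d n})"
  define a where "a \<omega> = ?I \<omega> * (norm (x n \<omega> - z))\<^sup>2" for \<omega>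
  define b where "b \<omega> = ?I \<omega> * inner (x n \<omega> - z) (d n \<omega>)" for \<omega>
  define c where "c \<omega> = ?I \<omega> * (norm (d n \<omega>))\<^sup>2" for \<omega>
  have A_M [measurable]: "A \<in> sets M"
    using A \<X>.sets_F_subset by blast
  \<comment> \<open>Adding \<open>d n\<close> to the generators keeps \<open>A\<close> measurable,
    so its indicator stays in the factor that is independent of \<open>lam n\<close>.\<close>
  have [measurable]: "A \<in> sets ?\<Sigma>"
    using A sets_sigma_rv_mono[of "x ` {..n}" "x ` {..n} \<union> {d n}" M] unfolding step1 by blast
  have [measurable]: "x n \<in> borel_measurable ?\<Sigma>" "d n \<in> borel_measurable ?\<Sigma>"
    by (intro measurable_sigma_rv; simp)+
  have \<Sigma>: "b \<in> borel_measurable ?\<Sigma>" "c \<in> borel_measurable ?\<Sigma>"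
    unfolding b_def c_def by measurable
  have xz: "(\<lambda>\<omega>. x n \<omega> - z) \<in> Lp 2 M" for n
    by (intro Lp2_diff x_Lp2 Lp2_const finite_measure_axioms)
  have ind_int: "integrable M (\<lambda>\<omega>. ?I \<omega> * f \<omega>)" if "integrable M f" for f
    using integrable_mult_indicator[OF A_M that] by simp
  have a: "integrable M a" and b: "integrable M b" and c: "integrable M c"
    unfolding a_def b_def c_def using xz d_Lp2
    by (auto intro!: ind_int integrable_inner_Lp2 simp: Lp2_iff)
  have lam_\<Sigma>: "lam n \<in> borel_measurable (sigma_rv M {lam n})"
    by (intro measurable_sigma_rv) simp
  then have lam2_\<Sigma>: "(\<lambda>\<omega>. (lam n \<omega>)\<^sup>2) \<in> borel_measurable (sigma_rv M {lam n})"
    by measurable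
  note lb = indep_sigma_rv_product[OF indep lam_\<Sigma> lam_integrable(1) \<Sigma>(1) b]
  note lc = indep_sigma_rv_product[OF indep lam2_\<Sigma> lam_integrable(2) \<Sigma>(2) c]
  have "AE \<omega> in M. ?I \<omega> * (norm (x (Suc n) \<omega> - z))\<^sup>2 =
      a \<omega> - 2 * (lam n \<omega> * b \<omega>) + (lam n \<omega>)\<^sup>2 * c \<omega>"
    using step9[of n]
  proof eventually_elim
    case (elim \<omega>)
    have sq: "(norm (x (Suc n) \<omega> - z))\<^sup>2 = (norm (x n \<omega> - z))\<^sup>2 -
        2 * (lam n \<omega> * inner (x n \<omega> - z) (d n \<omega>)) + (lam n \<omega>)\<^sup>2 * (norm (d n \<omega>))\<^sup>2"
      unfolding elim power2_norm_eq_inner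
      by (simp add: inner_diff_left inner_diff_right inner_commute power2_eq_square algebra_simps)
    show ?case
      unfolding a_def b_def c_def sq by (simp add: algebra_simps)
  qed
  then have "(LINT \<omega>:A|M. (norm (x (Suc n) \<omega> - z))\<^sup>2) =
      expectation (\<lambda>\<omega>. a \<omega> - 2 * (lam n \<omega> * b \<omega>) + (lam n \<omega>)\<^sup>2 * c \<omega>)"
    unfolding set_lebesgue_integral_def real_scaleR_def
    using a lb(1) lc(1) by (intro integral_cong_AE) auto
  also have "\<dots> = expectation a - 2 * (expectation (lam n) * expectation b) +
      expectation (\<lambda>\<omega>. (lam n \<omega>)\<^sup>2) * expectation c"
    using a lb lc by simp
  finally have expand: "(LINT \<omega>:A|M. (norm (x (Suc n) \<omega> - z))\<^sup>2) =
      expectation a - 2 * (expectation (lam n) * expectation b) +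
      expectation (\<lambda>\<omega>. (lam n \<omega>)\<^sup>2) * expectation c" .
  have "(LINT \<omega>:A|M. gap n z \<omega>) = expectation (\<lambda>\<omega>. c \<omega> - b \<omega>)"
    unfolding set_lebesgue_integral_def real_scaleR_def
  proof (rule integral_cong_AE)
    show "AE \<omega> in M. ?I \<omega> * gap n z \<omega> = c \<omega> - b \<omega>"
      using gap_eq[of n z]
    proof eventually_elim
      case (elim \<omega>)
      show ?case
        unfolding elim b_def c_def by (simp add: algebra_simps)
    qed
  qed (use b c ind_int[OF gap_integrable] in auto)
  then have "expectation c - expectation b \<le> enn2real (\<integral>\<^sup>+ \<omega>. e2ennreal (\<epsilon> n z \<omega>) \<partial>M)"
    using set_integral_gap_le[OF assms] b c by simp
  then have "expectation (lam n) * (expectation c - expectation b) \<le>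
      expectation (lam n) * enn2real (\<integral>\<^sup>+ \<omega>. e2ennreal (\<epsilon> n z \<omega>) \<partial>M)"
    using expectation_lam_pos[of n] by (intro mult_left_mono) auto
  moreover have p: "(LINT \<omega>|M. lam n \<omega> * (2 - lam n \<omega>)) =
      2 * expectation (lam n) - expectation (\<lambda>\<omega>. (lam n \<omega>)\<^sup>2)"
  proof -
    have "(LINT \<omega>|M. lam n \<omega> * (2 - lam n \<omega>)) = expectation (\<lambda>\<omega>. 2 * lam n \<omega> - (lam n \<omega>)\<^sup>2)"
      by (intro Bochner_Integration.integral_cong) (auto simp: algebra_simps power2_eq_square)
    then show ?thesis
      using lam_integrable[of n] by simp
  qed
  \<comment> \<open>By \<open>p\<close>, the mean of the squared weight is
    \<open>2 * expectation (lam n)\<close> minus the mean of \<open>lam n * (2 - lam n)\<close>.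
    This isolates \<open>expectation c - expectation b\<close>, the integral of \<open>gap\<close>
    over \<open>A\<close>.\<close>
  moreover have "(LINT \<omega>:A|M. (norm (x (Suc n) \<omega> - z))\<^sup>2) = expectation a -
      (LINT \<omega>|M. lam n \<omega> * (2 - lam n \<omega>)) * expectation c +
      2 * (expectation (lam n) * (expectation c - expectation b))"
    unfolding expand p by (simp add: algebra_simps)
  moreover have "(LINT \<omega>:A|M. (norm (x n \<omega> - z))\<^sup>2) = expectation a"
      "(LINT \<omega>:A|M. (norm (d n \<omega>))\<^sup>2) = expectation c"
    unfolding a_def c_def set_lebesgue_integral_def by simp_all
  ultimately show ?thesis
    by simp
qed

section \<open>Consequences of summable errors: boundedness and convergent distances\<close>

context
  assumes summable_errors: "\<forall>z\<in>Z.
    (\<Sum>n. (\<integral>\<^sup>+ \<omega>. e2ennreal (\<epsilon> n z \<omega>) \<partial>M) * ennreal (LINT \<omega>|M. lam n \<omega>)) < \<infinity>"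
begin

definition noise :: "nat \<Rightarrow> 'a \<Rightarrow> real" where
  "noise n z = 2 * expectation (lam n) * enn2real (\<integral>\<^sup>+ \<omega>. e2ennreal (\<epsilon> n z \<omega>) \<partial>M)"

text \<open>A finite product in \<open>ennreal\<close> bounds its first factor only if the second is
  not 0; here positivity of \<open>expectation (lam n)\<close> enters.\<close>

lemma error_finite:
  assumes "z \<in> Z"
  shows "(\<integral>\<^sup>+ \<omega>. e2ennreal (\<epsilon> n z \<omega>) \<partial>M) < \<infinity>"
  using ennreal_suminf_lessD[OF bspec[OF summable_errors assms], of n] expectation_lam_pos[of n]
  by (auto simp: ennreal_mult_less_top ennreal_eq_0_iff)

lemma noise_nonneg: "0 \<le> noise n z"
  unfolding noise_def using expectation_lam_pos[of n] by simp

lemma noise_summable: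
  assumes "z \<in> Z"
  shows "summable (\<lambda>n. noise n z)"
proof -
  have "summable (\<lambda>n. enn2real (\<integral>\<^sup>+ \<omega>. e2ennreal (\<epsilon> n z \<omega>) \<partial>M) * expectation (lam n))"
  proof (rule summable_suminf_not_top)
    show "0 \<le> enn2real (\<integral>\<^sup>+ \<omega>. e2ennreal (\<epsilon> n z \<omega>) \<partial>M) * expectation (lam n)" for n
      using expectation_lam_pos[of n] by simp
    have "ennreal (enn2real (\<integral>\<^sup>+ \<omega>. e2ennreal (\<epsilon> n z \<omega>) \<partial>M) * expectation (lam n)) =
        (\<integral>\<^sup>+ \<omega>. e2ennreal (\<epsilon> n z \<omega>) \<partial>M) * ennreal (LINT \<omega>|M. lam n \<omega>)" for n
      using error_finite[OF assms, of n] expectation_lam_pos[of n] by (simp add: ennreal_mult'')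
    then show "(\<Sum>n. ennreal (enn2real (\<integral>\<^sup>+ \<omega>. e2ennreal (\<epsilon> n z \<omega>) \<partial>M) * expectation (lam n))) \<noteq> top"
      using bspec[OF summable_errors assms] by simp
  qed
  from summable_mult[OF this, of 2] show ?thesis
    unfolding noise_def by (simp add: mult_ac)
qed

lemma quasi_fejer:
  assumes "z \<in> Z" "A \<in> sets (\<X> n)"
  shows "(LINT \<omega>:A|M. (norm (x (Suc n) \<omega> - z))\<^sup>2) \<le>
    (LINT \<omega>:A|M. (norm (x n \<omega> - z))\<^sup>2) -
    (LINT \<omega>|M. lam n \<omega> * (2 - lam n \<omega>)) * (LINT \<omega>:A|M. (norm (d n \<omega>))\<^sup>2) + noise n z"
  using set_integral_decrease[OF assms error_finite[OF assms(1)]] unfolding noise_def .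

lemma x_diff_Lp2: "(\<lambda>\<omega>. x n \<omega> - z) \<in> Lp 2 M"
  by (intro Lp2_diff x_Lp2 Lp2_const finite_measure_axioms)

lemma quasi_supermartingale:
  assumes "z \<in> Z"
  shows "nonneg_quasi_supermartingale M \<X> (\<lambda>n \<omega>. (norm (x n \<omega> - z))\<^sup>2) (\<lambda>n. noise n z)"
proof unfold_locales
  show "subalgebra M (\<X> n)" for n
    by (rule \<X>_subalgebra)
  show "(\<lambda>\<omega>. (norm (x m \<omega> - z))\<^sup>2) \<in> borel_measurable (\<X> n)" if "m \<le> n" for m n
    using x_adapted[OF that] by measurable
  show "integrable M (\<lambda>\<omega>. (norm (x n \<omega> - z))\<^sup>2)" for n
    using x_diff_Lp2 by (simp add: Lp2_iff)
  show "(LINT \<omega>:A|M. (norm (x (Suc n) \<omega> - z))\<^sup>2) \<le> (LINT \<omega>:A|M. (norm (x n \<omega> - z))\<^sup>2) + noise n z"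
    if "A \<in> sets (\<X> n)" for n A
  proof -
    have "0 \<le> (LINT \<omega>:A|M. (norm (d n \<omega>))\<^sup>2)"
      unfolding set_lebesgue_integral_def by simp
    with lam[of n] have "0 \<le> (LINT \<omega>|M. lam n \<omega> * (2 - lam n \<omega>)) * (LINT \<omega>:A|M. (norm (d n \<omega>))\<^sup>2)"
      by simp
    then show ?thesis
      using quasi_fejer[OF assms that] by linarith
  qed
qed (use noise_nonneg noise_summable[OF assms] in auto)

lemma expectation_norm_squared_bounded: "\<exists>K. \<forall>n. expectation (\<lambda>\<omega>. (norm (x n \<omega>))\<^sup>2) \<le> K"
proof -
  obtain z where z: "z \<in> Z"
    using Z(2) by blast
  interpret V: nonneg_quasi_supermartingale M \<X> "\<lambda>n \<omega>. (norm (x n \<omega> - z))\<^sup>2" "\<lambda>n. noise n z"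
    by (rule quasi_supermartingale[OF z])
  \<comment> \<open>The vector \<open>x n \<omega>\<close> is the difference of
    \<open>x n \<omega> - z\<close> and the constant \<open>- z\<close>.\<close>
  have "expectation (\<lambda>\<omega>. (norm (x n \<omega>))\<^sup>2) \<le>
      2 * (expectation (\<lambda>\<omega>. (norm (x 0 \<omega> - z))\<^sup>2) + (\<Sum>n. noise n z)) + 2 * (norm z)\<^sup>2" for n
    using expectation_norm_diff_squared_le[OF x_diff_Lp2[of n z] Lp2_const[OF finite_measure_axioms, of "- z"]]
      V.expectation_le[of n] by (simp add: prob_space)
  then show ?thesis
    by blast
qed

text \<open>The null set of the supermartingale argument depends on \<open>z\<close>. It is
  therefore applied on a countable dense subset of \<open>Z\<close>, and density supplies the
  remaining points path by path.\<close>

lemma AE_convergent_norm: "AE \<omega> in M. \<forall>z\<in>Z. convergent (\<lambda>n. norm (x n \<omega> - z))"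
proof -
  obtain D where D: "countable D" "D \<subseteq> Z" "Z \<subseteq> closure D"
    using separable by blast
  have "AE \<omega> in M. convergent (\<lambda>n. norm (x n \<omega> - z))" if "z \<in> D" for z
  proof -
    interpret V: nonneg_quasi_supermartingale M \<X> "\<lambda>n \<omega>. (norm (x n \<omega> - z))\<^sup>2" "\<lambda>n. noise n z"
      using quasi_supermartingale D that by blast
    show ?thesis
      using V.AE_convergent
    proof eventually_elim
      case (elim \<omega>)
      then obtain l where "(\<lambda>n. (norm (x n \<omega> - z))\<^sup>2) \<longlonglongrightarrow> l"
        unfolding convergent_def by blast
      then have "(\<lambda>n. sqrt ((norm (x n \<omega> - z))\<^sup>2)) \<longlonglongrightarrow> sqrt l"
        by (rule tendsto_real_sqrt)
      then show ?case
        unfolding convergent_def by auto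
    qed
  qed
  then have "AE \<omega> in M. \<forall>z\<in>D. convergent (\<lambda>n. norm (x n \<omega> - z))"
    using D(1) by (simp add: AE_ball_countable)
  then show ?thesis
  proof eventually_elim
    case (elim \<omega>)
    then show ?case
      using D(3) convergent_dist_dense[of D "\<lambda>n. x n \<omega>"] by blast
  qed
qed

lemma AE_bounded: "AE \<omega> in M. bounded (range (\<lambda>n. x n \<omega>))"
  using AE_convergent_norm
proof eventually_elim
  case (elim \<omega>)
  obtain z where "z \<in> Z"
    using Z(2) by blast
  then have "Bseq (\<lambda>n. norm (x n \<omega> - z))"
    using elim convergent_imp_Bseq by blast
  then obtain K where "\<And>n. norm (x n \<omega> - z) \<le> K"
    unfolding Bseq_def by auto
  then have "norm (x n \<omega>) \<le> norm z + K" for n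
    using norm_triangle_sub[of "x n \<omega>" z] by (smt (verit))
  then show ?case
    unfolding bounded_iff by blast
qed

text \<open>With the whole space as event, the decrease inequality telescopes; the squared distances
  are nonnegative and the noise is summable.\<close>

lemma summable_steps:
  "summable (\<lambda>n. (LINT \<omega>|M. lam n \<omega> * (2 - lam n \<omega>)) * expectation (\<lambda>\<omega>. (norm (d n \<omega>))\<^sup>2))"
proof -
  obtain z where z: "z \<in> Z"
    using Z(2) by blast
  define v where "v n = expectation (\<lambda>\<omega>. (norm (x n \<omega> - z))\<^sup>2)" for n
  define p where "p n = (LINT \<omega>|M. lam n \<omega> * (2 - lam n \<omega>)) * expectation (\<lambda>\<omega>. (norm (d n \<omega>))\<^sup>2)" for n
  have v_nonneg: "0 \<le> v n" for n
    unfolding v_def by simp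
  have "v (Suc n) \<le> v n - p n + noise n z" for n
  proof -
    have "space M \<in> sets (\<X> n)"
      using \<X>_subalgebra[of n] sets.top[of "\<X> n"] unfolding subalgebra_def by simp
    from quasi_fejer[OF z this] show ?thesis
      using x_diff_Lp2 d_Lp2 unfolding v_def p_def by (simp add: set_integral_space Lp2_iff)
  qed
  then have step: "p n \<le> v n - v (Suc n) + noise n z" for n
    by (simp add: algebra_simps)
  have p0: "0 \<le> p n" for n
    using lam[of n] unfolding p_def by simp
  have "summable p"
  proof (rule bounded_imp_summable[OF p0])
    fix n
    have "(\<Sum>k\<le>n. p k) \<le> (\<Sum>k\<le>n. (v k - v (Suc k)) + noise k z)"
      using step by (intro sum_mono)
    also have "\<dots> = v 0 - v (Suc n) + (\<Sum>k\<le>n. noise k z)"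
      by (simp add: sum.distrib sum_telescope)
    also have "\<dots> \<le> v 0 + (\<Sum>k. noise k z)"
      using sum_le_suminf[OF noise_summable[OF z], of "{..n}"] noise_nonneg v_nonneg[of "Suc n"]
      by simp
    finally show "(\<Sum>k\<le>n. p k) \<le> v 0 + (\<Sum>k. noise k z)" .
  qed
  then show ?thesis
    unfolding p_def .
qed

section \<open>Summability of the steps and vanishing of the separation gap\<close>

lemma nn_integral_d: "(\<integral>\<^sup>+ \<omega>. ennreal ((norm (d n \<omega>))\<^sup>2) \<partial>M) = ennreal (expectation (\<lambda>\<omega>. (norm (d n \<omega>))\<^sup>2))"
  using d_Lp2[of n] by (intro nn_integral_eq_integral) (auto simp: Lp2_iff)

lemma suminf_steps_finite:
  "(\<Sum>n. ennreal (LINT \<omega>|M. lam n \<omega> * (2 - lam n \<omega>)) *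
     (\<integral>\<^sup>+ \<omega>. ennreal ((norm (d n \<omega>))\<^sup>2) \<partial>M)) < \<infinity>"
  using summable_steps lam
  by (simp add: nn_integral_d ennreal_mult[symmetric] suminf_ennreal2 less_top[symmetric])

lemma summable_d:
  assumes "(INF n. LINT \<omega>|M. lam n \<omega> * (2 - lam n \<omega>)) > 0"
  shows "summable (\<lambda>n. expectation (\<lambda>\<omega>. (norm (d n \<omega>))\<^sup>2))"
proof -
  let ?p = "\<lambda>n. LINT \<omega>|M. lam n \<omega> * (2 - lam n \<omega>)"
  have "bdd_below (range ?p)"
    using lam by (intro bdd_belowI[of _ 0]) auto
  then have "(INF n. ?p n) \<le> ?p n" for n
    by (intro cINF_lower) auto
  then have "(INF n. ?p n) * expectation (\<lambda>\<omega>. (norm (d n \<omega>))\<^sup>2) \<le> ?p n * expectation (\<lambda>\<omega>. (norm (d n \<omega>))\<^sup>2)" for n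
    by (intro mult_right_mono) auto
  then have "summable (\<lambda>n. (INF n. ?p n) * expectation (\<lambda>\<omega>. (norm (d n \<omega>))\<^sup>2))"
    using assms by (intro summable_comparison_test[OF _ summable_steps]) auto
  then show ?thesis
    using assms by (subst (asm) summable_cmult_iff) auto
qed

lemma suminf_increments_finite:
  assumes "(INF n. LINT \<omega>|M. lam n \<omega> * (2 - lam n \<omega>)) > 0"
  shows "(\<Sum>n. \<integral>\<^sup>+ \<omega>. ennreal ((norm (x (Suc n) \<omega> - x n \<omega>))\<^sup>2) \<partial>M) < \<infinity>"
proof -
  have "(\<integral>\<^sup>+ \<omega>. ennreal ((norm (x (Suc n) \<omega> - x n \<omega>))\<^sup>2) \<partial>M) \<le>
      ennreal (\<rho>\<^sup>2 * expectation (\<lambda>\<omega>. (norm (d n \<omega>))\<^sup>2))" for n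
  proof -
    have "(\<integral>\<^sup>+ \<omega>. ennreal ((norm (x (Suc n) \<omega> - x n \<omega>))\<^sup>2) \<partial>M) \<le>
        (\<integral>\<^sup>+ \<omega>. ennreal (\<rho>\<^sup>2) * ennreal ((norm (d n \<omega>))\<^sup>2) \<partial>M)"
    proof (rule nn_integral_mono_AE)
      show "AE \<omega> in M. ennreal ((norm (x (Suc n) \<omega> - x n \<omega>))\<^sup>2) \<le> ennreal (\<rho>\<^sup>2) * ennreal ((norm (d n \<omega>))\<^sup>2)"
        using step8(2)[of n] step9[of n]
      proof eventually_elim
        case (elim \<omega>)
        have "(norm (x (Suc n) \<omega> - x n \<omega>))\<^sup>2 = (lam n \<omega>)\<^sup>2 * (norm (d n \<omega>))\<^sup>2"
          using elim(2) by (simp add: power_mult_distrib)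
        also have "\<dots> \<le> \<rho>\<^sup>2 * (norm (d n \<omega>))\<^sup>2"
          using elim(1) by (intro mult_right_mono power_mono) auto
        finally show ?case
          by (simp add: ennreal_leI flip: ennreal_mult)
      qed
    qed
    also have "\<dots> = ennreal (\<rho>\<^sup>2) * ennreal (expectation (\<lambda>\<omega>. (norm (d n \<omega>))\<^sup>2))"
      by (subst nn_integral_cmult) (auto simp: nn_integral_d)
    finally show ?thesis
      by (simp add: ennreal_mult)
  qed
  then have "(\<Sum>n. \<integral>\<^sup>+ \<omega>. ennreal ((norm (x (Suc n) \<omega> - x n \<omega>))\<^sup>2) \<partial>M) \<le>
      (\<Sum>n. ennreal (\<rho>\<^sup>2 * expectation (\<lambda>\<omega>. (norm (d n \<omega>))\<^sup>2)))"
    by (intro suminf_le summableI)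
  also have "\<dots> < \<infinity>"
    using summable_mult[OF summable_d[OF assms], of "\<rho>\<^sup>2"]
    by (subst suminf_ennreal2) auto
  finally show ?thesis .
qed

text \<open>Summability of the expected squared steps makes \<open>d n\<close> tend to 0 almost
  surely, and \<open>\<Delta> n\<close> is at most
  \<open>norm (d n \<omega>) * norm (t' n \<omega>)\<close> with the second factor bounded along the
  path.\<close>

lemma AE_limsup_le:
  assumes "(INF n. LINT \<omega>|M. lam n \<omega> * (2 - lam n \<omega>)) > 0"
    and "AE \<omega> in M. bounded (range (\<lambda>n. t' n \<omega>))"
  shows "AE \<omega> in M. limsup (\<lambda>n. ereal (\<Delta> n \<omega>)) \<le> 0"
proof -
  have "(\<integral>\<^sup>+ \<omega>. (\<Sum>n. ennreal ((norm (d n \<omega>))\<^sup>2)) \<partial>M) = (\<Sum>n. ennreal (expectation (\<lambda>\<omega>. (norm (d n \<omega>))\<^sup>2)))"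
    by (subst nn_integral_suminf) (auto simp: nn_integral_d)
  also have "\<dots> \<noteq> \<infinity>"
    using summable_d[OF assms(1)] by (subst suminf_ennreal2) auto
  finally have "AE \<omega> in M. (\<Sum>n. ennreal ((norm (d n \<omega>))\<^sup>2)) \<noteq> \<infinity>"
    by (intro nn_integral_PInf_AE) auto
  moreover have "AE \<omega> in M. \<forall>n. \<Delta> n \<omega> \<le> norm (d n \<omega>) * norm (t' n \<omega>)"
    unfolding AE_all_countable using AE_step by (auto elim: eventually_mono)
  ultimately show ?thesis
    using assms(2)
  proof eventually_elim
    case (elim \<omega>)
    obtain K where K: "\<And>n. norm (t' n \<omega>) \<le> K"
      using elim(3) unfolding bounded_iff by auto
    have "summable (\<lambda>n. (norm (d n \<omega>))\<^sup>2)"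
      using elim(1) by (intro summable_suminf_not_top) auto
    then have "(\<lambda>n. sqrt ((norm (d n \<omega>))\<^sup>2)) \<longlonglongrightarrow> sqrt 0"
      by (intro tendsto_real_sqrt summable_LIMSEQ_zero)
    then have "(\<lambda>n. norm (d n \<omega>) * K) \<longlonglongrightarrow> 0"
      by (intro tendsto_mult_left_zero) simp
    then have "limsup (\<lambda>n. ereal (norm (d n \<omega>) * K)) = 0"
      by (intro lim_imp_Limsup) (auto simp: zero_ereal_def)
    moreover have "limsup (\<lambda>n. ereal (\<Delta> n \<omega>)) \<le> limsup (\<lambda>n. ereal (norm (d n \<omega>) * K))"
    proof (intro Limsup_mono always_eventually allI)
      fix n
      have "norm (d n \<omega>) * norm (t' n \<omega>) \<le> norm (d n \<omega>) * K"
        using K by (intro mult_left_mono) auto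
      then show "ereal (\<Delta> n \<omega>) \<le> ereal (norm (d n \<omega>) * K)"
        using elim(2) by (auto intro: order_trans)
    qed
    ultimately show ?case
      by simp
  qed
qed

section \<open>Convergence of the iterates to a zero\<close>

lemma AE_graph: "AE \<omega> in M. \<forall>n. w' n \<omega> + e' n \<omega> \<in> W (w n \<omega> + e n \<omega>)"
  unfolding AE_all_countable using step2(5) by (simp add: gra_def)

text \<open>Completeness of \<open>M\<close> makes the pointwise weak limit, chosen arbitrarily off a null set,
  measurable.\<close>

lemma weakly_convergent:
  assumes "AE \<omega> in M. weakly_converges (\<lambda>n. x n \<omega> - w n \<omega> - e n \<omega>) 0"
    and "AE \<omega> in M. (\<lambda>n. w n \<omega> + e n \<omega> - q n \<omega>) \<longlonglongrightarrow> 0"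
    and "AE \<omega> in M. (\<lambda>n. w' n \<omega> + e' n \<omega> + C (q n \<omega>)) \<longlonglongrightarrow> 0"
  shows "\<exists>y \<in> borel_measurable M. (AE \<omega> in M. y \<omega> \<in> Z) \<and>
    (AE \<omega> in M. weakly_converges (\<lambda>n. x n \<omega>) (y \<omega>)) \<and> L2_weakly_converges M x y"
proof -
  have "AE \<omega> in M. \<exists>y\<in>Z. weakly_converges (\<lambda>n. x n \<omega>) y"
    using assms AE_convergent_norm AE_graph
  proof eventually_elim
    case (elim \<omega>)
    show ?case
    proof (rule opial[OF Z(2)])
      show "convergent (\<lambda>n. norm (x n \<omega> - z))" if "z \<in> Z" for z
        using elim(4) that by blast
      fix r :: "nat \<Rightarrow> nat" and y
      assume r: "strict_mono r" and y: "weakly_converges ((\<lambda>n. x n \<omega>) \<circ> r) y"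
      \<comment> \<open>The cluster point is carried over from \<open>x\<close> to
        \<open>w + e\<close>, the point at which \<open>W\<close> is evaluated.\<close>
      have "weakly_converges (\<lambda>n. x (r n) \<omega> - (x (r n) \<omega> - w (r n) \<omega> - e (r n) \<omega>)) (y - 0)"
        using weakly_converges_diff[OF y weakly_converges_subseq[OF elim(1) r]] by (simp add: o_def)
      then have a: "weakly_converges (\<lambda>n. w (r n) \<omega> + e (r n) \<omega>) y"
        by (simp add: algebra_simps)
      have "(\<lambda>n. w (r n) \<omega> + e (r n) \<omega> - q (r n) \<omega>) \<longlonglongrightarrow> 0"
        "(\<lambda>n. w' (r n) \<omega> + e' (r n) \<omega> + C (q (r n) \<omega>)) \<longlonglongrightarrow> 0"
        using LIMSEQ_subseq_LIMSEQ[OF elim(2) r] LIMSEQ_subseq_LIMSEQ[OF elim(3) r] by (simp_all add: o_def)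
      moreover obtain z where "z \<in> Z"
        using Z(2) by blast
      ultimately show "y \<in> Z"
        unfolding Z(1) using elim(5) by (intro zer_operator_plus_demiclosed[OF W C \<alpha> _ a]) auto
    qed
  qed
  moreover define y where "y \<omega> = (SOME v. v \<in> Z \<and> weakly_converges (\<lambda>n. x n \<omega>) v)" for \<omega>
  ultimately have y: "AE \<omega> in M. y \<omega> \<in> Z \<and> weakly_converges (\<lambda>n. x n \<omega>) (y \<omega>)"
    by (auto simp: y_def intro: someI2_ex elim!: eventually_mono)
  have "y \<in> borel_measurable M"
  proof (rule borel_measurable_if_inner)
    fix u
    have "AE \<omega> in M. lim (\<lambda>n. inner (x n \<omega>) u) = inner (y \<omega>) u"
      using y by eventually_elim (auto simp: weakly_converges_def intro: limI)
    then show "(\<lambda>\<omega>. inner (y \<omega>) u) \<in> borel_measurable M"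
      by (rule measurable_AE_cong) auto
  qed
  moreover obtain K where "\<And>n. expectation (\<lambda>\<omega>. (norm (x n \<omega>))\<^sup>2) \<le> K"
    using expectation_norm_squared_bounded by blast
  ultimately have "L2_weakly_converges M x y"
    using y by (intro AE_weakly_converges_imp_L2_weakly_converges[OF x_Lp2]) auto
  with \<open>y \<in> borel_measurable M\<close> y show ?thesis
    by (intro bexI[of _ y]) auto
qed

lemma C_measurable: "C \<in> borel_measurable borel"
proof (rule borel_measurable_continuous_onI)
  have "(1 / \<alpha>)-lipschitz_on UNIV C"
    using cocoercive_lipschitz[OF C \<alpha>] \<alpha> by (intro lipschitz_onI) (auto simp: dist_norm)
  then show "continuous_on UNIV C"
    by (rule lipschitz_on_continuous_on)
qed

text \<open>The residuals vanish almost surely only along \<open>r\<close>. A further subsequence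
  has a strong limit \<open>v\<close> in \<open>Z\<close>; since the distance from
  \<open>x n\<close> to \<open>v\<close> converges along the whole sequence, its limit must be
  0.\<close>

lemma strongly_convergent_finite_dim:
  assumes B: "finite (B :: 'a set)" "span B = UNIV"
    and "converges_in_probability M (\<lambda>n \<omega>. x n \<omega> - w n \<omega> - e n \<omega>) (\<lambda>_. 0)"
    and "converges_in_probability M (\<lambda>n \<omega>. w n \<omega> + e n \<omega> - q n \<omega>) (\<lambda>_. 0)"
    and "converges_in_probability M (\<lambda>n \<omega>. w' n \<omega> + e' n \<omega> + C (q n \<omega>)) (\<lambda>_. 0)"
  shows "\<exists>y \<in> borel_measurable M. (AE \<omega> in M. y \<omega> \<in> Z) \<and>
    (AE \<omega> in M. (\<lambda>n. x n \<omega>) \<longlonglongrightarrow> y \<omega>) \<and> Lp_converges 1 M x y"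
proof -
  note C_measurable [measurable]
  obtain r :: "nat \<Rightarrow> nat" where r: "strict_mono r" and ae: "AE \<omega> in M.
      (\<lambda>n. x (r n) \<omega> - w (r n) \<omega> - e (r n) \<omega>) \<longlonglongrightarrow> 0 \<and>
      (\<lambda>n. w (r n) \<omega> + e (r n) \<omega> - q (r n) \<omega>) \<longlonglongrightarrow> 0 \<and>
      (\<lambda>n. w' (r n) \<omega> + e' (r n) \<omega> + C (q (r n) \<omega>)) \<longlonglongrightarrow> 0"
    using converges_in_probability_AE_subseq3[OF _ _ _ assms(3-5)] by (auto simp: measurable_compose)
  \<comment> \<open>Strong convergence permits \<open>lim\<close>, which is measurable as a limit of
    the iterates.\<close>
  define y where "y \<omega> = lim (\<lambda>n. x n \<omega>)" for \<omega>
  have [measurable]: "y \<in> borel_measurable M"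
    unfolding y_def by measurable
  have y: "AE \<omega> in M. y \<omega> \<in> Z \<and> (\<lambda>n. x n \<omega>) \<longlonglongrightarrow> y \<omega>"
    using ae AE_convergent_norm AE_bounded AE_graph
  proof eventually_elim
    case (elim \<omega>)
    have "bounded (range (\<lambda>n. x (r n) \<omega>))"
      using elim(3) by (rule bounded_subset) auto
    from weakly_convergent_subsequence[OF this] obtain s v
      where s: "strict_mono (s :: nat \<Rightarrow> nat)" and v: "weakly_converges (\<lambda>n. x (r (s n)) \<omega>) v"
      by (auto simp: o_def)
    have sub: "(\<lambda>n. x (r (s n)) \<omega> - w (r (s n)) \<omega> - e (r (s n)) \<omega>) \<longlonglongrightarrow> 0"
      "(\<lambda>n. w (r (s n)) \<omega> + e (r (s n)) \<omega> - q (r (s n)) \<omega>) \<longlonglongrightarrow> 0"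
      "(\<lambda>n. w' (r (s n)) \<omega> + e' (r (s n)) \<omega> + C (q (r (s n)) \<omega>)) \<longlonglongrightarrow> 0"
      using elim(1) LIMSEQ_subseq_LIMSEQ[OF _ s] by (fastforce simp: o_def)+
    have "weakly_converges (\<lambda>n. x (r (s n)) \<omega> - (x (r (s n)) \<omega> - w (r (s n)) \<omega> - e (r (s n)) \<omega>)) (v - 0)"
      by (intro weakly_converges_diff v tendsto_imp_weakly_converges sub(1))
    then have a: "weakly_converges (\<lambda>n. w (r (s n)) \<omega> + e (r (s n)) \<omega>) v"
      by (simp add: algebra_simps)
    obtain z where "z \<in> Z"
      using Z(2) by blast
    then have "v \<in> Z"
      unfolding Z(1) using elim(4) sub
      by (intro zer_operator_plus_demiclosed[OF W C \<alpha> _ a]) auto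
    then obtain l where l: "(\<lambda>n. norm (x n \<omega> - v)) \<longlonglongrightarrow> l"
      using elim(2) unfolding convergent_def by blast
    have "(\<lambda>n. x (r (s n)) \<omega>) \<longlonglongrightarrow> v"
      by (rule finite_dim_weakly_converges_imp_tendsto[OF B v])
    then have "(\<lambda>n. norm (x (r (s n)) \<omega> - v)) \<longlonglongrightarrow> 0"
      by (intro tendsto_norm_zero LIM_zero)
    moreover have "(\<lambda>n. norm (x (r (s n)) \<omega> - v)) \<longlonglongrightarrow> l"
      using LIMSEQ_subseq_LIMSEQ[OF l strict_mono_o[OF r s]] by (simp add: o_def)
    ultimately have "l = 0"
      using LIMSEQ_unique by blast
    then have "(\<lambda>n. x n \<omega>) \<longlonglongrightarrow> v"
      using l by (simp add: tendsto_norm_zero_iff LIM_zero_iff)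
    then show ?case
      using \<open>v \<in> Z\<close> unfolding y_def by (simp add: limI)
  qed
  obtain K where "\<And>n. expectation (\<lambda>\<omega>. (norm (x n \<omega>))\<^sup>2) \<le> K"
    using expectation_norm_squared_bounded by blast
  then have "Lp_converges 1 M x y"
    using y by (intro AE_tendsto_imp_Lp_converges_1[OF x_Lp2]) auto
  with y show ?thesis
    by (intro bexI[of _ y]) auto
qed

end

end

theorem theorem3p1:
  fixes M :: "'w measure"
    and W :: "'a::{real_inner, banach, second_countable_topology} \<Rightarrow> 'a set"
    and C :: "'a \<Rightarrow> 'a"
    and \<alpha> \<rho> :: real
    and Z :: "'a set"
    and \<X> :: "nat \<Rightarrow> 'w measure"
    and x w w' e e' q c' f' t' d :: "nat \<Rightarrow> 'w \<Rightarrow> 'a"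
    and \<Delta> \<theta> lam :: "nat \<Rightarrow> 'w \<Rightarrow> real"
    and \<epsilon> :: "nat \<Rightarrow> 'a \<Rightarrow> 'w \<Rightarrow> ereal"
  assumes "prob_space M" and "complete_measure M"
    and W: "maximally_monotone W"
    and \<alpha>: "0 < \<alpha>"
    and C: "cocoercive \<alpha> C"
    and Z: "Z = zer (operator_plus W C)" "Z \<noteq> {}"
    and \<rho>: "2 \<le> \<rho>"
    and x0: "x 0 \<in> Lp 2 M"
    and step1: "\<And>n. \<X> n = sigma_rv M (x ` {..n})"
    and step2: "\<And>n. w n \<in> Lp 2 M" "\<And>n. w' n \<in> Lp 2 M" "\<And>n. e n \<in> Lp 2 M" "\<And>n. e' n \<in> Lp 2 M"
      "\<And>n. AE \<omega> in M. (w n \<omega> + e n \<omega>, w' n \<omega> + e' n \<omega>) \<in> gra W"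
    and step3: "\<And>n. q n \<in> Lp 2 M" "\<And>n. c' n \<in> Lp 2 M" "\<And>n. f' n \<in> Lp 2 M"
      "\<And>n. AE \<omega> in M. c' n \<omega> + f' n \<omega> = C (q n \<omega>)"
    and step4: "\<And>n. AE \<omega> in M. t' n \<omega> = w' n \<omega> + c' n \<omega>"
    and step5: "\<And>n. AE \<omega> in M.
      \<Delta> n \<omega> = inner (x n \<omega> - w n \<omega>) (t' n \<omega>) - inverse (4 * \<alpha>) * (norm (w n \<omega> - q n \<omega>))\<^sup>2"
    and step6: "\<And>n. AE \<omega> in M.
      \<theta> n \<omega> = of_bool (t' n \<omega> \<noteq> 0) * of_bool (\<Delta> n \<omega> > 0) * \<Delta> n \<omega> /
              ((norm (t' n \<omega>))\<^sup>2 + of_bool (t' n \<omega> = 0))"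
    and step7: "\<And>n. AE \<omega> in M. d n \<omega> = \<theta> n \<omega> *\<^sub>R t' n \<omega>"
    and step8: "\<And>n. lam n \<in> borel_measurable M" "\<And>n. AE \<omega> in M. 0 < lam n \<omega> \<and> lam n \<omega> \<le> \<rho>"
    and step9: "\<And>n. AE \<omega> in M. x (Suc n) \<omega> = x n \<omega> - lam n \<omega> *\<^sub>R d n \<omega>"
    and \<epsilon>: "\<And>n z. z \<in> Z \<Longrightarrow> AE \<omega> in M.
      \<epsilon> n z \<omega> = max 0 (ereal_cond_exp M (\<X> n)
        (\<lambda>\<omega>. \<theta> n \<omega> * (inner (w n \<omega> - z) (e' n \<omega> + f' n \<omega>) +
                    inner (e n \<omega>) (w' n \<omega> + C z) + inner (e n \<omega>) (e' n \<omega>))) \<omega>)"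
    and indep: "\<And>n. prob_space.indep_set M
      (sets (sigma_rv M {lam n})) (sets (sigma_rv M (x ` {..n} \<union> {d n})))"
    and lam: "\<And>n. 0 \<le> (LINT \<omega>|M. lam n \<omega> * (2 - lam n \<omega>))"
  shows
    "(\<forall>n. \<forall>z \<in> Z. AE \<omega> in M.
        ereal (inner z (cond_exp M (\<X> n) (\<lambda>\<omega>. \<theta> n \<omega> *\<^sub>R t' n \<omega>) \<omega>)) \<le>
        ereal (real_cond_exp M (\<X> n) (\<lambda>\<omega>. \<theta> n \<omega> * inner (w n \<omega>) (t' n \<omega>)) \<omega> +
               1 / (4 * \<alpha>) * real_cond_exp M (\<X> n) (\<lambda>\<omega>. \<theta> n \<omega> * (norm (w n \<omega> - q n \<omega>))\<^sup>2) \<omega>)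
        + \<epsilon> n z \<omega>)
   \<and> (\<forall>n. x n \<in> Lp 2 M)
   \<and> ((\<forall>z \<in> Z. (\<Sum>n. (\<integral>\<^sup>+ \<omega>. e2ennreal (\<epsilon> n z \<omega>) \<partial>M) * ennreal (LINT \<omega>|M. lam n \<omega>)) < \<infinity>) \<longrightarrow>
        ((AE \<omega> in M. bounded (range (\<lambda>n. norm (x n \<omega>)))) \<and>
         bounded (range (\<lambda>n. LINT \<omega>|M. (norm (x n \<omega>))\<^sup>2)))
      \<and> (\<Sum>n. ennreal (LINT \<omega>|M. lam n \<omega> * (2 - lam n \<omega>)) *
              (\<integral>\<^sup>+ \<omega>. ennreal ((norm (d n \<omega>))\<^sup>2) \<partial>M)) < \<infinity>
      \<and> ((INF n. LINT \<omega>|M. lam n \<omega> * (2 - lam n \<omega>)) > 0 \<longrightarrow>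
          (\<Sum>n. \<integral>\<^sup>+ \<omega>. ennreal ((norm (x (Suc n) \<omega> - x n \<omega>))\<^sup>2) \<partial>M) < \<infinity>)
      \<and> ((INF n. LINT \<omega>|M. lam n \<omega> * (2 - lam n \<omega>)) > 0 \<and>
         (AE \<omega> in M. (INF n. lam n \<omega>) > 0) \<and>
         (AE \<omega> in M. bounded (range (\<lambda>n. t' n \<omega>))) \<longrightarrow>
          (AE \<omega> in M. limsup (\<lambda>n. ereal (\<Delta> n \<omega>)) \<le> 0))
      \<and> ((AE \<omega> in M. weakly_converges (\<lambda>n. x n \<omega> - w n \<omega> - e n \<omega>) 0) \<and>
         (AE \<omega> in M. (\<lambda>n. w n \<omega> + e n \<omega> - q n \<omega>) \<longlonglongrightarrow> 0) \<and>
         (AE \<omega> in M. (\<lambda>n. w' n \<omega> + e' n \<omega> + C (q n \<omega>)) \<longlonglongrightarrow> 0) \<longrightarrow>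
          (\<exists>y \<in> borel_measurable M. (AE \<omega> in M. y \<omega> \<in> Z) \<and>
            (AE \<omega> in M. weakly_converges (\<lambda>n. x n \<omega>) (y \<omega>)) \<and>
            L2_weakly_converges M x y))
      \<and> ((\<exists>B::'a set. finite B \<and> span B = UNIV) \<and>
         converges_in_probability M (\<lambda>n \<omega>. x n \<omega> - w n \<omega> - e n \<omega>) (\<lambda>_. 0) \<and>
         converges_in_probability M (\<lambda>n \<omega>. w n \<omega> + e n \<omega> - q n \<omega>) (\<lambda>_. 0) \<and>
         converges_in_probability M (\<lambda>n \<omega>. w' n \<omega> + e' n \<omega> + C (q n \<omega>)) (\<lambda>_. 0) \<longrightarrow>
          (\<exists>y \<in> borel_measurable M. (AE \<omega> in M. y \<omega> \<in> Z) \<and>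
            (AE \<omega> in M. (\<lambda>n. x n \<omega>) \<longlonglongrightarrow> y \<omega>) \<and>
            Lp_converges 1 M x y)))"
proof -
  interpret prob_space M by fact
  interpret complete_measure M by fact
  interpret stochastic_splitting M W C \<alpha> \<rho> Z \<X> x w w' e e' q c' f' t' d \<Delta> \<theta> lam \<epsilon>
    by unfold_locales (fact assms)+

  show ?thesis
  proof (intro conjI impI ballI allI)
    fix n z assume "z \<in> Z"
    then show "AE \<omega> in M.
        ereal (inner z (cond_exp M (\<X> n) (\<lambda>\<omega>. \<theta> n \<omega> *\<^sub>R t' n \<omega>) \<omega>)) \<le>
        ereal (real_cond_exp M (\<X> n) (\<lambda>\<omega>. \<theta> n \<omega> * inner (w n \<omega>) (t' n \<omega>)) \<omega> +
               1 / (4 * \<alpha>) * real_cond_exp M (\<X> n) (\<lambda>\<omega>. \<theta> n \<omega> * (norm (w n \<omega> - q n \<omega>))\<^sup>2) \<omega>)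
        + \<epsilon> n z \<omega>"
      by (rule cond_exp_bound)
  next
    show "x n \<in> Lp 2 M" for n
      by (rule x_Lp2)
  next
    assume errors: "\<forall>z\<in>Z. (\<Sum>n. (\<integral>\<^sup>+ \<omega>. e2ennreal (\<epsilon> n z \<omega>) \<partial>M) * ennreal (LINT \<omega>|M. lam n \<omega>)) < \<infinity>"
    show "AE \<omega> in M. bounded (range (\<lambda>n. norm (x n \<omega>)))"
      using AE_bounded[OF errors] by eventually_elim (simp add: bounded_iff)
    obtain K where "\<And>n. expectation (\<lambda>\<omega>. (norm (x n \<omega>))\<^sup>2) \<le> K"
      using expectation_norm_squared_bounded[OF errors] by blast
    then show "bounded (range (\<lambda>n. LINT \<omega>|M. (norm (x n \<omega>))\<^sup>2))"
      unfolding bounded_iff by auto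
    show "(\<Sum>n. ennreal (LINT \<omega>|M. lam n \<omega> * (2 - lam n \<omega>)) *
        (\<integral>\<^sup>+ \<omega>. ennreal ((norm (d n \<omega>))\<^sup>2) \<partial>M)) < \<infinity>"
      using suminf_steps_finite[OF errors] .
    show "(\<Sum>n. \<integral>\<^sup>+ \<omega>. ennreal ((norm (x (Suc n) \<omega> - x n \<omega>))\<^sup>2) \<partial>M) < \<infinity>"
      if "(INF n. LINT \<omega>|M. lam n \<omega> * (2 - lam n \<omega>)) > 0"
      using suminf_increments_finite[OF errors that] .
    show "AE \<omega> in M. limsup (\<lambda>n. ereal (\<Delta> n \<omega>)) \<le> 0"
      if "(INF n. LINT \<omega>|M. lam n \<omega> * (2 - lam n \<omega>)) > 0 \<and>
         (AE \<omega> in M. (INF n. lam n \<omega>) > 0) \<and>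
         (AE \<omega> in M. bounded (range (\<lambda>n. t' n \<omega>)))"
      using AE_limsup_le[OF errors] that by blast
    show "\<exists>y \<in> borel_measurable M. (AE \<omega> in M. y \<omega> \<in> Z) \<and>
        (AE \<omega> in M. weakly_converges (\<lambda>n. x n \<omega>) (y \<omega>)) \<and> L2_weakly_converges M x y"
      if "(AE \<omega> in M. weakly_converges (\<lambda>n. x n \<omega> - w n \<omega> - e n \<omega>) 0) \<and>
         (AE \<omega> in M. (\<lambda>n. w n \<omega> + e n \<omega> - q n \<omega>) \<longlonglongrightarrow> 0) \<and>
         (AE \<omega> in M. (\<lambda>n. w' n \<omega> + e' n \<omega> + C (q n \<omega>)) \<longlonglongrightarrow> 0)"
      using weakly_convergent[OF errors] that by blast
    show "\<exists>y \<in> borel_measurable M. (AE \<omega> in M. y \<omega> \<in> Z) \<and>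
        (AE \<omega> in M. (\<lambda>n. x n \<omega>) \<longlonglongrightarrow> y \<omega>) \<and> Lp_converges 1 M x y"
      if "(\<exists>B::'a set. finite B \<and> span B = UNIV) \<and>
         converges_in_probability M (\<lambda>n \<omega>. x n \<omega> - w n \<omega> - e n \<omega>) (\<lambda>_. 0) \<and>
         converges_in_probability M (\<lambda>n \<omega>. w n \<omega> + e n \<omega> - q n \<omega>) (\<lambda>_. 0) \<and>
         converges_in_probability M (\<lambda>n \<omega>. w' n \<omega> + e' n \<omega> + C (q n \<omega>)) (\<lambda>_. 0)"
      using strongly_convergent_finite_dim[OF errors] that by blast
  qed
qed

end
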